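(* Let $\mathcal A$ be an $A_\infty$-category, let $\mathcal S$ be the full $A_\infty$-subcategory of $\mathrm{Tw}(k[t,t^{-1}]\otimes_k\mathcal A)$ on the objects of the form $(\bigoplus_{i\in I}X_i[0],\delta)$, and let $\iota:\mathcal S\to\mathrm{Tw}(k[t,t^{-1}]\otimes_k\mathcal A)$ be the inclusion functor. The functor $Z^0(\iota)$ has a retraction (left inverse) and is an equivalence of categories. Furthermore, $\iota$ is a quasi-equivalence.
   Context: $k$ is a field and all categories are $k$-linear. $A_\infty$-categories follow Seidel's conventions: graded Hom spaces, structure maps $\mu^d$ of degree $2-d$ ($d\ge 1$), $|a|$ the degree of a homogeneous morphism $a$ and $\|a\|=|a|-1$, with relations $\sum_{m,n}(-1)^{\|a_1\|+\dots+\|a_n\|}\mu^{d-m+1}(a_d,\dots,a_{n+m+1},\mu^m(a_{n+m},\dots,a_{n+1}),a_n,\dots,a_1)=0$. All $A_\infty$-categories are strictly unital and all $A_\infty$-functors are strict and unital. $Z^0(\mathcal A)$ has the objects of $\mathcal A$, morphisms the degree-$0$ morphisms $f$ with $\mu^1(f)=0$, and composition given by $\mu^2$; $H^0(\mathcal A)$ has the same objects and morphisms the degree-$0$ cohomology of $(\mathrm{Hom}_{\mathcal A},\mu^1)$. Both are functorial in $A_\infty$-functors. A quasi-equivalence is an $A_\infty$-functor inducing an equivalence on cohomology categories. Category $\mathbb Z\mathcal A$: objects are formal finite direct sums $\bigoplus_{i\in I}X_i[p_i]$ with $X_i\in\mathcal A$, $p_i\in\mathbb Z$; $\mathrm{Hom}_{\mathbb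 Z\mathcal A}(X[p],Y[q])=\mathrm{Hom}_{\mathrm{gr}\,k}(k[p],k[q])\otimes_k\mathrm{Hom}_{\mathcal A}(X,Y)$ is spanned by elements $s^p_q\otimes a$ of degree $p-q+|a|$, where $s^p_q$ is the identity map $k[p]\to k[q]$, of degree $p-q$ (morphisms between direct sums are matrices); and $$\mu^d_{\mathbb Z\mathcal A}(s^{p_{d-1}}_{p_d}\otimes a_d,\dots,s^{p_0}_{p_1}\otimes a_1)=(-1)^{\sum_{i<j}(p_{i-1}-p_i)\|a_j\|}\,s^{p_0}_{p_d}\otimes\mu^d_{\mathcal A}(a_d,\dots,a_1).$$ Twisted complexes: objects of $\mathrm{Tw}(\mathcal A)$ are pairs $(X,\delta_X)$ with $X\in\mathbb Z\mathcal A$ and $\delta_X$ a degree $1$ endomorphism of $X$ in $\mathbb Z\mathcal A$ that is strictly lower triangular (in Seidel's sense: $X$ has a finite filtration preserved by $\delta_X$ such that $\delta_X$ induces zero on the graded pieces) and satisfies $\sum_{d>0}\mu^d_{\mathbb Z\mathcal A}(\delta_X,\dots,\delta_X)=0$. Morphism spaces are those of $\mathbb Z\mathcal A$, and $$\mu^d_{\mathrm{Tw}(\mathcal A)}(f_d,\dots,f_1)=\sum_{i_0,\dots,i_d\ge 0}\mu^{d+i_0+\dots+i_d}_{\mathbb Z\mathcal A}(\delta_{X_d}^{\otimes i_d},f_d,\delta_{X_{d-1}}^{\otimes i_{d-1}},f_{d-1},\dots,f_1,\delta_{X_0}^{\otimes i_0}).$$ Category $k[t,t^{-1}]\otimes_k\mathcal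 A$: $k[t,t^{-1}]$ is graded with $|t|=1$; objects are those of $\mathcal A$, $\mathrm{Hom}(X,Y)=k[t,t^{-1}]\otimes_k\mathrm{Hom}_{\mathcal A}(X,Y)$, units $1\otimes\mathrm{id}_X$, and $\mu^d(t^{\alpha_d}\otimes a_d,\dots,t^{\alpha_1}\otimes a_1)=(-1)^{\sum_{i<j}\alpha_i\|a_j\|}\,t^{\alpha_d+\dots+\alpha_1}\otimes\mu^d_{\mathcal A}(a_d,\dots,a_1)$. $\mathcal S$ carries the $A_\infty$-structure induced from $\mathrm{Tw}(k[t,t^{-1}]\otimes_k\mathcal A)$.
   Formalization: Since Z⁰ with composition μ² need not be associative for a general A∞-category, functors, retraction and equivalence on Z⁰ are understood for linear categories without the associativity axiom; whenever Z⁰ is associative these are the usual notions. *)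

theory Defs
  imports Complex_Main "HOL-Library.Poly_Mapping"
begin

section \<open>Homogeneous morphisms and \<open>A\<^sub>\<infinity>\<close>-categories\<close>

text \<open>
  A homogeneous morphism is recorded together with its source, target and degree, so that the
  degree-dependent signs below are well defined on zero elements as well.
\<close>

datatype ('o, 'm) arr = Arr (src: 'o) (tgt: 'o) (deg: int) (val: 'm)

text \<open>
  A graded Hom space is the family \<open>Hom A X Y n\<close> of its homogeneous parts, which are subspaces of an
  ambient vector space \<open>'m\<close>. The maps \<open>\<mu>\<^sup>d\<close> are given on homogeneous arguments. Lists of morphisms
  are in path order: \<open>mu A [a\<^sub>1, \<dots>, a\<^sub>d]\<close> stands for \<open>\<mu>\<^sup>d(a\<^sub>d, \<dots>, a\<^sub>1)\<close>. The value of \<open>mu A []\<close> is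
  irrelevant.
\<close>

record ('k, 'o, 'm) ainf =
  Obj :: "'o set"
  Hom :: "'o \<Rightarrow> 'o \<Rightarrow> int \<Rightarrow> 'm set"
  smul :: "'k \<Rightarrow> 'm \<Rightarrow> 'm"
  mu :: "('o, 'm) arr list \<Rightarrow> 'm"
  idm :: "'o \<Rightarrow> 'm"

definition is_arr :: "('k, 'o, 'm) ainf \<Rightarrow> ('o, 'm) arr \<Rightarrow> bool" where
  "is_arr A f \<longleftrightarrow> src f \<in> Obj A \<and> tgt f \<in> Obj A \<and> val f \<in> Hom A (src f) (tgt f) (deg f)"

definition composable :: "('k, 'o, 'm) ainf \<Rightarrow> ('o, 'm) arr list \<Rightarrow> bool" where
  "composable A fs \<longleftrightarrow> fs \<noteq> [] \<and> (\<forall>f\<in>set fs. is_arr A f) \<and>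
     (\<forall>i. Suc i < length fs \<longrightarrow> tgt (fs ! i) = src (fs ! Suc i))"

definition mu_arr :: "('k, 'o, 'm) ainf \<Rightarrow> ('o, 'm) arr list \<Rightarrow> ('o, 'm) arr" where
  "mu_arr A fs =
     Arr (src (hd fs)) (tgt (last fs)) (sum_list (map deg fs) + 2 - int (length fs)) (mu A fs)"

abbreviation id_arr :: "('k, 'o, 'm) ainf \<Rightarrow> 'o \<Rightarrow> ('o, 'm) arr" where
  "id_arr A X \<equiv> Arr X X 0 (idm A X)"

text \<open>\<open>signed n x\<close> is \<open>(-1)\<^sup>n x\<close>.\<close>

definition signed :: "int \<Rightarrow> 'a::uminus \<Rightarrow> 'a" where
  "signed n x = (if even n then x else - x)"

text \<open>Strict units follow Seidel: \<open>\<mu>\<^sup>2(a, e) = a\<close> and \<open>\<mu>\<^sup>2(e, a) = (-1)\<^bsup>|a|\<^esup> a\<close>.\<close>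

locale ainf_category =
  fixes A :: "('k::field, 'o, 'm::ab_group_add) ainf"
  assumes vector_space_ambient: "vector_space (smul A)"
    and subspace_Hom:
      "X \<in> Obj A \<Longrightarrow> Y \<in> Obj A \<Longrightarrow> module.subspace (smul A) (Hom A X Y n)"
    and mu_closed: "composable A fs \<Longrightarrow> is_arr A (mu_arr A fs)"
    and mu_add:
      "composable A (fs @ Arr X Y n a # gs) \<Longrightarrow> b \<in> Hom A X Y n \<Longrightarrow>
       mu A (fs @ Arr X Y n (a + b) # gs) = mu A (fs @ Arr X Y n a # gs) + mu A (fs @ Arr X Y n b # gs)"
    and mu_smul:
      "composable A (fs @ Arr X Y n a # gs) \<Longrightarrow>
       mu A (fs @ Arr X Y n (smul A c a) # gs) = smul A c (mu A (fs @ Arr X Y n a # gs))"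
    and mu_relations:
      "composable A fs \<Longrightarrow>
       (\<Sum>n<length fs. \<Sum>m = 1..length fs - n.
          signed (\<Sum>i<n. deg (fs ! i) - 1)
            (mu A (take n fs @ [mu_arr A (take m (drop n fs))] @ drop (n + m) fs))) = 0"
    and idm_closed: "X \<in> Obj A \<Longrightarrow> idm A X \<in> Hom A X X 0"
    and mu1_idm: "X \<in> Obj A \<Longrightarrow> mu A [id_arr A X] = 0"
    and mu2_idm_right: "is_arr A f \<Longrightarrow> mu A [id_arr A (src f), f] = val f"
    and mu2_idm_left: "is_arr A f \<Longrightarrow> mu A [f, id_arr A (tgt f)] = signed (deg f) (val f)"
    and mu_idm:
      "composable A (fs @ id_arr A X # gs) \<Longrightarrow> length fs + length gs \<ge> 2 \<Longrightarrow>
       mu A (fs @ id_arr A X # gs) = 0"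

text \<open>Strict, unital \<open>A\<^sub>\<infinity>\<close>-functors, i.e. those with vanishing higher components.\<close>

record ('o, 'm, 'p, 'n) afun =
  afob :: "'o \<Rightarrow> 'p"
  afmor :: "('o, 'm) arr \<Rightarrow> 'n"

definition af_arr :: "('o, 'm, 'p, 'n) afun \<Rightarrow> ('o, 'm) arr \<Rightarrow> ('p, 'n) arr" where
  "af_arr F f = Arr (afob F (src f)) (afob F (tgt f)) (deg f) (afmor F f)"

locale ainf_functor = A: ainf_category A + B: ainf_category B
  for A :: "('k::field, 'o, 'm::ab_group_add) ainf"
    and B :: "('k, 'p, 'n::ab_group_add) ainf" +
  fixes F :: "('o, 'm, 'p, 'n) afun"
  assumes afob_closed: "X \<in> Obj A \<Longrightarrow> afob F X \<in> Obj B"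
    and af_arr_closed: "is_arr A f \<Longrightarrow> is_arr B (af_arr F f)"
    and afmor_add:
      "X \<in> Obj A \<Longrightarrow> Y \<in> Obj A \<Longrightarrow> a \<in> Hom A X Y n \<Longrightarrow> b \<in> Hom A X Y n \<Longrightarrow>
       afmor F (Arr X Y n (a + b)) = afmor F (Arr X Y n a) + afmor F (Arr X Y n b)"
    and afmor_smul:
      "X \<in> Obj A \<Longrightarrow> Y \<in> Obj A \<Longrightarrow> a \<in> Hom A X Y n \<Longrightarrow>
       afmor F (Arr X Y n (smul A c a)) = smul B c (afmor F (Arr X Y n a))"
    and afmor_mu: "composable A fs \<Longrightarrow> mu B (map (af_arr F) fs) = afmor F (mu_arr A fs)"
    and afmor_idm: "X \<in> Obj A \<Longrightarrow> afmor F (id_arr A X) = idm B (afob F X)"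

definition full_subcategory :: "('k, 'o, 'm) ainf \<Rightarrow> 'o set \<Rightarrow> ('k, 'o, 'm) ainf" where
  "full_subcategory A U = A\<lparr>Obj := Obj A \<inter> U\<rparr>"

definition inclusion :: "('o, 'm, 'o, 'm) afun" where
  "inclusion = \<lparr>afob = (\<lambda>X. X), afmor = val\<rparr>"


section \<open>Linear categories\<close>

text \<open>
  Hom spaces carry their own vector space structure, as those of cohomology categories consist of
  cosets.
\<close>

record ('k, 'v) kvs =
  carr :: "'v set"
  vzero :: 'v
  vadd :: "'v \<Rightarrow> 'v \<Rightarrow> 'v"
  vscl :: "'k \<Rightarrow> 'v \<Rightarrow> 'v"

locale kvector_space =
  fixes V :: "('k::field, 'v) kvs"
  assumes zero_closed: "vzero V \<in> carr V"
    and add_closed: "x \<in> carr V \<Longrightarrow> y \<in> carr V \<Longrightarrow> vadd V x y \<in> carr V"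
    and scl_closed: "x \<in> carr V \<Longrightarrow> vscl V c x \<in> carr V"
    and add_assoc: "x \<in> carr V \<Longrightarrow> y \<in> carr V \<Longrightarrow> z \<in> carr V \<Longrightarrow>
      vadd V (vadd V x y) z = vadd V x (vadd V y z)"
    and add_commute: "x \<in> carr V \<Longrightarrow> y \<in> carr V \<Longrightarrow> vadd V x y = vadd V y x"
    and add_zero: "x \<in> carr V \<Longrightarrow> vadd V (vzero V) x = x"
    and add_inverse: "x \<in> carr V \<Longrightarrow> \<exists>y\<in>carr V. vadd V x y = vzero V"
    and scl_add_right: "x \<in> carr V \<Longrightarrow> y \<in> carr V \<Longrightarrow>
      vscl V c (vadd V x y) = vadd V (vscl V c x) (vscl V c y)"
    and scl_add_left: "x \<in> carr V \<Longrightarrow> vscl V (b + c) x = vadd V (vscl V b x) (vscl V c x)"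
    and scl_assoc: "x \<in> carr V \<Longrightarrow> vscl V b (vscl V c x) = vscl V (b * c) x"
    and scl_one: "x \<in> carr V \<Longrightarrow> vscl V 1 x = x"

definition linear_between :: "('k, 'v) kvs \<Rightarrow> ('k, 'w) kvs \<Rightarrow> ('v \<Rightarrow> 'w) \<Rightarrow> bool" where
  "linear_between V W f \<longleftrightarrow>
     (\<forall>x\<in>carr V. f x \<in> carr W) \<and>
     (\<forall>x\<in>carr V. \<forall>y\<in>carr V. f (vadd V x y) = vadd W (f x) (f y)) \<and>
     (\<forall>c. \<forall>x\<in>carr V. f (vscl V c x) = vscl W c (f x))"

text \<open>\<open>cmp C X Y Z g f\<close> is the composite of \<open>f : X \<rightarrow> Y\<close> and \<open>g : Y \<rightarrow> Z\<close>.\<close>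

record ('k, 'o, 'a) lcat =
  obj :: "'o set"
  hom :: "'o \<Rightarrow> 'o \<Rightarrow> ('k, 'a) kvs"
  cmp :: "'o \<Rightarrow> 'o \<Rightarrow> 'o \<Rightarrow> 'a \<Rightarrow> 'a \<Rightarrow> 'a"
  idn :: "'o \<Rightarrow> 'a"

text \<open>
  Composition is not required to be associative. The notions below are applied to \<open>Z\<^sup>0(A)\<close>, whose
  composition \<open>\<mu>\<^sup>2\<close> satisfies the unit laws strictly but is in general associative only up to
  terms \<open>\<mu>\<^sup>1(\<mu>\<^sup>3(h, g, f))\<close>. When it is associative, e.g. if \<open>\<mu>\<^sup>3 = 0\<close>, these are the usual notions.
\<close>

locale lcategory =
  fixes C :: "('k::field, 'o, 'a) lcat"
  assumes hom_space: "X \<in> obj C \<Longrightarrow> Y \<in> obj C \<Longrightarrow> kvector_space (hom C X Y)"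
    and cmp_linear_left:
      "X \<in> obj C \<Longrightarrow> Y \<in> obj C \<Longrightarrow> Z \<in> obj C \<Longrightarrow> f \<in> carr (hom C X Y) \<Longrightarrow>
       linear_between (hom C Y Z) (hom C X Z) (\<lambda>g. cmp C X Y Z g f)"
    and cmp_linear_right:
      "X \<in> obj C \<Longrightarrow> Y \<in> obj C \<Longrightarrow> Z \<in> obj C \<Longrightarrow> g \<in> carr (hom C Y Z) \<Longrightarrow>
       linear_between (hom C X Y) (hom C X Z) (\<lambda>f. cmp C X Y Z g f)"
    and idn_closed: "X \<in> obj C \<Longrightarrow> idn C X \<in> carr (hom C X X)"
    and cmp_idn_right:
      "X \<in> obj C \<Longrightarrow> Y \<in> obj C \<Longrightarrow> f \<in> carr (hom C X Y) \<Longrightarrow> cmp C X X Y f (idn C X) = f"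
    and cmp_idn_left:
      "X \<in> obj C \<Longrightarrow> Y \<in> obj C \<Longrightarrow> f \<in> carr (hom C X Y) \<Longrightarrow> cmp C X Y Y (idn C Y) f = f"

record ('o, 'a, 'p, 'b) cfun =
  cfob :: "'o \<Rightarrow> 'p"
  cfmor :: "'o \<Rightarrow> 'o \<Rightarrow> 'a \<Rightarrow> 'b"

definition cf_id :: "('o, 'a, 'o, 'a) cfun" where
  "cf_id = \<lparr>cfob = (\<lambda>X. X), cfmor = (\<lambda>X Y f. f)\<rparr>"

definition cf_comp ::
  "('p, 'b, 'q, 'c) cfun \<Rightarrow> ('o, 'a, 'p, 'b) cfun \<Rightarrow> ('o, 'a, 'q, 'c) cfun" where
  "cf_comp G F = \<lparr>cfob = (\<lambda>X. cfob G (cfob F X)),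
     cfmor = (\<lambda>X Y f. cfmor G (cfob F X) (cfob F Y) (cfmor F X Y f))\<rparr>"

locale lfunctor = C: lcategory C + D: lcategory D
  for C :: "('k::field, 'o, 'a) lcat" and D :: "('k, 'p, 'b) lcat" +
  fixes F :: "('o, 'a, 'p, 'b) cfun"
  assumes cfob_closed: "X \<in> obj C \<Longrightarrow> cfob F X \<in> obj D"
    and cfmor_linear:
      "X \<in> obj C \<Longrightarrow> Y \<in> obj C \<Longrightarrow>
       linear_between (hom C X Y) (hom D (cfob F X) (cfob F Y)) (cfmor F X Y)"
    and cfmor_idn: "X \<in> obj C \<Longrightarrow> cfmor F X X (idn C X) = idn D (cfob F X)"
    and cfmor_cmp:
      "X \<in> obj C \<Longrightarrow> Y \<in> obj C \<Longrightarrow> Z \<in> obj C \<Longrightarrow>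
       f \<in> carr (hom C X Y) \<Longrightarrow> g \<in> carr (hom C Y Z) \<Longrightarrow>
       cfmor F X Z (cmp C X Y Z g f) =
       cmp D (cfob F X) (cfob F Y) (cfob F Z) (cfmor F Y Z g) (cfmor F X Y f)"

text \<open>Equality of functors with domain \<open>C\<close>, on objects and on morphisms.\<close>

definition functor_eq ::
  "('k, 'o, 'a) lcat \<Rightarrow> ('o, 'a, 'p, 'b) cfun \<Rightarrow> ('o, 'a, 'p, 'b) cfun \<Rightarrow> bool" where
  "functor_eq C F G \<longleftrightarrow>
     (\<forall>X\<in>obj C. cfob F X = cfob G X) \<and>
     (\<forall>X\<in>obj C. \<forall>Y\<in>obj C. \<forall>f\<in>carr (hom C X Y). cfmor F X Y f = cfmor G X Y f)"

definition isomorphism :: "('k, 'o, 'a) lcat \<Rightarrow> 'o \<Rightarrow> 'o \<Rightarrow> 'a \<Rightarrow> bool" where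
  "isomorphism C X Y f \<longleftrightarrow> f \<in> carr (hom C X Y) \<and>
     (\<exists>g\<in>carr (hom C Y X). cmp C X Y X g f = idn C X \<and> cmp C Y X Y f g = idn C Y)"

definition naturally_isomorphic ::
  "('k, 'o, 'a) lcat \<Rightarrow> ('k, 'p, 'b) lcat \<Rightarrow> ('o, 'a, 'p, 'b) cfun \<Rightarrow> ('o, 'a, 'p, 'b) cfun \<Rightarrow> bool"
  where
  "naturally_isomorphic C D F G \<longleftrightarrow>
     (\<exists>\<eta>. (\<forall>X\<in>obj C. isomorphism D (cfob F X) (cfob G X) (\<eta> X)) \<and>
       (\<forall>X\<in>obj C. \<forall>Y\<in>obj C. \<forall>f\<in>carr (hom C X Y).
          cmp D (cfob F X) (cfob F Y) (cfob G Y) (\<eta> Y) (cfmor F X Y f) =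
          cmp D (cfob F X) (cfob G X) (cfob G Y) (cfmor G X Y f) (\<eta> X)))"

definition has_retraction ::
  "('k::field, 'o, 'a) lcat \<Rightarrow> ('k, 'p, 'b) lcat \<Rightarrow> ('o, 'a, 'p, 'b) cfun \<Rightarrow> bool" where
  "has_retraction C D F \<longleftrightarrow> lfunctor C D F \<and>
     (\<exists>R. lfunctor D C R \<and> functor_eq C (cf_comp R F) cf_id)"

definition equivalence ::
  "('k::field, 'o, 'a) lcat \<Rightarrow> ('k, 'p, 'b) lcat \<Rightarrow> ('o, 'a, 'p, 'b) cfun \<Rightarrow> bool" where
  "equivalence C D F \<longleftrightarrow> lfunctor C D F \<and>
     (\<exists>G. lfunctor D C G \<and> naturally_isomorphic C C (cf_comp G F) cf_id \<and>
       naturally_isomorphic D D (cf_comp F G) cf_id)"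

definition Z0 :: "('k, 'o, 'm::ab_group_add) ainf \<Rightarrow> ('k, 'o, 'm) lcat" where
  "Z0 A = \<lparr>
     obj = Obj A,
     hom = (\<lambda>X Y. \<lparr>carr = {f \<in> Hom A X Y 0. mu A [Arr X Y 0 f] = 0},
       vzero = 0, vadd = (+), vscl = smul A\<rparr>),
     cmp = (\<lambda>X Y Z g f. mu A [Arr X Y 0 f, Arr Y Z 0 g]),
     idn = idm A\<rparr>"

definition Z0_map :: "('o, 'm, 'p, 'n) afun \<Rightarrow> ('o, 'm, 'p, 'n) cfun" where
  "Z0_map F = \<lparr>cfob = afob F, cfmor = (\<lambda>X Y f. afmor F (Arr X Y 0 f))\<rparr>"


section \<open>Graded linear categories and cohomology categories\<close>

text \<open>
  \<open>gcmp C X Y Z n m g f\<close> is the composite of \<open>f : X \<rightarrow> Y\<close> of degree \<open>m\<close> and \<open>g : Y \<rightarrow> Z\<close> of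
  degree \<open>n\<close>.
\<close>

record ('k, 'o, 'a) gcat =
  gobj :: "'o set"
  ghom :: "'o \<Rightarrow> 'o \<Rightarrow> int \<Rightarrow> ('k, 'a) kvs"
  gcmp :: "'o \<Rightarrow> 'o \<Rightarrow> 'o \<Rightarrow> int \<Rightarrow> int \<Rightarrow> 'a \<Rightarrow> 'a \<Rightarrow> 'a"
  gidn :: "'o \<Rightarrow> 'a"

locale gcategory =
  fixes C :: "('k::field, 'o, 'a) gcat"
  assumes hom_space: "X \<in> gobj C \<Longrightarrow> Y \<in> gobj C \<Longrightarrow> kvector_space (ghom C X Y n)"
    and cmp_linear_left:
      "X \<in> gobj C \<Longrightarrow> Y \<in> gobj C \<Longrightarrow> Z \<in> gobj C \<Longrightarrow> f \<in> carr (ghom C X Y m) \<Longrightarrow>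
       linear_between (ghom C Y Z n) (ghom C X Z (n + m)) (\<lambda>g. gcmp C X Y Z n m g f)"
    and cmp_linear_right:
      "X \<in> gobj C \<Longrightarrow> Y \<in> gobj C \<Longrightarrow> Z \<in> gobj C \<Longrightarrow> g \<in> carr (ghom C Y Z n) \<Longrightarrow>
       linear_between (ghom C X Y m) (ghom C X Z (n + m)) (\<lambda>f. gcmp C X Y Z n m g f)"
    and idn_closed: "X \<in> gobj C \<Longrightarrow> gidn C X \<in> carr (ghom C X X 0)"
    and cmp_idn_right:
      "X \<in> gobj C \<Longrightarrow> Y \<in> gobj C \<Longrightarrow> f \<in> carr (ghom C X Y m) \<Longrightarrow>
       gcmp C X X Y m 0 f (gidn C X) = f"
    and cmp_idn_left:
      "X \<in> gobj C \<Longrightarrow> Y \<in> gobj C \<Longrightarrow> f \<in> carr (ghom C X Y m) \<Longrightarrow>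
       gcmp C X Y Y 0 m (gidn C Y) f = f"
    and cmp_assoc:
      "W \<in> gobj C \<Longrightarrow> X \<in> gobj C \<Longrightarrow> Y \<in> gobj C \<Longrightarrow> Z \<in> gobj C \<Longrightarrow>
       f \<in> carr (ghom C W X l) \<Longrightarrow> g \<in> carr (ghom C X Y m) \<Longrightarrow> h \<in> carr (ghom C Y Z n) \<Longrightarrow>
       gcmp C W X Z (n + m) l (gcmp C X Y Z n m h g) f =
       gcmp C W Y Z n (m + l) h (gcmp C W X Y m l g f)"

record ('o, 'a, 'p, 'b) gfun =
  gfob :: "'o \<Rightarrow> 'p"
  gfmor :: "'o \<Rightarrow> 'o \<Rightarrow> int \<Rightarrow> 'a \<Rightarrow> 'b"

definition gf_id :: "('o, 'a, 'o, 'a) gfun" where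
  "gf_id = \<lparr>gfob = (\<lambda>X. X), gfmor = (\<lambda>X Y n f. f)\<rparr>"

definition gf_comp ::
  "('p, 'b, 'q, 'c) gfun \<Rightarrow> ('o, 'a, 'p, 'b) gfun \<Rightarrow> ('o, 'a, 'q, 'c) gfun" where
  "gf_comp G F = \<lparr>gfob = (\<lambda>X. gfob G (gfob F X)),
     gfmor = (\<lambda>X Y n f. gfmor G (gfob F X) (gfob F Y) n (gfmor F X Y n f))\<rparr>"

locale gfunctor = C: gcategory C + D: gcategory D
  for C :: "('k::field, 'o, 'a) gcat" and D :: "('k, 'p, 'b) gcat" +
  fixes F :: "('o, 'a, 'p, 'b) gfun"
  assumes gfob_closed: "X \<in> gobj C \<Longrightarrow> gfob F X \<in> gobj D"
    and gfmor_linear: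
      "X \<in> gobj C \<Longrightarrow> Y \<in> gobj C \<Longrightarrow>
       linear_between (ghom C X Y n) (ghom D (gfob F X) (gfob F Y) n) (gfmor F X Y n)"
    and gfmor_idn: "X \<in> gobj C \<Longrightarrow> gfmor F X X 0 (gidn C X) = gidn D (gfob F X)"
    and gfmor_cmp:
      "X \<in> gobj C \<Longrightarrow> Y \<in> gobj C \<Longrightarrow> Z \<in> gobj C \<Longrightarrow>
       f \<in> carr (ghom C X Y m) \<Longrightarrow> g \<in> carr (ghom C Y Z n) \<Longrightarrow>
       gfmor F X Z (n + m) (gcmp C X Y Z n m g f) =
       gcmp D (gfob F X) (gfob F Y) (gfob F Z) n m (gfmor F Y Z n g) (gfmor F X Y m f)"

definition gisomorphism :: "('k, 'o, 'a) gcat \<Rightarrow> 'o \<Rightarrow> 'o \<Rightarrow> 'a \<Rightarrow> bool" where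
  "gisomorphism C X Y f \<longleftrightarrow> f \<in> carr (ghom C X Y 0) \<and>
     (\<exists>g\<in>carr (ghom C Y X 0).
        gcmp C X Y X 0 0 g f = gidn C X \<and> gcmp C Y X Y 0 0 f g = gidn C Y)"

definition gnaturally_isomorphic ::
  "('k, 'o, 'a) gcat \<Rightarrow> ('k, 'p, 'b) gcat \<Rightarrow> ('o, 'a, 'p, 'b) gfun \<Rightarrow> ('o, 'a, 'p, 'b) gfun \<Rightarrow> bool"
  where
  "gnaturally_isomorphic C D F G \<longleftrightarrow>
     (\<exists>\<eta>. (\<forall>X\<in>gobj C. gisomorphism D (gfob F X) (gfob G X) (\<eta> X)) \<and>
       (\<forall>X\<in>gobj C. \<forall>Y\<in>gobj C. \<forall>n. \<forall>f\<in>carr (ghom C X Y n).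
          gcmp D (gfob F X) (gfob F Y) (gfob G Y) 0 n (\<eta> Y) (gfmor F X Y n f) =
          gcmp D (gfob F X) (gfob G X) (gfob G Y) n 0 (gfmor G X Y n f) (\<eta> X)))"

definition gequivalence ::
  "('k::field, 'o, 'a) gcat \<Rightarrow> ('k, 'p, 'b) gcat \<Rightarrow> ('o, 'a, 'p, 'b) gfun \<Rightarrow> bool" where
  "gequivalence C D F \<longleftrightarrow> gfunctor C D F \<and>
     (\<exists>G. gfunctor D C G \<and> gnaturally_isomorphic C C (gf_comp G F) gf_id \<and>
       gnaturally_isomorphic D D (gf_comp F G) gf_id)"

definition cocycles :: "('k, 'o, 'm::zero) ainf \<Rightarrow> 'o \<Rightarrow> 'o \<Rightarrow> int \<Rightarrow> 'm set" where
  "cocycles A X Y n = {f \<in> Hom A X Y n. mu A [Arr X Y n f] = 0}"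

definition coboundaries :: "('k, 'o, 'm) ainf \<Rightarrow> 'o \<Rightarrow> 'o \<Rightarrow> int \<Rightarrow> 'm set" where
  "coboundaries A X Y n = (\<lambda>h. mu A [Arr X Y (n - 1) h]) ` Hom A X Y (n - 1)"

definition cohomology_class ::
  "('k, 'o, 'm::ab_group_add) ainf \<Rightarrow> 'o \<Rightarrow> 'o \<Rightarrow> int \<Rightarrow> 'm \<Rightarrow> 'm set" where
  "cohomology_class A X Y n f = {f + b | b. b \<in> coboundaries A X Y n}"

definition cohomology ::
  "('k, 'o, 'm::ab_group_add) ainf \<Rightarrow> 'o \<Rightarrow> 'o \<Rightarrow> int \<Rightarrow> ('k, 'm set) kvs" where
  "cohomology A X Y n = \<lparr>
     carr = cohomology_class A X Y n ` cocycles A X Y n,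
     vzero = cohomology_class A X Y n 0,
     vadd = (\<lambda>u v. \<Union>f\<in>u. \<Union>g\<in>v. cohomology_class A X Y n (f + g)),
     vscl = (\<lambda>c u. \<Union>f\<in>u. cohomology_class A X Y n (smul A c f))\<rparr>"

text \<open>
  The graded cohomology category, with Seidel's composition \<open>[g] [f] = (-1)\<^bsup>|f|\<^esup> [\<mu>\<^sup>2(g, f)]\<close>. Its
  degree zero part is \<open>H\<^sup>0(A)\<close>.
\<close>

definition coh_cat :: "('k, 'o, 'm::ab_group_add) ainf \<Rightarrow> ('k, 'o, 'm set) gcat" where
  "coh_cat A = \<lparr>
     gobj = Obj A,
     ghom = cohomology A,
     gcmp = (\<lambda>X Y Z n m v u. \<Union>g\<in>v. \<Union>f\<in>u.
       cohomology_class A X Z (n + m) (signed m (mu A [Arr X Y m f, Arr Y Z n g]))),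
     gidn = (\<lambda>X. cohomology_class A X X 0 (idm A X))\<rparr>"

definition coh_map ::
  "('k, 'p, 'n::ab_group_add) ainf \<Rightarrow> ('o, 'm, 'p, 'n) afun \<Rightarrow> ('o, 'm set, 'p, 'n set) gfun" where
  "coh_map B F = \<lparr>gfob = afob F,
     gfmor = (\<lambda>X Y n u. \<Union>f\<in>u.
       cohomology_class B (afob F X) (afob F Y) n (afmor F (Arr X Y n f)))\<rparr>"

definition quasi_equivalence ::
  "('k::field, 'o, 'm::ab_group_add) ainf \<Rightarrow> ('k, 'p, 'n::ab_group_add) ainf \<Rightarrow>
   ('o, 'm, 'p, 'n) afun \<Rightarrow> bool" where
  "quasi_equivalence A B F \<longleftrightarrow>
     ainf_functor A B F \<and> gequivalence (coh_cat A) (coh_cat B) (coh_map B F)"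


section \<open>The category \<open>k[t, t\<^sup>-\<^sup>1] \<otimes> A\<close>\<close>

text \<open>
  The finitely supported function \<open>f\<close> stands for \<open>\<Sum>\<^sub>\<alpha> t\<^bsup>\<alpha>\<^esup> \<otimes> f(\<alpha>)\<close>. If \<open>f\<close> has degree \<open>n\<close>,
  then \<open>f(\<alpha>)\<close> has degree \<open>n - \<alpha>\<close>.
\<close>

definition t_coeff :: "('o, int \<Rightarrow>\<^sub>0 'm::zero) arr \<Rightarrow> int \<Rightarrow> ('o, 'm) arr" where
  "t_coeff f \<alpha> = Arr (src f) (tgt f) (deg f - \<alpha>) (Poly_Mapping.lookup (val f) \<alpha>)"

definition laurent ::
  "('k, 'o, 'm::ab_group_add) ainf \<Rightarrow> ('k, 'o, int \<Rightarrow>\<^sub>0 'm) ainf" where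
  "laurent A = \<lparr>
     Obj = Obj A,
     Hom = (\<lambda>X Y n. {f. \<forall>\<alpha>. Poly_Mapping.lookup f \<alpha> \<in> Hom A X Y (n - \<alpha>)}),
     smul = (\<lambda>c. Poly_Mapping.map (smul A c)),
     mu = (\<lambda>fs. \<Sum>\<alpha>s\<in>listset (map (\<lambda>f. Poly_Mapping.keys (val f)) fs).
       let as = map2 t_coeff fs \<alpha>s in
       signed (\<Sum>j<length fs. \<Sum>i<j. \<alpha>s ! i * (deg (as ! j) - 1))
         (Poly_Mapping.single (sum_list \<alpha>s) (mu A as))),
     idm = (\<lambda>X. Poly_Mapping.single 0 (idm A X))\<rparr>"


section \<open>The category \<open>\<int>A\<close>\<close>

text \<open>
  The list \<open>[(X\<^sub>0, p\<^sub>0), (X\<^sub>1, p\<^sub>1), \<dots>]\<close> is the formal sum of the \<open>X\<^sub>i[p\<^sub>i]\<close>. A morphism is a matrix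
  whose entry at \<open>(j, i)\<close> is the component from the \<open>i\<close>-th summand \<open>X[p]\<close> of the source to the
  \<open>j\<close>-th summand \<open>Y[q]\<close> of the target. As \<open>s\<^sup>p\<^sub>q\<close> spans the Hom space from \<open>k[p]\<close> to \<open>k[q]\<close>, the
  component \<open>s\<^sup>p\<^sub>q \<otimes> a\<close> is represented by \<open>a\<close>, which has degree \<open>n - (p - q)\<close> if the morphism has
  degree \<open>n\<close>.
\<close>

type_synonym 'o formal_sum = "('o \<times> int) list"
type_synonym 'm matrix = "(nat \<times> nat) \<Rightarrow>\<^sub>0 'm"

definition s_deg :: "'o formal_sum \<Rightarrow> 'o formal_sum \<Rightarrow> nat \<Rightarrow> nat \<Rightarrow> int" where
  "s_deg X Y i j = snd (X ! i) - snd (Y ! j)"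

definition entry :: "('o formal_sum, 'm::zero matrix) arr \<Rightarrow> nat \<Rightarrow> nat \<Rightarrow> ('o, 'm) arr" where
  "entry f i j = Arr (fst (src f ! i)) (fst (tgt f ! j)) (deg f - s_deg (src f) (tgt f) i j)
     (Poly_Mapping.lookup (val f) (j, i))"

definition index_paths :: "('o formal_sum, 'm) arr list \<Rightarrow> nat list set" where
  "index_paths fs = {is. length is = Suc (length fs) \<and>
     (\<forall>l<length fs. is ! l < length (src (fs ! l)) \<and> is ! Suc l < length (tgt (fs ! l)))}"

definition ZZ ::
  "('k, 'o, 'm::ab_group_add) ainf \<Rightarrow> ('k, 'o formal_sum, 'm matrix) ainf" where
  "ZZ A = \<lparr>
     Obj = {X. fst ` set X \<subseteq> Obj A},
     Hom = (\<lambda>X Y n. {f. Poly_Mapping.keys f \<subseteq> {..<length Y} \<times> {..<length X} \<and>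
       (\<forall>i<length X. \<forall>j<length Y.
          Poly_Mapping.lookup f (j, i) \<in> Hom A (fst (X ! i)) (fst (Y ! j)) (n - s_deg X Y i j))}),
     smul = (\<lambda>c. Poly_Mapping.map (smul A c)),
     mu = (\<lambda>fs. \<Sum>is\<in>index_paths fs.
       let as = map (\<lambda>l. entry (fs ! l) (is ! l) (is ! Suc l)) [0..<length fs];
           s = (\<lambda>l. s_deg (src (fs ! l)) (tgt (fs ! l)) (is ! l) (is ! Suc l)) in
       signed (\<Sum>j<length fs. \<Sum>i<j. s i * (deg (as ! j) - 1))
         (Poly_Mapping.single (last is, hd is) (mu A as))),
     idm = (\<lambda>X. \<Sum>i<length X. Poly_Mapping.single (i, i) (idm A (fst (X ! i))))\<rparr>"


section \<open>Twisted complexes\<close>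

type_synonym ('o, 'm) twisted = "'o formal_sum \<times> 'm matrix"

text \<open>
  As in Seidel, a filtration of a formal sum of objects \<open>X\<^sub>i[p\<^sub>i]\<close> consists of partial sums, which
  are given by subsets of the index set: a subobject of \<open>V\<^sub>i \<otimes> X\<^sub>i\<close> comes from a graded subspace of
  \<open>V\<^sub>i\<close>, and here all \<open>V\<^sub>i = k[p\<^sub>i]\<close> are one-dimensional.
\<close>

definition strictly_lower_triangular :: "'o formal_sum \<Rightarrow> 'm::zero matrix \<Rightarrow> bool" where
  "strictly_lower_triangular X \<delta> \<longleftrightarrow>
     (\<exists>(F :: nat \<Rightarrow> nat set) N. F 0 = {..<length X} \<and> F N = {} \<and> (\<forall>r. F (Suc r) \<subseteq> F r) \<and>
       (\<forall>r. \<forall>i\<in>F r. \<forall>j\<in>{..<length X} - F r. Poly_Mapping.lookup \<delta> (j, i) = 0) \<and>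
       (\<forall>r. \<forall>i\<in>F r - F (Suc r). \<forall>j\<in>F r - F (Suc r). Poly_Mapping.lookup \<delta> (j, i) = 0))"

definition tw_diff :: "('o, 'm) twisted \<Rightarrow> ('o formal_sum, 'm matrix) arr" where
  "tw_diff X = Arr (fst X) (fst X) 1 (snd X)"

definition tw_forget ::
  "(('o, 'm) twisted, 'm matrix) arr \<Rightarrow> ('o formal_sum, 'm matrix) arr" where
  "tw_forget f = Arr (fst (src f)) (fst (tgt f)) (deg f) (val f)"

text \<open>
  \<open>tw_insert [f\<^sub>1, \<dots>, f\<^sub>d] [i\<^sub>0, \<dots>, i\<^sub>d]\<close> is the path with \<open>i\<^sub>0\<close> copies of the differential of the
  source of \<open>f\<^sub>1\<close>, then \<open>f\<^sub>1\<close>, then \<open>i\<^sub>1\<close> copies of the differential of the target of \<open>f\<^sub>1\<close>, and so on.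
\<close>

definition tw_insert ::
  "(('o, 'm) twisted, 'm matrix) arr list \<Rightarrow> nat list \<Rightarrow> ('o formal_sum, 'm matrix) arr list" where
  "tw_insert fs is = replicate (is ! 0) (tw_diff (src (hd fs))) @
     concat (map (\<lambda>l. tw_forget (fs ! l) # replicate (is ! Suc l) (tw_diff (tgt (fs ! l))))
       [0..<length fs])"

text \<open>
  The infinite sums below have only finitely many nonzero terms since all differentials are strictly
  lower triangular.
\<close>

definition Tw ::
  "('k, 'o, 'm::ab_group_add) ainf \<Rightarrow> ('k, ('o, 'm) twisted, 'm matrix) ainf" where
  "Tw A = \<lparr>
     Obj = {(X, \<delta>). X \<in> Obj (ZZ A) \<and> \<delta> \<in> Hom (ZZ A) X X 1 \<and> strictly_lower_triangular X \<delta> \<and>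
       Sum_any (\<lambda>d. if d > 0 then mu (ZZ A) (replicate d (tw_diff (X, \<delta>))) else 0) = 0},
     Hom = (\<lambda>X Y. Hom (ZZ A) (fst X) (fst Y)),
     smul = smul (ZZ A),
     mu = (\<lambda>fs. Sum_any (\<lambda>is.
       if length is = Suc (length fs) then mu (ZZ A) (tw_insert fs is) else 0)),
     idm = (\<lambda>X. idm (ZZ A) (fst X))\<rparr>"

definition unshifted_Tw ::
  "('k, 'o, 'm::ab_group_add) ainf \<Rightarrow> ('k, ('o, int \<Rightarrow>\<^sub>0 'm) twisted, (int \<Rightarrow>\<^sub>0 'm) matrix) ainf" where
  "unshifted_Tw A = full_subcategory (Tw (laurent A)) {(X, \<delta>). \<forall>p\<in>snd ` set X. p = 0}"

end

theory Submission
  imports Defs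
begin

text \<open>
  Since \<open>t\<close> is invertible of degree 1, the summand \<open>X[p]\<close> is isomorphic to \<open>X[0]\<close> by \<open>s\<^sup>p\<^sub>0 \<otimes> t\<^bsup>-p\<^esup> \<otimes> id\<close>, which
  has degree 0. Transporting all morphisms along these isomorphisms, with a sign, gives a strict
  \<open>A\<^sub>\<infinity>\<close>-functor that is a left inverse of the inclusion, and the isomorphisms become closed natural
  isomorphisms in \<open>Tw\<close> because \<open>\<mu>\<^sup>d\<close> with an argument of the form \<open>t\<^sup>p \<otimes> id\<close> vanishes for \<open>d \<noteq> 2\<close>.

  That \<open>k[t, t\<^sup>-\<^sup>1] \<otimes> A\<close> and \<open>\<int>A\<close> are \<open>A\<^sub>\<infinity>\<close>-categories is checked on monomials, by multilinearity. The
  relations in \<open>Tw\<close> are the sum of the relations of \<open>\<int>A\<close> over all words that result from inserting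
  differentials, where the terms whose inner operation has only differentials as arguments add up to
  the Maurer--Cartan equation.
\<close>

section \<open>Signs, paths and multilinearity\<close>

text \<open>The sign of the retraction is the one produced by moving \<open>t^p\<close> past
  \<open>t^\<alpha>\<close> when a matrix entry leaving \<open>X[p]\<close> is composed with the
  isomorphism from \<open>X[0]\<close> to \<open>X[p]\<close>. The functor is nevertheless given by
  a formula on monomials and not by composing with the isomorphisms, so that compatibility with
  every \<mu>^d is a comparison of exponents and no associativity enters: \<open>Z0\<close> is not
  associative in general. Naturality holds on the chain level, for morphisms of every degree, closed
  or not. For the differentials it says that the isomorphisms are closed; for closed morphisms it
  serves \<open>Z0\<close> and cohomology alike. The obstacle in \<open>Tw\<close> is its infinite
  sums: the number of nonzero terms depends on the path, while a relation compares many paths at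
  once. All sums are therefore truncated at a common bound on the length of words, and the
  discrepancies vanish because a long word contains many consecutive differentials of one
  object.\<close>

lemma signed_0 [simp]: "signed 0 x = x"
  and signed_zero [simp]: "signed n (0 :: 'a :: ab_group_add) = 0"
  by (auto simp: signed_def)

lemma signed_signed: "signed m (signed n (x :: 'a :: ab_group_add)) = signed (m + n) x"
  by (auto simp: signed_def)

lemma signed_add: "signed n (x + y :: 'a :: ab_group_add) = signed n x + signed n y"
  by (auto simp: signed_def)

lemma signed_sum: "signed n (sum f S :: 'a :: ab_group_add) = (\<Sum>x\<in>S. signed n (f x))"
  by (auto simp: signed_def sum_negf)

lemma signed_cong: "even (m - n) \<Longrightarrow> signed m x = signed n x"
  by (auto simp: signed_def)

lemma signed_eq_0_iff [simp]: "signed n (x :: 'a :: ab_group_add) = 0 \<longleftrightarrow> x = 0"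
  by (auto simp: signed_def)

lemma single_signed:
  "Poly_Mapping.single k (signed n (x :: 'a :: ab_group_add)) = signed n (Poly_Mapping.single k x)"
  by (auto simp: signed_def single_uminus)

lemma lookup_signed:
  "Poly_Mapping.lookup (signed n (f :: 'b \<Rightarrow>\<^sub>0 'a :: ab_group_add)) k = signed n (Poly_Mapping.lookup f k)"
  by (auto simp: signed_def)

lemma sum_single_keys: "(\<Sum>k\<in>Poly_Mapping.keys f. Poly_Mapping.single k (Poly_Mapping.lookup f k)) = f"
  by (rule poly_mapping_eqI)
    (auto simp: lookup_sum lookup_single when_def in_keys_iff)

lemma lookup_sum_single:
  assumes "finite K"
  shows "Poly_Mapping.lookup (\<Sum>k\<in>K. Poly_Mapping.single k (g k)) k =
    (if k \<in> K then g k else 0)"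
  using assms by (simp add: lookup_sum lookup_single when_def)

lemma arr_collapse: "Arr (src f) (tgt f) (deg f) (val f) = f"
  by (cases f) simp

text \<open>The index set of an A-infinity relation without numerical positions: \<open>ys\<close>
  is the block fed to the inner operation, hence nonempty. Concatenation and \<open>map\<close> act
  on such triples directly, on which the regrouping of words in twisted complexes relies.\<close>

definition splits :: "'a list \<Rightarrow> ('a list \<times> 'a list \<times> 'a list) set" where
  "splits fs = {(xs, ys, zs). xs @ ys @ zs = fs \<and> ys \<noteq> []}"

lemma splits_bij:
  "bij_betw (\<lambda>(n, m). (take n fs, take m (drop n fs), drop (n + m) fs))
    (SIGMA n:{..<length fs}. {1..length fs - n}) (splits fs)"
proof (rule bij_betw_byWitness[where f' = "\<lambda>(xs, ys, zs). (length xs, length ys)"])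
  show "(\<lambda>(n, m). (take n fs, take m (drop n fs), drop (n + m) fs)) `
    (SIGMA n:{..<length fs}. {1..length fs - n}) \<subseteq> splits fs"
  proof (clarsimp simp: splits_def)
    fix n m :: nat
    show "take n fs @ take m (drop n fs) @ drop (n + m) fs = fs"
      by (metis append_assoc append_take_drop_id take_add)
  qed
  show "(\<lambda>(xs, ys, zs). (length xs, length ys)) ` splits fs \<subseteq>
    (SIGMA n:{..<length fs}. {1..length fs - n})"
    by (auto simp: splits_def Suc_le_eq)
qed (auto simp: splits_def)

lemma finite_splits [simp]: "finite (splits fs)"
  using bij_betw_finite[OF splits_bij[of fs]] by auto

lemma sum_splits:
  "sum g (splits fs) = (\<Sum>n<length fs. \<Sum>m = 1..length fs - n.
     g (take n fs, take m (drop n fs), drop (n + m) fs))"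
proof -
  have "sum g (splits fs) = (\<Sum>(n, m)\<in>(SIGMA n:{..<length fs}. {1..length fs - n}).
     g (take n fs, take m (drop n fs), drop (n + m) fs))"
    by (subst sum.reindex_bij_betw[OF splits_bij, symmetric]) (simp add: case_prod_unfold)
  then show ?thesis
    by (simp add: sum.Sigma)
qed

text \<open>Relations are evaluated on lists of arrows paired with keys; this moves the sum between
  the list of pairs and the lists derived from it.\<close>

lemma sum_splits_map:
  "sum g (splits (map h ps)) = (\<Sum>(xs, ys, zs)\<in>splits ps. g (map h xs, map h ys, map h zs))"
  by (simp add: sum_splits take_map drop_map)

section \<open>Composable paths\<close>

lemma successively_conv_nth:
  "successively P xs \<longleftrightarrow> (\<forall>i. Suc i < length xs \<longrightarrow> P (xs ! i) (xs ! Suc i))"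
proof (induction xs)
  case (Cons x xs)
  then show ?case
    by (cases xs) (auto simp: nth_Cons split: nat.splits)
qed simp

lemma composable_iff:
  "composable A fs \<longleftrightarrow> fs \<noteq> [] \<and> (\<forall>f\<in>set fs. is_arr A f) \<and> successively (\<lambda>f g. tgt f = src g) fs"
  by (simp add: composable_def successively_conv_nth)

lemma composable_single [simp]: "composable A [f] \<longleftrightarrow> is_arr A f"
  by (auto simp: composable_iff)

lemma composable_pair: "composable A [f, g] \<longleftrightarrow> is_arr A f \<and> is_arr A g \<and> tgt f = src g"
  by (auto simp: composable_iff)

lemma composable_replace:
  assumes "composable A (fs @ f # gs)" "is_arr A f'" "src f' = src f" "tgt f' = tgt f"
  shows "composable A (fs @ f' # gs)"
  using assms by (auto simp: composable_iff successively_append_iff successively_Cons)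

lemma composable_slot: "composable A (fs @ f # gs) \<Longrightarrow> is_arr A f"
  by (auto simp: composable_iff)

lemma composable_split:
  assumes "composable A fs" "(xs, ys, zs) \<in> splits fs"
  shows "composable A ys"
  using assms by (auto simp: composable_iff splits_def successively_append_iff)

text \<open>The left side of the A-infinity relation, named as a function of the path so that it can
  be treated like \<open>mu\<close>: additive in every slot and hence determined by
  monomials.\<close>

definition ainf_rel :: "('k, 'o, 'm::ab_group_add) ainf \<Rightarrow> ('o, 'm) arr list \<Rightarrow> 'm" where
  "ainf_rel A fs = (\<Sum>(xs, ys, zs)\<in>splits fs.
     signed (\<Sum>f\<leftarrow>xs. deg f - 1) (mu A (xs @ [mu_arr A ys] @ zs)))"

lemma ainf_rel_eq:
  "ainf_rel A fs = (\<Sum>n<length fs. \<Sum>m = 1..length fs - n.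
     signed (\<Sum>i<n. deg (fs ! i) - 1)
       (mu A (take n fs @ [mu_arr A (take m (drop n fs))] @ drop (n + m) fs)))"
proof -
  have "(\<Sum>f\<leftarrow>take n fs. deg f - 1) = (\<Sum>i<n. deg (fs ! i) - 1)" if "n < length fs" for n
    using that by (simp add: sum_list_sum_nth atLeast0LessThan)
  then show ?thesis
    by (simp add: ainf_rel_def sum_splits)
qed

text \<open>Multilinearity without scalars, for values in an arbitrary group. It is shared by
  \<open>mu\<close>, by \<open>ainf_rel\<close> and by both sides of the compatibility of
  \<open>mu\<close> with the removal of shifts; a decomposition into monomials only involves sums.
  That \<open>a + b\<close> is again a morphism is a premise because the locale assumes no closure
  of the Hom sets.\<close>

locale slot_additive =
  fixes A :: "('k, 'o, 'm::ab_group_add) ainf" and E :: "('o, 'm) arr list \<Rightarrow> 'v::ab_group_add"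
  assumes slot_add: "composable A (fs @ Arr X Y n a # gs) \<Longrightarrow> is_arr A (Arr X Y n b) \<Longrightarrow>
    is_arr A (Arr X Y n (a + b)) \<Longrightarrow>
    E (fs @ Arr X Y n (a + b) # gs) = E (fs @ Arr X Y n a # gs) + E (fs @ Arr X Y n b # gs)"
begin

lemma slot_zero:
  assumes "composable A (fs @ Arr X Y n 0 # gs)"
  shows "E (fs @ Arr X Y n 0 # gs) = 0"
  using slot_add[OF assms, of 0] composable_slot[OF assms] by simp

text \<open>Closure is asked for every subset of \<open>S\<close> because the induction passes
  through partial sums.\<close>

lemma slot_sum:
  assumes "composable A (fs @ Arr X Y n (sum a S) # gs)"
    and "finite S" "\<And>s. s \<in> S \<Longrightarrow> is_arr A (Arr X Y n (a s))"
    and clos: "\<And>T. T \<subseteq> S \<Longrightarrow> is_arr A (Arr X Y n (sum a T))"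
  shows "E (fs @ Arr X Y n (sum a S) # gs) = (\<Sum>s\<in>S. E (fs @ Arr X Y n (a s) # gs))"
  using assms(2,3) clos
proof (induction S)
  case empty
  then have "composable A (fs @ Arr X Y n 0 # gs)"
    using composable_replace[OF assms(1), of "Arr X Y n 0"] by simp
  then show ?case
    by (simp add: slot_zero)
next
  case (insert s S)
  have "composable A (fs @ Arr X Y n (a s) # gs)"
    using composable_replace[OF assms(1), of "Arr X Y n (a s)"] insert by simp
  then have "E (fs @ Arr X Y n (a s + sum a S) # gs) =
      E (fs @ Arr X Y n (a s) # gs) + E (fs @ Arr X Y n (sum a S) # gs)"
    using insert.prems(2)[of S] insert.prems(2)[of "insert s S"] insert.hyps
    by (intro slot_add) auto
  then show ?case
    using insert by auto
qed

end

text \<open>The axioms of \<open>ainf_category\<close> are layered: the linear structure of the Hom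
  spaces here, closed and multilinear operations in \<open>multilinear_ainf\<close>, relations and
  units last. Constructions climb these layers and use the lower ones while proving the
  higher.\<close>

locale closed_ainf =
  fixes A :: "('k::field, 'o, 'm::ab_group_add) ainf"
  assumes vs: "vector_space (smul A)"
    and subspace: "X \<in> Obj A \<Longrightarrow> Y \<in> Obj A \<Longrightarrow> module.subspace (smul A) (Hom A X Y n)"
begin

sublocale vector_space "smul A"
  by (rule vs)

lemma Hom_zero: "X \<in> Obj A \<Longrightarrow> Y \<in> Obj A \<Longrightarrow> 0 \<in> Hom A X Y n"
  using subspace subspace_0 by blast

lemma Hom_add:
  "X \<in> Obj A \<Longrightarrow> Y \<in> Obj A \<Longrightarrow> a \<in> Hom A X Y n \<Longrightarrow> b \<in> Hom A X Y n \<Longrightarrow> a + b \<in> Hom A X Y n"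
  using subspace subspace_add by blast

lemma Hom_smul:
  "X \<in> Obj A \<Longrightarrow> Y \<in> Obj A \<Longrightarrow> a \<in> Hom A X Y n \<Longrightarrow> smul A c a \<in> Hom A X Y n"
  using subspace subspace_scale by blast

lemma Hom_minus: "X \<in> Obj A \<Longrightarrow> Y \<in> Obj A \<Longrightarrow> a \<in> Hom A X Y n \<Longrightarrow> - a \<in> Hom A X Y n"
  using subspace subspace_neg by blast

lemma Hom_signed: "X \<in> Obj A \<Longrightarrow> Y \<in> Obj A \<Longrightarrow> a \<in> Hom A X Y n \<Longrightarrow> signed k a \<in> Hom A X Y n"
  by (simp add: signed_def Hom_minus)

lemma Hom_sum:
  "X \<in> Obj A \<Longrightarrow> Y \<in> Obj A \<Longrightarrow> (\<And>s. s \<in> S \<Longrightarrow> a s \<in> Hom A X Y n) \<Longrightarrow> sum a S \<in> Hom A X Y n"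
  using subspace subspace_sum by blast

lemma arr_sum:
  "X \<in> Obj A \<Longrightarrow> Y \<in> Obj A \<Longrightarrow> (\<And>s. s \<in> S \<Longrightarrow> is_arr A (Arr X Y n (a s))) \<Longrightarrow>
   is_arr A (Arr X Y n (sum a S))"
  by (auto simp: is_arr_def intro: Hom_sum)

text \<open>Slot by slot from the right, the arrows of a path are replaced by generators.\<close>

lemma slot_additive_eqI:
  assumes "slot_additive A E" "slot_additive A E'"
    and gen: "\<And>f. is_arr A f \<Longrightarrow> \<exists>(S :: 's set) a. finite S \<and> val f = sum a S \<and>
      (\<forall>s\<in>S. is_arr A (Arr (src f) (tgt f) (deg f) (a s)) \<and> G (Arr (src f) (tgt f) (deg f) (a s)))"
    and eq: "\<And>fs. composable A fs \<Longrightarrow> (\<forall>f\<in>set fs. G f) \<Longrightarrow> E fs = E' fs"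
    and "composable A fs"
  shows "E fs = E' fs"
proof -
  interpret E: slot_additive A E by fact
  interpret E': slot_additive A E' by fact
  have "composable A (fs @ gs) \<Longrightarrow> (\<forall>g\<in>set gs. G g) \<Longrightarrow> E (fs @ gs) = E' (fs @ gs)" for gs
  proof (induction fs arbitrary: gs rule: rev_induct)
    case Nil
    then show ?case using eq by simp
  next
    case (snoc f fs)
    have comp: "composable A (fs @ f # gs)"
      using snoc.prems(1) by simp
    have f: "is_arr A f"
      using comp by (rule composable_slot)
    obtain S :: "'s set" and a where Sa: "finite S" "val f = sum a S"
      "\<And>s. s \<in> S \<Longrightarrow> is_arr A (Arr (src f) (tgt f) (deg f) (a s))"
      "\<And>s. s \<in> S \<Longrightarrow> G (Arr (src f) (tgt f) (deg f) (a s))"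
      using gen[OF f] by auto
    have f_eq: "f = Arr (src f) (tgt f) (deg f) (sum a S)"
      using Sa(2) by (cases f) simp
    have clos: "is_arr A (Arr (src f) (tgt f) (deg f) (sum a T))" if "T \<subseteq> S" for T
      using f Sa(3) that by (intro arr_sum) (auto simp: is_arr_def)
    have comp': "composable A (fs @ Arr (src f) (tgt f) (deg f) (sum a S) # gs)"
      using comp f_eq by simp
    have "E (fs @ Arr (src f) (tgt f) (deg f) (a s) # gs) =
        E' (fs @ Arr (src f) (tgt f) (deg f) (a s) # gs)" if "s \<in> S" for s
      using composable_replace[OF comp Sa(3)] that Sa(4) snoc.prems(2) by (intro snoc.IH) auto
    then have "E (fs @ Arr (src f) (tgt f) (deg f) (sum a S) # gs) =
        E' (fs @ Arr (src f) (tgt f) (deg f) (sum a S) # gs)"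
      using E.slot_sum[OF comp' Sa(1,3) clos] E'.slot_sum[OF comp' Sa(1,3) clos] by simp
    then show ?case
      using f_eq by simp
  qed
  from this[of "[]"] assms show ?thesis by simp
qed

end

locale multilinear_ainf = closed_ainf +
  assumes mu_arr_closed: "composable A fs \<Longrightarrow> is_arr A (mu_arr A fs)"
    and mu_slot_add:
      "composable A (fs @ Arr X Y n a # gs) \<Longrightarrow> b \<in> Hom A X Y n \<Longrightarrow>
       mu A (fs @ Arr X Y n (a + b) # gs) = mu A (fs @ Arr X Y n a # gs) + mu A (fs @ Arr X Y n b # gs)"
    and mu_slot_smul:
      "composable A (fs @ Arr X Y n a # gs) \<Longrightarrow>
       mu A (fs @ Arr X Y n (smul A c a) # gs) = smul A c (mu A (fs @ Arr X Y n a # gs))"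
begin

sublocale mu: slot_additive A "mu A"
  by standard (simp add: mu_slot_add is_arr_def)

lemma mu_slot_minus:
  assumes "composable A (fs @ Arr X Y n a # gs)"
  shows "mu A (fs @ Arr X Y n (- a) # gs) = - mu A (fs @ Arr X Y n a # gs)"
  using mu_slot_smul[OF assms, of "-1"] by simp

lemma mu_slot_signed:
  assumes "composable A (fs @ Arr X Y n a # gs)"
  shows "mu A (fs @ Arr X Y n (signed k a) # gs) = signed k (mu A (fs @ Arr X Y n a # gs))"
  using mu_slot_minus[OF assms] by (simp add: signed_def)

lemma mu_slot_sum:
  assumes "composable A (fs @ Arr X Y n a # gs)" "finite S" "\<And>s. s \<in> S \<Longrightarrow> b s \<in> Hom A X Y n"
  shows "mu A (fs @ Arr X Y n (sum b S) # gs) = (\<Sum>s\<in>S. mu A (fs @ Arr X Y n (b s) # gs))"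
proof -
  have "is_arr A (Arr X Y n (sum b T))" if "T \<subseteq> S" for T
    using that composable_slot[OF assms(1)] assms(3) by (intro arr_sum) (auto simp: is_arr_def)
  moreover have "is_arr A (Arr X Y n (b s))" if "s \<in> S" for s
    using that composable_slot[OF assms(1)] assms(3) by (auto simp: is_arr_def)
  ultimately show ?thesis
    using assms(2) composable_replace[OF assms(1)] by (intro mu.slot_sum) auto
qed

lemma mu_nth_zero:
  assumes "composable A fs" "l < length fs" "val (fs ! l) = 0"
  shows "mu A fs = 0"
proof -
  have fs: "fs = take l fs @ Arr (src (fs ! l)) (tgt (fs ! l)) (deg (fs ! l)) 0 # drop (Suc l) fs"
    using assms(2,3) id_take_nth_drop by (metis arr_collapse)
  then show ?thesis
    using assms(1) mu.slot_zero by metis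
qed

lemma composable_contract:
  assumes "composable A (xs @ ys @ zs)" "ys \<noteq> []"
  shows "composable A (xs @ mu_arr A ys # zs)"
proof -
  have "composable A ys"
    using assms composable_split[of A "xs @ ys @ zs" xs ys zs] by (simp add: splits_def)
  then show ?thesis
    using assms mu_arr_closed[of ys]
    by (auto simp: composable_iff successively_append_iff successively_Cons mu_arr_def)
qed

text \<open>The slot lies before, inside or after the block consumed by the inner operation. Only in
  the second case is additivity used twice, once for each operation. The signs involve degrees only
  and are not affected.\<close>

lemma ainf_rel_additive: "slot_additive A (ainf_rel A)"
proof
  fix fs gs X Y n a b
  assume comp: "composable A (fs @ Arr X Y n a # gs)" and b: "is_arr A (Arr X Y n b)"
  define fa where "fa c = fs @ Arr X Y n c # gs" for c
  define T where "T c i m = signed (\<Sum>f\<leftarrow>take i (fa c). deg f - 1)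
    (mu A (take i (fa c) @ [mu_arr A (take m (drop i (fa c)))] @ drop (i + m) (fa c)))" for c i m
  have compc: "composable A (fa c)" if "is_arr A (Arr X Y n c)" for c
    using composable_replace[OF comp, of "Arr X Y n c"] that by (simp add: fa_def)
  have T_add: "T (a + b) i m = T a i m + T b i m" if m: "m \<ge> 1" and i: "i + m \<le> length (fa a)" for i m
  proof -
    consider "i > length fs" | "i \<le> length fs" "length fs < i + m" | "length fs \<ge> i + m"
      by linarith
    then show ?thesis
    proof cases
      case 1
      define i' where "i' = i - Suc (length fs)"
      have i_eq: "i = length fs + Suc i'"
        using 1 by (simp add: i'_def)
      have tk: "take i (fa c) = fs @ Arr X Y n c # take i' gs" 
        "drop i (fa c) = drop i' gs" "drop (i + m) (fa c) = drop (i' + m) gs" for c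
        using i_eq by (auto simp: fa_def add.commute)
      have split: "(take i (fa a), take m (drop i (fa a)), drop (i + m) (fa a)) \<in> splits (fa a)"
        using i m by (auto simp: splits_def)
          (metis append_assoc append_take_drop_id take_add)
      have ne: "take m (drop i' gs) \<noteq> []"
        using split by (simp add: splits_def tk)
      have "composable A (take i (fa a) @ mu_arr A (take m (drop i (fa a))) # drop (i + m) (fa a))"
        using split comp by (intro composable_contract) (auto simp: splits_def fa_def)
      then have "composable A (fs @ Arr X Y n a # (take i' gs @ [mu_arr A (take m (drop i' gs))] @ drop (i' + m) gs))"
        by (simp add: tk)
      from mu_slot_add[OF this] b show ?thesis
        by (simp add: T_def tk signed_add is_arr_def)
    next
      case 2
      define m' where "m' = i + m - Suc (length fs)"
      have tk: "take i (fa c) = take i fs" "take m (drop i (fa c)) = drop i fs @ Arr X Y n c # take m' gs" 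
        "drop (i + m) (fa c) = drop m' gs" for c
        using 2 m i by (auto simp: fa_def m'_def Suc_diff_le take_Cons' drop_Cons' diff_diff_add diff_add_assoc)
          (auto intro: arg_cong[where f="\<lambda>k. take k gs"] arg_cong[where f="\<lambda>k. drop k gs"])
      have dec: "fa c = take i fs @ (drop i fs @ Arr X Y n c # take m' gs) @ drop m' gs" for c
        by (simp add: fa_def)
      define M where "M c = mu_arr A (drop i fs @ Arr X Y n c # take m' gs)" for c
      have M: "is_arr A (M c)" "composable A (take i fs @ M c # drop m' gs)" if "is_arr A (Arr X Y n c)" for c
      proof -
        have c: "composable A (take i fs @ (drop i fs @ Arr X Y n c # take m' gs) @ drop m' gs)"
          using compc[OF that] unfolding dec[of c] .
        show "composable A (take i fs @ M c # drop m' gs)"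
          using composable_contract[OF c] by (simp add: M_def)
        then show "is_arr A (M c)"
          by (rule composable_slot)
      qed
      \<comment> \<open>Source, target and degree of the inner result do not depend on the value in
        the slot, so the outer operation is additive in it as well.\<close>
      have st: "src (M c) = src (M a)" "tgt (M c) = tgt (M a)" "deg (M c) = deg (M a)" for c
        by (cases "drop i fs"; cases "take m' gs"; simp add: M_def mu_arr_def)+
      have comp_mid: "composable A (drop i fs @ Arr X Y n a # take m' gs)"
        using composable_split[OF compc, of a "take i fs" _ "drop m' gs"] composable_slot[OF comp]
        by (simp add: splits_def dec[symmetric]) (simp add: fa_def)
      have valM: "val (M (a + b)) = val (M a) + val (M b)"
        using mu_slot_add[OF comp_mid] b by (simp add: M_def mu_arr_def is_arr_def)
      have ab: "M (a + b) = Arr (src (M a)) (tgt (M a)) (deg (M a)) (val (M a) + val (M b))"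
        using valM st[of "a+b"] by (metis arr_collapse)
      have bb: "M b = Arr (src (M a)) (tgt (M a)) (deg (M a)) (val (M b))"
        using st[of b] by (metis arr_collapse)
      have aa: "composable A (take i fs @ Arr (src (M a)) (tgt (M a)) (deg (M a)) (val (M a)) # drop m' gs)"
        using M(2)[OF composable_slot[OF comp]] by (simp add: arr_collapse)
      have "val (M b) \<in> Hom A (src (M a)) (tgt (M a)) (deg (M a))"
        using M(1)[OF b] by (metis is_arr_def st)
      from mu_slot_add[OF aa this]
      have "mu A (take i fs @ M (a + b) # drop m' gs) =
         mu A (take i fs @ M a # drop m' gs) + mu A (take i fs @ M b # drop m' gs)"
        using ab bb by (simp add: arr_collapse)
      then show ?thesis
        by (simp add: T_def tk signed_add M_def)
    next
      case 3
      have tk: "take i (fa c) = take i fs" "take m (drop i (fa c)) = take m (drop i fs)" 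
        "drop (i + m) (fa c) = drop (i + m) fs @ Arr X Y n c # gs" for c
        using 3 by (auto simp: fa_def)
      have split: "(take i (fa a), take m (drop i (fa a)), drop (i + m) (fa a)) \<in> splits (fa a)"
        using i m by (auto simp: splits_def)
          (metis append_assoc append_take_drop_id take_add)
      have "composable A (take i (fa a) @ mu_arr A (take m (drop i (fa a))) # drop (i + m) (fa a))"
        using split comp by (intro composable_contract) (auto simp: splits_def fa_def)
      then have "composable A ((take i fs @ mu_arr A (take m (drop i fs)) # drop (i + m) fs) @ Arr X Y n a # gs)"
        by (simp add: tk)
      from mu_slot_add[OF this] b show ?thesis
        by (simp add: T_def tk signed_add is_arr_def)
    qed
  qed
  have len: "length (fa c) = length fs + Suc (length gs)" for c
    by (simp add: fa_def)
  have "ainf_rel A (fa c) = (\<Sum>i<length (fa a). \<Sum>m = 1..length (fa a) - i. T c i m)" for c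
    unfolding ainf_rel_def sum_splits by (simp add: T_def len)
  moreover have "(\<Sum>i<length (fa a). \<Sum>m = 1..length (fa a) - i. T (a + b) i m) =
    (\<Sum>i<length (fa a). \<Sum>m = 1..length (fa a) - i. T a i m + T b i m)"
    by (intro sum.cong refl T_add) auto
  ultimately have "ainf_rel A (fa (a + b)) = ainf_rel A (fa a) + ainf_rel A (fa b)"
    by (simp add: sum.distrib)
  then show "ainf_rel A (fs @ Arr X Y n (a + b) # gs) =
    ainf_rel A (fs @ Arr X Y n a # gs) + ainf_rel A (fs @ Arr X Y n b # gs)"
    by (simp add: fa_def)
qed

end

text \<open>Besides the units, this covers the morphisms \<open>t\<^sup>p \<otimes> id\<close> and diagonal matrices of these.\<close>

definition unitlike :: "('k, 'o, 'm::ab_group_add) ainf \<Rightarrow> ('o, 'm) arr \<Rightarrow> bool" where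
  "unitlike A u \<longleftrightarrow> is_arr A u \<and>
     (\<forall>fs gs. composable A (fs @ u # gs) \<longrightarrow> length fs + length gs \<noteq> 1 \<longrightarrow> mu A (fs @ u # gs) = 0)"

text \<open>The isomorphisms that remove shifts have units as coefficients only up to sign.\<close>

lemma (in multilinear_ainf) unitlike_signed:
  assumes "unitlike A (Arr X Y n a)"
  shows "unitlike A (Arr X Y n (signed k a))"
  unfolding unitlike_def
proof (intro conjI allI impI)
  have a: "is_arr A (Arr X Y n a)"
    using assms by (simp add: unitlike_def)
  then show "is_arr A (Arr X Y n (signed k a))"
    by (auto simp: is_arr_def Hom_signed)
  fix fs gs
  assume comp: "composable A (fs @ Arr X Y n (signed k a) # gs)" and "length fs + length gs \<noteq> 1"
  then have "composable A (fs @ Arr X Y n a # gs)"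
    using composable_replace[OF comp a] by simp
  then show "mu A (fs @ Arr X Y n (signed k a) # gs) = 0"
    using mu_slot_signed assms \<open>length fs + length gs \<noteq> 1\<close> by (simp add: unitlike_def)
qed

text \<open>The axioms in terms of the layers and of \<open>ainf_rel\<close>; this is the form in
  which the extensions and the twisted complexes are verified.\<close>

lemma ainf_category_iff:
  "ainf_category A \<longleftrightarrow> multilinear_ainf A \<and>
    (\<forall>fs. composable A fs \<longrightarrow> ainf_rel A fs = 0) \<and>
    (\<forall>X. X \<in> Obj A \<longrightarrow> idm A X \<in> Hom A X X 0) \<and>
    (\<forall>X. X \<in> Obj A \<longrightarrow> mu A [id_arr A X] = 0) \<and>
    (\<forall>f. is_arr A f \<longrightarrow> mu A [id_arr A (src f), f] = val f) \<and>
    (\<forall>f. is_arr A f \<longrightarrow> mu A [f, id_arr A (tgt f)] = signed (deg f) (val f)) \<and>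
    (\<forall>fs X gs. composable A (fs @ id_arr A X # gs) \<longrightarrow> length fs + length gs \<ge> 2 \<longrightarrow>
       mu A (fs @ id_arr A X # gs) = 0)"
  unfolding ainf_category_def multilinear_ainf_def multilinear_ainf_axioms_def closed_ainf_def
    ainf_rel_eq
  by (intro iffI; elim conjE; intro conjI; assumption)

context ainf_category
begin

sublocale multilinear_ainf A
  using ainf_category_axioms by (simp add: ainf_category_iff)

lemma unitlike_id_arr:
  assumes "X \<in> Obj A"
  shows "unitlike A (id_arr A X)"
  unfolding unitlike_def
proof (intro conjI allI impI)
  show "is_arr A (id_arr A X)"
    using assms by (simp add: is_arr_def idm_closed)
  fix fs gs
  assume "composable A (fs @ id_arr A X # gs)" "length fs + length gs \<noteq> 1"
  moreover from this have "length fs + length gs \<ge> 2 \<or> length fs + length gs = 0"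
    by linarith
  ultimately show "mu A (fs @ id_arr A X # gs) = 0"
    using mu_idm mu1_idm assms by auto
qed

lemma rel: "composable A fs \<Longrightarrow> ainf_rel A fs = 0"
  using ainf_category_axioms by (simp add: ainf_category_iff)

end

section \<open>Extensions of an \<open>A\<^sub>\<infinity>\<close>-category by graded coefficients\<close>

lemma in_listset: "xs \<in> listset As \<longleftrightarrow> list_all2 (\<in>) xs As"
  by (induction As arbitrary: xs) (auto simp: set_Cons_def list_all2_Cons2)

lemma finite_listset:
  assumes "\<And>K. K \<in> set Ks \<Longrightarrow> finite K"
  shows "finite (listset Ks)"
  using assms
proof (induction Ks)
  case (Cons K Ks)
  have "set_Cons K (listset Ks) = (\<lambda>(x, xs). x # xs) ` (K \<times> listset Ks)"
    by (auto simp: set_Cons_def)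
  then show ?case
    using Cons by simp
qed simp

lemma list_slotE:
  assumes "length l = m + Suc n"
  obtains us x vs where "l = us @ x # vs" "length us = m" "length vs = n"
  using assms by (intro that[of "take m l" "l ! m" "drop (Suc m) l"] id_take_nth_drop) auto

lemma lookup_map_0: "f 0 = 0 \<Longrightarrow> Poly_Mapping.lookup (Poly_Mapping.map f p) k = f (Poly_Mapping.lookup p k)"
  by (simp add: Poly_Mapping.map.rep_eq when_def)

lemma vector_space_map:
  fixes s :: "'k::field \<Rightarrow> 'm::ab_group_add \<Rightarrow> 'm"
  assumes "vector_space s"
  shows "vector_space (\<lambda>c. Poly_Mapping.map (s c) :: ('i \<Rightarrow>\<^sub>0 'm) \<Rightarrow> _)"
proof -
  interpret vector_space s by fact
  show ?thesis
    by unfold_locales (auto intro!: poly_mapping_eqI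
      simp: lookup_map_0 lookup_add scale_right_distrib scale_left_distrib)
qed

text \<open>The exponent in the signs of both \<open>laurent\<close> and \<open>ZZ\<close>: every
  pair of positions i < j contributes the coefficient degree at i times the reduced degree at j. The
  recursive form yields \<open>cross_append\<close>, from which the sign of a contracted block is
  computed.\<close>

fun cross :: "(int \<times> int) list \<Rightarrow> int" where
  "cross [] = 0"
| "cross (x # l) = fst x * sum_list (map snd l) + cross l"

lemma cross_append:
  "cross (l @ l') = cross l + cross l' + sum_list (map fst l) * sum_list (map snd l')"
  by (induction l) (auto simp: algebra_simps)

lemma cross_eq_sum: "cross l = (\<Sum>j<length l. \<Sum>i<j. fst (l ! i) * snd (l ! j))"
proof (induction l)
  case (Cons x l)
  have "(\<Sum>j<length (x # l). \<Sum>i<j. fst ((x # l) ! i) * snd ((x # l) ! j)) =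
    (\<Sum>j<length l. fst x * snd (l ! j) + (\<Sum>i<j. fst (l ! i) * snd (l ! j)))"
    by (simp add: sum.lessThan_Suc_shift del: sum.lessThan_Suc)
  also have "\<dots> = cross (x # l)"
    by (simp add: sum.distrib Cons sum_list_sum_nth sum_distrib_left atLeast0LessThan)
  finally show ?case ..
qed simp

text \<open>A graded coefficient category with bases in which products of composable basis elements
  are again basis elements. A key is such an element, from the index \<open>ks\<close> to the index
  \<open>kt\<close>, of degree \<open>sd\<close>, with product \<open>cc\<close> and identities
  \<open>un\<close>. For \<open>laurent\<close> the keys are the powers of t over a single index,
  for \<open>ZZ\<close> the matrix units. The product is a total function on keys, so
  \<open>cc_assoc\<close> carries no composability condition.\<close>

locale key_grading =
  fixes part :: "'p \<Rightarrow> 'x \<Rightarrow> 'o" and Ix :: "'p \<Rightarrow> 'x set" and ks kt :: "'i \<Rightarrow> 'x"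
    and sd :: "'p \<Rightarrow> 'p \<Rightarrow> 'i \<Rightarrow> int" and cc :: "'i \<Rightarrow> 'i \<Rightarrow> 'i" and un :: "'x \<Rightarrow> 'i"
  assumes cc_assoc: "cc (cc \<kappa> \<kappa>') \<kappa>'' = cc \<kappa> (cc \<kappa>' \<kappa>'')"
    and ks_cc: "kt \<kappa> = ks \<kappa>' \<Longrightarrow> ks (cc \<kappa> \<kappa>') = ks \<kappa>"
    and kt_cc: "kt \<kappa> = ks \<kappa>' \<Longrightarrow> kt (cc \<kappa> \<kappa>') = kt \<kappa>'"
    and sd_cc: "kt \<kappa> = ks \<kappa>' \<Longrightarrow> sd X Z (cc \<kappa> \<kappa>') = sd X Y \<kappa> + sd Y Z \<kappa>'"
    and ks_un: "ks (un x) = x" and kt_un: "kt (un x) = x"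
    and cc_un_left: "cc (un (ks \<kappa>)) \<kappa> = \<kappa>" and cc_un_right: "cc \<kappa> (un (kt \<kappa>)) = \<kappa>"
    and sd_un: "sd X X (un x) = 0"
begin

abbreviation chain :: "'i list \<Rightarrow> bool" where
  "chain \<equiv> successively (\<lambda>\<kappa> \<kappa>'. kt \<kappa> = ks \<kappa>')"

fun cmp :: "'i list \<Rightarrow> 'i" where
  "cmp [] = undefined"
| "cmp [\<kappa>] = \<kappa>"
| "cmp (\<kappa> # \<kappa>' # l) = cc \<kappa> (cmp (\<kappa>' # l))"

definition adm :: "('p, 'v) arr \<Rightarrow> 'i \<Rightarrow> bool" where
  "adm f \<kappa> \<longleftrightarrow> ks \<kappa> \<in> Ix (src f) \<and> kt \<kappa> \<in> Ix (tgt f)"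

definition component :: "('p, 'i \<Rightarrow>\<^sub>0 'v::zero) arr \<Rightarrow> 'i \<Rightarrow> ('o, 'v) arr" where
  "component f \<kappa> = Arr (part (src f) (ks \<kappa>)) (part (tgt f) (kt \<kappa>)) (deg f - sd (src f) (tgt f) \<kappa>)
     (Poly_Mapping.lookup (val f) \<kappa>)"

text \<open>The two numbers paired by \<open>cross\<close>: the degree of the coefficient and the
  reduced degree of the factor in \<open>A\<close>.\<close>

definition weight :: "('p, 'v) arr \<Rightarrow> 'i \<Rightarrow> int \<times> int" where
  "weight f \<kappa> = (sd (src f) (tgt f) \<kappa>, deg f - sd (src f) (tgt f) \<kappa> - 1)"

lemma component_sel [simp]:
  "src (component f \<kappa>) = part (src f) (ks \<kappa>)" "tgt (component f \<kappa>) = part (tgt f) (kt \<kappa>)"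
  "deg (component f \<kappa>) = deg f - sd (src f) (tgt f) \<kappa>"
  "val (component f \<kappa>) = Poly_Mapping.lookup (val f) \<kappa>"
  by (simp_all add: component_def)

lemma ks_cmp: "\<kappa>s \<noteq> [] \<Longrightarrow> chain \<kappa>s \<Longrightarrow> ks (cmp \<kappa>s) = ks (hd \<kappa>s)"
  by (induction \<kappa>s rule: cmp.induct) (auto simp: ks_cc)

lemma kt_cmp: "\<kappa>s \<noteq> [] \<Longrightarrow> chain \<kappa>s \<Longrightarrow> kt (cmp \<kappa>s) = kt (last \<kappa>s)"
  by (induction \<kappa>s rule: cmp.induct) (auto simp: kt_cc ks_cmp)

lemma cmp_Cons: "l \<noteq> [] \<Longrightarrow> cmp (\<kappa> # l) = cc \<kappa> (cmp l)"
  by (cases l) auto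

lemma cmp_append: "xs \<noteq> [] \<Longrightarrow> ys \<noteq> [] \<Longrightarrow> cmp (xs @ ys) = cc (cmp xs) (cmp ys)"
  by (induction xs rule: cmp.induct) (auto simp: cmp_Cons cc_assoc)

lemma cmp_contract: "ys \<noteq> [] \<Longrightarrow> cmp (xs @ cmp ys # zs) = cmp (xs @ ys @ zs)"
  by (cases "xs = []"; cases "zs = []") (auto simp: cmp_append cmp_Cons)

lemma chain_contract:
  assumes "ys \<noteq> []" "chain ys"
  shows "chain (xs @ cmp ys # zs) \<longleftrightarrow> chain (xs @ ys @ zs)"
  using assms by (auto simp: successively_append_iff successively_Cons ks_cmp kt_cmp)

text \<open>Coefficient degrees add along a chain, with the intermediate objects of the path in
  between. This puts the output of an operation in the right degree.\<close>

lemma sd_cmp: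
  assumes "ps \<noteq> []" "successively (\<lambda>f g. tgt f = src g) (map fst ps)" "chain (map snd ps)"
  shows "sd (src (fst (hd ps))) (tgt (fst (last ps))) (cmp (map snd ps)) =
    (\<Sum>(f, \<kappa>)\<leftarrow>ps. sd (src f) (tgt f) \<kappa>)"
  using assms
proof (induction ps rule: induct_list012)
  case (3 p q ps)
  have "sd (src (fst p)) (tgt (fst (last (q # ps)))) (cc (snd p) (cmp (map snd (q # ps)))) =
    sd (src (fst p)) (tgt (fst p)) (snd p) +
    sd (tgt (fst p)) (tgt (fst (last (q # ps)))) (cmp (map snd (q # ps)))"
    using 3 by (intro sd_cc) (auto simp: ks_cmp simp del: cmp.simps)
  with 3 show ?case
    by (simp add: case_prod_unfold)
qed (auto simp: case_prod_unfold)

end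

text \<open>\<open>B\<close> is the tensor product of the coefficient category with
  \<open>A\<close>. The operation is specified through some admissible key sets \<open>Ks\<close>
  that contain the supports, because \<open>laurent\<close> sums over supports and \<open>ZZ\<close>
  over all index paths; by \<open>sum_mu_term_superset\<close> the result does not depend on the
  choice.\<close>

locale graded_extension = key_grading part Ix ks kt sd cc un + A: ainf_category A
  for part :: "'p \<Rightarrow> 'x \<Rightarrow> 'o" and Ix :: "'p \<Rightarrow> 'x set" and ks kt :: "'i \<Rightarrow> 'x"
    and sd :: "'p \<Rightarrow> 'p \<Rightarrow> 'i \<Rightarrow> int" and cc :: "'i \<Rightarrow> 'i \<Rightarrow> 'i" and un :: "'x \<Rightarrow> 'i"
    and A :: "('k::field, 'o, 'm::ab_group_add) ainf" +
  fixes B :: "('k, 'p, 'i \<Rightarrow>\<^sub>0 'm) ainf"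
  assumes finite_Ix: "X \<in> Obj B \<Longrightarrow> finite (Ix X)"
    and part_closed: "X \<in> Obj B \<Longrightarrow> x \<in> Ix X \<Longrightarrow> part X x \<in> Obj A"
    and Hom_B: "X \<in> Obj B \<Longrightarrow> Y \<in> Obj B \<Longrightarrow> Hom B X Y n = {f. \<forall>\<kappa>.
      if ks \<kappa> \<in> Ix X \<and> kt \<kappa> \<in> Ix Y
      then Poly_Mapping.lookup f \<kappa> \<in> Hom A (part X (ks \<kappa>)) (part Y (kt \<kappa>)) (n - sd X Y \<kappa>)
      else Poly_Mapping.lookup f \<kappa> = 0}"
    and smul_B: "smul B = (\<lambda>c. Poly_Mapping.map (smul A c))"
    and mu_B_some: "composable B fs \<Longrightarrow> \<exists>Ks.
      list_all2 (\<lambda>f K. finite K \<and> Poly_Mapping.keys (val f) \<subseteq> K \<and> (\<forall>\<kappa>\<in>K. adm f \<kappa>)) fs Ks \<and>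
      mu B fs = (\<Sum>\<kappa>s\<in>{\<kappa>s \<in> listset Ks. chain \<kappa>s}.
        signed (cross (map2 weight fs \<kappa>s))
          (Poly_Mapping.single (cmp \<kappa>s) (mu A (map2 component fs \<kappa>s))))"
    and idm_B: "X \<in> Obj B \<Longrightarrow> Poly_Mapping.lookup (idm B X) \<kappa> =
      (if ks \<kappa> \<in> Ix X \<and> \<kappa> = un (ks \<kappa>) then idm A (part X (ks \<kappa>)) else 0)"
begin

abbreviation mu_term :: "('p, 'i \<Rightarrow>\<^sub>0 'm) arr list \<Rightarrow> 'i list \<Rightarrow> 'i \<Rightarrow>\<^sub>0 'm" where
  "mu_term fs \<kappa>s \<equiv> signed (cross (map2 weight fs \<kappa>s))
     (Poly_Mapping.single (cmp \<kappa>s) (mu A (map2 component fs \<kappa>s)))"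

lemma is_arr_adm: "is_arr B f \<Longrightarrow> \<kappa> \<in> Poly_Mapping.keys (val f) \<Longrightarrow> adm f \<kappa>"
  by (auto simp: is_arr_def Hom_B in_keys_iff adm_def split: if_splits)

lemma component_closed: "is_arr B f \<Longrightarrow> adm f \<kappa> \<Longrightarrow> is_arr A (component f \<kappa>)"
  by (auto simp: is_arr_def Hom_B adm_def part_closed split: if_splits)

lemma components_composable:
  assumes "composable B fs" "list_all2 adm fs \<kappa>s" "chain \<kappa>s"
  shows "composable A (map2 component fs \<kappa>s)"
proof -
  have len: "length fs = length \<kappa>s"
    using assms(2) by (rule list_all2_lengthD)
  have "is_arr A (component f \<kappa>)" if "(f, \<kappa>) \<in> set (zip fs \<kappa>s)" for f \<kappa>
    using that assms(1,2) len
    by (intro component_closed) (auto simp: composable_iff list_all2_iff dest: set_zip_leftD)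
  moreover have "successively (\<lambda>f g. tgt f = src g) (map2 component fs \<kappa>s)"
    using len assms(1,3) unfolding composable_iff
    by (induction fs \<kappa>s rule: list_induct2) (auto simp: successively_Cons hd_map hd_zip)
  moreover have "map2 component fs \<kappa>s \<noteq> []"
    using len assms(1) by (auto simp: composable_iff)
  ultimately show ?thesis
    by (auto simp: composable_iff)
qed

lemma single_Hom:
  assumes "X \<in> Obj B" "Y \<in> Obj B" "ks \<kappa> \<in> Ix X" "kt \<kappa> \<in> Ix Y"
    "a \<in> Hom A (part X (ks \<kappa>)) (part Y (kt \<kappa>)) (n - sd X Y \<kappa>)"
  shows "Poly_Mapping.single \<kappa> a \<in> Hom B X Y n"
  using assms by (auto simp: Hom_B lookup_single when_def part_closed intro!: A.Hom_zero)

sublocale B: closed_ainf B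
proof (rule closed_ainf.intro)
  show vs: "vector_space (smul B)"
    unfolding smul_B by (rule vector_space_map) (rule A.vs)
  interpret vector_space "smul B" by (rule vs)
  fix X Y n
  assume "X \<in> Obj B" "Y \<in> Obj B"
  then show "module.subspace (smul B) (Hom B X Y n)"
    unfolding subspace_def
    by (auto simp: Hom_B smul_B lookup_add lookup_map_0 part_closed
      intro: A.Hom_zero A.Hom_add A.Hom_smul)
qed

text \<open>The coefficient degrees removed from the components add up to the degree of the
  composite key, so the term lies in the same degree for every chain.\<close>

lemma mu_term_Hom:
  assumes "composable B fs" "list_all2 adm fs \<kappa>s" "chain \<kappa>s"
  shows "mu_term fs \<kappa>s \<in> Hom B (src (hd fs)) (tgt (last fs)) (sum_list (map deg fs) + 2 - int (length fs))"
proof -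
  define ps where "ps = zip fs \<kappa>s"
  have len: "length fs = length \<kappa>s"
    using assms(2) by (rule list_all2_lengthD)
  then have ps: "fs = map fst ps" "\<kappa>s = map snd ps"
    by (auto simp: ps_def)
  have ne: "ps \<noteq> []" "fs \<noteq> []" "\<kappa>s \<noteq> []"
    using assms(1) ps by (auto simp: composable_iff)
  have "is_arr A (mu_arr A (map2 component fs \<kappa>s))"
    using components_composable[OF assms] by (rule A.mu_arr_closed)
  then have 1: "mu A (map2 component fs \<kappa>s) \<in>
      Hom A (src (hd (map2 component fs \<kappa>s))) (tgt (last (map2 component fs \<kappa>s)))
       (sum_list (map deg (map2 component fs \<kappa>s)) + 2 - int (length fs))"
    using len by (simp add: is_arr_def mu_arr_def)
  have 2: "src (hd (map2 component fs \<kappa>s)) = part (src (hd fs)) (ks (hd \<kappa>s))"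
     "tgt (last (map2 component fs \<kappa>s)) = part (tgt (last fs)) (kt (last \<kappa>s))"
    using ne len by (simp_all add: hd_map hd_zip last_map last_zip)
  have 3: "sum_list (map deg (map2 component fs \<kappa>s)) = sum_list (map deg fs) -
      sd (src (hd fs)) (tgt (last fs)) (cmp \<kappa>s)"
    using sd_cmp[OF ne(1)] assms(1,3) ne(1) unfolding ps_def[symmetric]
    by (simp add: ps composable_iff hd_map last_map sum_list_subtractf case_prod_unfold comp_def)
  have obj: "src (hd fs) \<in> Obj B" "tgt (last fs) \<in> Obj B"
    using assms(1) ne by (auto simp: composable_iff is_arr_def)
  have "adm (hd fs) (hd \<kappa>s)" "adm (last fs) (last \<kappa>s)"
    using assms(2) ne len by (auto simp: list_all2_conv_all_nth hd_conv_nth last_conv_nth)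
  then have "Poly_Mapping.single (cmp \<kappa>s) (mu A (map2 component fs \<kappa>s)) \<in>
      Hom B (src (hd fs)) (tgt (last fs)) (sum_list (map deg fs) + 2 - int (length fs))"
    using 1 obj ne assms(3) unfolding 2 3
    by (intro single_Hom) (auto simp: ks_cmp kt_cmp adm_def algebra_simps)
  then show ?thesis
    using B.Hom_signed obj by blast
qed

text \<open>A key outside the support of its morphism gives a zero component, hence a zero term.
  Enlarging the key sets lets sums for different morphisms range over one index set.\<close>

lemma sum_mu_term_superset:
  assumes comp: "composable B fs"
    and Ks: "list_all2 (\<lambda>f K. finite K \<and> Poly_Mapping.keys (val f) \<subseteq> K \<and> (\<forall>\<kappa>\<in>K. adm f \<kappa>)) fs Ks"
  shows "(\<Sum>\<kappa>s\<in>{\<kappa>s \<in> listset (map (\<lambda>f. Poly_Mapping.keys (val f)) fs). chain \<kappa>s}. mu_term fs \<kappa>s) =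
    (\<Sum>\<kappa>s\<in>{\<kappa>s \<in> listset Ks. chain \<kappa>s}. mu_term fs \<kappa>s)"
proof (rule sum.mono_neutral_left)
  have "finite (listset Ks)"
    using Ks by (intro finite_listset) (auto simp: list_all2_conv_all_nth in_set_conv_nth)
  then show "finite {\<kappa>s \<in> listset Ks. chain \<kappa>s}"
    by simp
  show "{\<kappa>s \<in> listset (map (\<lambda>f. Poly_Mapping.keys (val f)) fs). chain \<kappa>s} \<subseteq> {\<kappa>s \<in> listset Ks. chain \<kappa>s}"
    using Ks by (fastforce simp: in_listset list_all2_conv_all_nth)
  show "\<forall>\<kappa>s\<in>{\<kappa>s \<in> listset Ks. chain \<kappa>s} -
      {\<kappa>s \<in> listset (map (\<lambda>f. Poly_Mapping.keys (val f)) fs). chain \<kappa>s}. mu_term fs \<kappa>s = 0"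
  proof
    fix \<kappa>s
    assume *: "\<kappa>s \<in> {\<kappa>s \<in> listset Ks. chain \<kappa>s} -
      {\<kappa>s \<in> listset (map (\<lambda>f. Poly_Mapping.keys (val f)) fs). chain \<kappa>s}"
    then have chain: "chain \<kappa>s" and adm: "list_all2 adm fs \<kappa>s" and len: "length \<kappa>s = length fs"
      using Ks by (fastforce simp: in_listset list_all2_conv_all_nth)+
    obtain l where l: "l < length fs" "\<kappa>s ! l \<notin> Poly_Mapping.keys (val (fs ! l))"
      using * len by (auto simp: in_listset list_all2_conv_all_nth)
    have "mu A (map2 component fs \<kappa>s) = 0"
      using components_composable[OF comp adm chain] l len
      by (intro A.mu_nth_zero[of _ l]) (auto simp: in_keys_iff)
    then show "mu_term fs \<kappa>s = 0"
      by simp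
  qed
qed

lemma mu_B_superset:
  assumes "composable B fs"
    and "list_all2 (\<lambda>f K. finite K \<and> Poly_Mapping.keys (val f) \<subseteq> K \<and> (\<forall>\<kappa>\<in>K. adm f \<kappa>)) fs Ks"
  shows "mu B fs = (\<Sum>\<kappa>s\<in>{\<kappa>s \<in> listset Ks. chain \<kappa>s}. mu_term fs \<kappa>s)"
  using mu_B_some[OF assms(1)]
  by (auto simp flip: sum_mu_term_superset[OF assms] sum_mu_term_superset[OF assms(1)])

lemma mu_B:
  assumes "composable B fs"
  shows "mu B fs =
    (\<Sum>\<kappa>s\<in>{\<kappa>s \<in> listset (map (\<lambda>f. Poly_Mapping.keys (val f)) fs). chain \<kappa>s}. mu_term fs \<kappa>s)"
  using mu_B_some[OF assms] by (auto simp flip: sum_mu_term_superset[OF assms])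

lemma adm_keys:
  "composable B fs \<Longrightarrow> list_all2 (\<lambda>f K. finite K \<and> Poly_Mapping.keys (val f) \<subseteq> K \<and> (\<forall>\<kappa>\<in>K. adm f \<kappa>)) fs
     (map (\<lambda>f. Poly_Mapping.keys (val f)) fs)"
  by (auto simp: list_all2_conv_all_nth composable_iff intro!: is_arr_adm)

sublocale B: multilinear_ainf B
proof
  fix fs
  assume comp: "composable B fs"
  then have obj: "src (hd fs) \<in> Obj B" "tgt (last fs) \<in> Obj B"
    by (auto simp: composable_iff is_arr_def)
  have "mu B fs \<in> Hom B (src (hd fs)) (tgt (last fs)) (sum_list (map deg fs) + 2 - int (length fs))"
    unfolding mu_B[OF comp]
    using adm_keys[OF comp]
    by (intro B.Hom_sum obj mu_term_Hom comp) (auto simp: in_listset list_all2_conv_all_nth)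
  then show "is_arr B (mu_arr B fs)"
    using obj by (simp add: is_arr_def mu_arr_def)
next
  fix fs gs X Y n a b
  assume comp: "composable B (fs @ Arr X Y n a # gs)" and b: "b \<in> Hom B X Y n"
  \<comment> \<open>One index set for the three sums with \<open>a\<close>, \<open>b\<close> and
    \<open>a + b\<close> in the slot.\<close>
  define Ks where "Ks = map (\<lambda>f. Poly_Mapping.keys (val f)) fs @
    (Poly_Mapping.keys a \<union> Poly_Mapping.keys b) # map (\<lambda>f. Poly_Mapping.keys (val f)) gs"
  have arr: "is_arr B (Arr X Y n a)" "is_arr B (Arr X Y n b)"
    using composable_slot[OF comp] b by (auto simp: is_arr_def)
  then have arr_ab: "is_arr B (Arr X Y n (a + b))"
    by (auto simp: is_arr_def B.Hom_add)
  have comp_c: "composable B (fs @ Arr X Y n c # gs)" if "is_arr B (Arr X Y n c)" for c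
    using composable_replace[OF comp that] by simp
  have Ks: "list_all2 (\<lambda>f K. finite K \<and> Poly_Mapping.keys (val f) \<subseteq> K \<and> (\<forall>\<kappa>\<in>K. adm f \<kappa>))
     (fs @ Arr X Y n c # gs) Ks" if "Poly_Mapping.keys c \<subseteq> Poly_Mapping.keys a \<union> Poly_Mapping.keys b" for c
  proof -
    have "adm (Arr X Y n c) \<kappa>" if "\<kappa> \<in> Poly_Mapping.keys a \<union> Poly_Mapping.keys b" for \<kappa>
      using that is_arr_adm[OF arr(1)] is_arr_adm[OF arr(2)] by (auto simp: adm_def)
    then show ?thesis
      unfolding Ks_def using adm_keys[OF comp] that by (simp add: list_all2_append)
  qed
  have trm_add: "mu_term (fs @ Arr X Y n (a + b) # gs) \<kappa>s =
      mu_term (fs @ Arr X Y n a # gs) \<kappa>s + mu_term (fs @ Arr X Y n b # gs) \<kappa>s"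
    if "\<kappa>s \<in> {\<kappa>s \<in> listset Ks. chain \<kappa>s}" for \<kappa>s
  proof -
    have adm: "list_all2 adm (fs @ Arr X Y n c # gs) \<kappa>s"
      if "Poly_Mapping.keys c \<subseteq> Poly_Mapping.keys a \<union> Poly_Mapping.keys b" for c
      using \<open>\<kappa>s \<in> _\<close> Ks[OF that] by (auto simp: in_listset list_all2_conv_all_nth)
    have "length \<kappa>s = length fs + Suc (length gs)"
      using adm[of a] by (auto dest: list_all2_lengthD)
    then obtain us \<kappa> vs where \<kappa>s: "\<kappa>s = us @ \<kappa> # vs" "length us = length fs" "length vs = length gs"
      by (rule list_slotE)
    have m2: "map2 component (fs @ Arr X Y n c # gs) \<kappa>s =
        map2 component fs us @ component (Arr X Y n c) \<kappa> # map2 component gs vs" for c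
      using \<kappa>s by simp
    have "map2 weight (fs @ Arr X Y n c # gs) \<kappa>s =
        map2 weight fs us @ (sd X Y \<kappa>, n - sd X Y \<kappa> - 1) # map2 weight gs vs" for c :: "'i \<Rightarrow>\<^sub>0 'm"
      using \<kappa>s by (simp add: weight_def)
    moreover have "mu A (map2 component (fs @ Arr X Y n (a + b) # gs) \<kappa>s) =
      mu A (map2 component (fs @ Arr X Y n a # gs) \<kappa>s) + mu A (map2 component (fs @ Arr X Y n b # gs) \<kappa>s)"
    proof -
      have "composable A (map2 component (fs @ Arr X Y n a # gs) \<kappa>s)"
        using components_composable[OF comp adm] that by auto
      moreover have "is_arr A (component (Arr X Y n b) \<kappa>)"
        using component_closed[OF arr(2)] adm[of b] \<kappa>s by (auto simp: list_all2_append)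
      ultimately show ?thesis
        unfolding m2 by (simp add: component_def lookup_add A.mu_slot_add is_arr_def)
    qed
    ultimately show ?thesis
      by (simp add: single_add signed_add)
  qed
  show "mu B (fs @ Arr X Y n (a + b) # gs) = mu B (fs @ Arr X Y n a # gs) + mu B (fs @ Arr X Y n b # gs)"
    unfolding mu_B_superset[OF comp Ks, simplified] mu_B_superset[OF comp_c[OF arr(2)] Ks, simplified]
      mu_B_superset[OF comp_c[OF arr_ab] Ks[OF keys_add]]
    using trm_add by (simp add: sum.distrib)
next
  fix fs gs X Y n a c
  assume comp: "composable B (fs @ Arr X Y n a # gs)"
  let ?ca = "smul B c a"
  have arr: "is_arr B (Arr X Y n a)"
    using composable_slot[OF comp] .
  then have arr_c: "is_arr B (Arr X Y n ?ca)"
    by (auto simp: is_arr_def B.Hom_smul)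
  have sub: "Poly_Mapping.keys ?ca \<subseteq> Poly_Mapping.keys a"
    by (auto simp: smul_B in_keys_iff lookup_map_0)
  define Ks where "Ks = map (\<lambda>f. Poly_Mapping.keys (val f)) (fs @ Arr X Y n a # gs)"
  have Ks: "list_all2 (\<lambda>f K. finite K \<and> Poly_Mapping.keys (val f) \<subseteq> K \<and> (\<forall>\<kappa>\<in>K. adm f \<kappa>))
     (fs @ Arr X Y n b # gs) Ks" if "b = a \<or> b = ?ca" for b
    using adm_keys[OF comp] that sub by (auto simp: list_all2_append Ks_def adm_def)
  have comp_c: "composable B (fs @ Arr X Y n ?ca # gs)"
    using composable_replace[OF comp arr_c] by simp
  have trm: "mu_term (fs @ Arr X Y n ?ca # gs) \<kappa>s = smul B c (mu_term (fs @ Arr X Y n a # gs) \<kappa>s)"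
    if "\<kappa>s \<in> {\<kappa>s \<in> listset Ks. chain \<kappa>s}" for \<kappa>s
  proof -
    have adm: "list_all2 adm (fs @ Arr X Y n a # gs) \<kappa>s"
      using \<open>\<kappa>s \<in> _\<close> Ks[of a] by (auto simp: in_listset list_all2_conv_all_nth)
    have "length \<kappa>s = length fs + Suc (length gs)"
      using adm by (auto dest: list_all2_lengthD)
    then obtain us \<kappa> vs where \<kappa>s: "\<kappa>s = us @ \<kappa> # vs" "length us = length fs" "length vs = length gs"
      by (rule list_slotE)
    have "map2 weight (fs @ Arr X Y n ?ca # gs) \<kappa>s = map2 weight (fs @ Arr X Y n a # gs) \<kappa>s"
      using \<kappa>s by (simp add: weight_def)
    moreover have "mu A (map2 component (fs @ Arr X Y n ?ca # gs) \<kappa>s) =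
        smul A c (mu A (map2 component (fs @ Arr X Y n a # gs) \<kappa>s))"
      using components_composable[OF comp adm] that \<kappa>s
      by (simp add: component_def smul_B lookup_map_0 A.mu_slot_smul)
    moreover have "signed m (smul B c x) = smul B c (signed m x)" for m x
      by (auto simp: signed_def)
    moreover have "Poly_Mapping.single k (smul A c x) = smul B c (Poly_Mapping.single k x)" for k x
      by (auto intro!: poly_mapping_eqI simp: smul_B lookup_map_0 lookup_single when_def)
    ultimately show ?thesis
      by simp
  qed
  show "mu B (fs @ Arr X Y n ?ca # gs) = smul B c (mu B (fs @ Arr X Y n a # gs))"
    unfolding mu_B_superset[OF comp Ks, simplified] mu_B_superset[OF comp_c Ks, simplified]
    using trm by (simp add: B.scale_sum_right)
qed

section \<open>The relations of an extension on monomials\<close>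

lemma mu_monomials:
  assumes "composable B fs" "list_all2 adm fs \<kappa>s"
    and "list_all2 (\<lambda>f \<kappa>. Poly_Mapping.keys (val f) \<subseteq> {\<kappa>}) fs \<kappa>s"
  shows "mu B fs = (if chain \<kappa>s then mu_term fs \<kappa>s else 0)"
proof -
  have "listset (map (\<lambda>\<kappa>. {\<kappa>}) \<kappa>s) = {\<kappa>s}" for \<kappa>s :: "'i list"
    by (induction \<kappa>s) (auto simp: set_Cons_def)
  then have "{\<kappa>s' \<in> listset (map (\<lambda>\<kappa>. {\<kappa>}) \<kappa>s). chain \<kappa>s'} = (if chain \<kappa>s then {\<kappa>s} else {})"
    by auto
  moreover have "mu B fs = (\<Sum>\<kappa>s\<in>{\<kappa>s' \<in> listset (map (\<lambda>\<kappa>. {\<kappa>}) \<kappa>s). chain \<kappa>s'}. mu_term fs \<kappa>s)"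
    using assms by (intro mu_B_superset) (auto simp: list_all2_conv_all_nth)
  ultimately show ?thesis
    by simp
qed

text \<open>Each term of the relation in \<open>B\<close> is the corresponding term in
  \<open>A\<close> on the components, up to a sign and a key that are the same for all splittings.
  The relation in \<open>A\<close> therefore gives the one in \<open>B\<close>.\<close>

lemma ainf_rel_monomials:
  assumes comp: "composable B (map fst ps)"
    and adm: "\<And>f \<kappa>. (f, \<kappa>) \<in> set ps \<Longrightarrow> adm f \<kappa>"
    and keys: "\<And>f \<kappa>. (f, \<kappa>) \<in> set ps \<Longrightarrow> Poly_Mapping.keys (val f) \<subseteq> {\<kappa>}"
  shows "ainf_rel B (map fst ps) = 0"
proof -
  define cm :: "(('p, 'i \<Rightarrow>\<^sub>0 'm) arr \<times> 'i) list \<Rightarrow> ('o, 'm) arr list" where "cm = map (\<lambda>(f, \<kappa>). component f \<kappa>)"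
  define wt :: "(('p, 'i \<Rightarrow>\<^sub>0 'm) arr \<times> 'i) list \<Rightarrow> (int \<times> int) list" where "wt = map (\<lambda>(f, \<kappa>). weight f \<kappa>)"
  have mono: "mu B (map fst qs) = (if chain (map snd qs)
      then signed (cross (wt qs)) (Poly_Mapping.single (cmp (map snd qs)) (mu A (cm qs))) else 0)"
    if "composable B (map fst qs)" "\<And>f \<kappa>. (f, \<kappa>) \<in> set qs \<Longrightarrow> adm f \<kappa>"
      "\<And>f \<kappa>. (f, \<kappa>) \<in> set qs \<Longrightarrow> Poly_Mapping.keys (val f) \<subseteq> {\<kappa>}" for qs
    using mu_monomials[of "map fst qs" "map snd qs"] that
    by (simp add: zip_map_fst_snd cm_def wt_def list_all2_conv_all_nth)
  have trm: "signed (\<Sum>f\<leftarrow>map fst xs. deg f - 1) (mu B (map fst xs @ [mu_arr B (map fst ys)] @ map fst zs)) =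
      (if chain (map snd ps) then signed (cross (wt ps)) (Poly_Mapping.single (cmp (map snd ps))
        (signed (\<Sum>f\<leftarrow>cm xs. deg f - 1) (mu A (cm xs @ [mu_arr A (cm ys)] @ cm zs)))) else 0)"
    if split: "(xs, ys, zs) \<in> splits ps" for xs ys zs
  proof -
    have ps: "ps = xs @ ys @ zs" and ne: "ys \<noteq> []"
      using split by (auto simp: splits_def)
    define g where "g = mu_arr B (map fst ys)"
    define \<kappa> where "\<kappa> = cmp (map snd ys)"
    have comp_ys: "composable B (map fst ys)"
      using comp ne unfolding ps by (auto simp: composable_iff successively_append_iff)
    have mu_ys: "mu B (map fst ys) = (if chain (map snd ys)
      then signed (cross (wt ys)) (Poly_Mapping.single \<kappa> (mu A (cm ys))) else 0)"
      unfolding \<kappa>_def using comp_ys adm keys ps by (intro mono) auto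
    have comp': "composable B (map fst xs @ g # map fst zs)"
      unfolding g_def using comp ps ne by (intro B.composable_contract) auto
    show ?thesis
    proof (cases "chain (map snd ys)")
      \<comment> \<open>A broken chain inside the block kills the inner operation and also breaks
        the whole chain, so both sides are zero.\<close>
      case False
      then have "mu B (map fst xs @ g # map fst zs) = 0"
        using comp' mu_ys by (simp add: g_def mu_arr_def B.mu.slot_zero)
      moreover have "\<not> chain (map snd ps)"
        using False ps by (auto simp: successively_append_iff)
      ultimately show ?thesis
        by (simp add: g_def)
    next
      case True
      have succ_ys: "successively (\<lambda>f g. tgt f = src g) (map fst ys)"
        using comp_ys by (simp add: composable_iff)
      have sd: "sd (src g) (tgt g) \<kappa> = (\<Sum>(f, \<kappa>)\<leftarrow>ys. sd (src f) (tgt f) \<kappa>)"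
        using sd_cmp[OF ne succ_ys True] ne by (simp add: g_def \<kappa>_def mu_arr_def hd_map last_map)
      have ksk: "ks \<kappa> = ks (snd (hd ys))" "kt \<kappa> = kt (snd (last ys))"
        using True ne by (auto simp: \<kappa>_def ks_cmp kt_cmp hd_map last_map)
      have "adm (fst (hd ys)) (snd (hd ys))" "adm (fst (last ys)) (snd (last ys))"
        using ne by (auto intro!: adm simp: ps)
      then have adm_g: "adm g \<kappa>"
        using ksk ne by (auto simp: g_def mu_arr_def adm_def hd_map last_map)
      have val_g: "val g = signed (cross (wt ys)) (Poly_Mapping.single \<kappa> (mu A (cm ys)))"
        using True mu_ys by (simp add: g_def mu_arr_def)
      then have keys_g: "Poly_Mapping.keys (val g) \<subseteq> {\<kappa>}"
        by (auto simp: signed_def)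
      define qs where "qs = xs @ (g, \<kappa>) # zs"
      have mu_g: "mu B (map fst xs @ g # map fst zs) = (if chain (map snd ps)
        then signed (cross (wt qs)) (Poly_Mapping.single (cmp (map snd ps)) (mu A (cm qs))) else 0)"
      proof -
        have "adm f k \<and> Poly_Mapping.keys (val f) \<subseteq> {k}" if "(f, k) \<in> set qs" for f k
          using that adm[of f k] keys[of f k] adm_g keys_g by (auto simp: qs_def ps)
        then show ?thesis
          using mono[of qs] comp' ne True
          by (simp add: qs_def \<kappa>_def cmp_contract chain_contract ps)
      qed
      show ?thesis
      proof (cases "chain (map snd ps)")
        case False
        then show ?thesis
          using mu_g by (simp add: g_def)
      next
        case chain: True
        have deg_g: "deg g = (\<Sum>f\<leftarrow>map fst ys. deg f) + 2 - int (length ys)"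
          by (simp add: g_def mu_arr_def)
        have len: "(\<Sum>x\<leftarrow>l. h x - 1) = sum_list (map h l) - int (length l)" for h :: "'b \<Rightarrow> int" and l
          by (induction l) auto
        have comp_g: "component g \<kappa> = Arr (src (mu_arr A (cm ys))) (tgt (mu_arr A (cm ys)))
          (deg (mu_arr A (cm ys))) (signed (cross (wt ys)) (mu A (cm ys)))"
          using ne ksk sd deg_g
          by (simp add: component_def mu_arr_def cm_def hd_map last_map case_prod_unfold val_g
            lookup_signed sum_list_subtractf comp_def) (simp add: g_def mu_arr_def hd_map last_map)
        have "composable A (cm ps)"
          using components_composable[OF comp _ chain] adm
          by (simp add: zip_map_fst_snd cm_def list_all2_conv_all_nth)
        then have "composable A (cm xs @ mu_arr A (cm ys) # cm zs)"
          using ne by (intro A.composable_contract) (auto simp: ps cm_def)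
        then have "mu A (cm qs) = signed (cross (wt ys)) (mu A (cm xs @ [mu_arr A (cm ys)] @ cm zs))"
          using A.mu_slot_signed[of "cm xs" "src (mu_arr A (cm ys))" "tgt (mu_arr A (cm ys))"
            "deg (mu_arr A (cm ys))" "mu A (cm ys)" "cm zs" "cross (wt ys)"]
          by (simp add: qs_def cm_def[THEN fun_cong, of "_ @ _"] comp_g)
            (simp add: cm_def comp_g mu_arr_def)
        moreover have "signed (\<Sum>f\<leftarrow>map fst xs. deg f - 1) (signed (cross (wt qs)) (signed (cross (wt ys)) x)) =
          signed (cross (wt ps)) (signed (\<Sum>f\<leftarrow>cm xs. deg f - 1) x)" for x :: "'i \<Rightarrow>\<^sub>0 'm"
        proof -
          define S E where "S l = sum_list (map fst (wt l))" and "E l = sum_list (map snd (wt l))" for l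
          \<comment> \<open>An operation raises the total reduced degree by one, whence the
            \<open>+ 1\<close>, and it adds the coefficient degrees.\<close>
          have w: "snd (weight g \<kappa>) = E ys + 1" "fst (weight g \<kappa>) = S ys"
            using sd deg_g len[of "\<lambda>(f, \<kappa>). deg f - sd (src f) (tgt f) \<kappa>" ys]
            by (simp_all add: weight_def S_def E_def wt_def comp_def case_prod_unfold sum_list_subtractf)
          have 1: "(\<Sum>f\<leftarrow>map fst xs. deg f - 1) = S xs + E xs"
            by (simp add: S_def E_def wt_def comp_def case_prod_unfold weight_def sum_list_addf[symmetric])
          have 2: "(\<Sum>f\<leftarrow>cm xs. deg f - 1) = E xs"
            by (simp add: E_def wt_def cm_def comp_def case_prod_unfold weight_def)
          have 3: "cross (wt ps) = cross (wt xs) + cross (wt ys) + cross (wt zs) + S xs * (E ys + E zs) + S ys * E zs"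
            unfolding ps by (simp add: wt_def cross_append S_def E_def algebra_simps)
          have 4: "cross (wt qs) = cross (wt xs) + cross (wt zs) + S xs * (E ys + 1 + E zs) + S ys * E zs"
            unfolding qs_def using w by (simp add: wt_def cross_append S_def E_def algebra_simps)
          \<comment> \<open>One \<open>S xs\<close> comes from the reduced degrees of
            \<open>xs\<close> in \<open>B\<close>, another from the extra one in
            \<open>E ys + 1\<close>; they cancel modulo 2.\<close>
          show ?thesis
            unfolding signed_signed 1 2 3 4 by (rule signed_cong) (simp add: algebra_simps)
        qed
        ultimately show ?thesis
          using mu_g chain by (simp add: g_def single_signed)
      qed
    qed
  qed
  have "ainf_rel B (map fst ps) = (\<Sum>(xs, ys, zs)\<in>splits ps. signed (\<Sum>f\<leftarrow>map fst xs. deg f - 1)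
      (mu B (map fst xs @ [mu_arr B (map fst ys)] @ map fst zs)))"
    unfolding ainf_rel_def sum_splits_map by (simp add: case_prod_unfold)
  also have "\<dots> = (\<Sum>(xs, ys, zs)\<in>splits ps.
      (if chain (map snd ps) then signed (cross (wt ps)) (Poly_Mapping.single (cmp (map snd ps))
        (signed (\<Sum>f\<leftarrow>cm xs. deg f - 1) (mu A (cm xs @ [mu_arr A (cm ys)] @ cm zs)))) else 0))"
    using trm by (intro sum.cong) auto
  also have "\<dots> = (if chain (map snd ps) then signed (cross (wt ps))
      (Poly_Mapping.single (cmp (map snd ps)) (ainf_rel A (cm ps))) else 0)"
  proof -
    have single_sum: "Poly_Mapping.single k (sum h S) = (\<Sum>x\<in>S. Poly_Mapping.single k (h x))"
      for k :: 'i and h :: "'b \<Rightarrow> 'm" and S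
      by (rule poly_mapping_eqI) (simp add: lookup_sum lookup_single when_def)
    show ?thesis
      unfolding ainf_rel_def cm_def sum_splits_map
      by (simp add: single_sum signed_sum case_prod_unfold)
  qed
  also have "\<dots> = 0"
  proof -
    have "composable A (cm ps)" if "chain (map snd ps)"
      using components_composable[OF comp _ that] adm
      by (simp add: zip_map_fst_snd cm_def list_all2_conv_all_nth)
    then show ?thesis
      by (simp add: A.rel)
  qed
  finally show ?thesis .
qed

lemma monomial_decomposition:
  assumes "is_arr B f"
  shows "finite (Poly_Mapping.keys (val f)) \<and>
    val f = (\<Sum>\<kappa>\<in>Poly_Mapping.keys (val f). Poly_Mapping.single \<kappa> (Poly_Mapping.lookup (val f) \<kappa>)) \<and>
    (\<forall>\<kappa>\<in>Poly_Mapping.keys (val f).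
      is_arr B (Arr (src f) (tgt f) (deg f) (Poly_Mapping.single \<kappa> (Poly_Mapping.lookup (val f) \<kappa>))) \<and>
      adm f \<kappa>)"
  using assms is_arr_adm[OF assms]
  by (auto simp: sum_single_keys is_arr_def adm_def intro!: single_Hom) (auto simp: Hom_B split: if_splits)

lemma ainf_rel_B: "composable B fs \<Longrightarrow> ainf_rel B fs = 0"
proof (rule B.slot_additive_eqI[where E' = "\<lambda>_. 0" and G = "\<lambda>f. \<exists>\<kappa>. adm f \<kappa> \<and> Poly_Mapping.keys (val f) \<subseteq> {\<kappa>}"])
  show "slot_additive B (ainf_rel B)"
    by (rule B.ainf_rel_additive)
  show "slot_additive B (\<lambda>_. 0)"
    by standard simp
next
  fix f
  assume "is_arr B f"
  from monomial_decomposition[OF this] show "\<exists>(S :: 'i set) a. finite S \<and> val f = sum a S \<and>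
     (\<forall>s\<in>S. is_arr B (Arr (src f) (tgt f) (deg f) (a s)) \<and>
       (\<exists>\<kappa>. adm (Arr (src f) (tgt f) (deg f) (a s)) \<kappa> \<and> Poly_Mapping.keys (val (Arr (src f) (tgt f) (deg f) (a s))) \<subseteq> {\<kappa>}))"
    by (intro exI[of _ "Poly_Mapping.keys (val f)"]
      exI[of _ "\<lambda>\<kappa>. Poly_Mapping.single \<kappa> (Poly_Mapping.lookup (val f) \<kappa>)"]) (fastforce simp: adm_def)
next
  fix fs
  assume comp: "composable B fs" and G: "\<forall>f\<in>set fs. \<exists>\<kappa>. adm f \<kappa> \<and> Poly_Mapping.keys (val f) \<subseteq> {\<kappa>}"
  then obtain k where k: "\<And>f. f \<in> set fs \<Longrightarrow> adm f (k f) \<and> Poly_Mapping.keys (val f) \<subseteq> {k f}"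
    by metis
  have "ainf_rel B (map fst (map (\<lambda>f. (f, k f)) fs)) = 0"
    using comp k by (intro ainf_rel_monomials) (auto simp: comp_def)
  then show "ainf_rel B fs = 0"
    by (simp add: comp_def)
qed

text \<open>Every term of \<open>mu B\<close> has a component of \<open>u\<close> in the slot of
  \<open>u\<close>, so the vanishing in \<open>A\<close> passes up. Used twice, from
  \<open>A\<close> to \<open>laurent A\<close> and on to \<open>ZZ (laurent A)\<close>, it covers
  the isomorphisms that remove shifts.\<close>

lemma unitlike_B:
  assumes u: "is_arr B u"
    and comps: "\<And>\<kappa>. \<kappa> \<in> Poly_Mapping.keys (val u) \<Longrightarrow> unitlike A (component u \<kappa>)"
  shows "unitlike B u"
  unfolding unitlike_def
proof (intro conjI allI impI u)
  fix fs gs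
  assume comp: "composable B (fs @ u # gs)" and len: "length fs + length gs \<noteq> 1"
  show "mu B (fs @ u # gs) = 0"
    unfolding mu_B[OF comp]
  proof (intro sum.neutral ballI)
    fix \<kappa>s
    assume \<kappa>s: "\<kappa>s \<in> {\<kappa>s \<in> listset (map (\<lambda>f. Poly_Mapping.keys (val f)) (fs @ u # gs)). chain \<kappa>s}"
    have adm: "list_all2 adm (fs @ u # gs) \<kappa>s"
      using \<kappa>s adm_keys[OF comp] by (fastforce simp: in_listset list_all2_conv_all_nth)
    have "length \<kappa>s = length fs + Suc (length gs)"
      using adm by (auto dest: list_all2_lengthD)
    then obtain us \<kappa> vs where \<kappa>s_eq: "\<kappa>s = us @ \<kappa> # vs" "length us = length fs" "length vs = length gs"
      by (rule list_slotE)
    have "\<kappa> \<in> Poly_Mapping.keys (val u)"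
      using \<kappa>s \<kappa>s_eq by (simp add: in_listset list_all2_append)
    then have "mu A (map2 component (fs @ u # gs) \<kappa>s) = 0"
      using comps[of \<kappa>] components_composable[OF comp adm] \<kappa>s \<kappa>s_eq len by (simp add: unitlike_def)
    then show "mu_term (fs @ u # gs) \<kappa>s = 0"
      by simp
  qed
qed

text \<open>For a diagonal \<open>u\<close> the only possible key ending at x is \<open>e x\<close>,
  so the sum over chains collapses to one over the keys of \<open>f\<close>. Units and the
  isomorphisms that remove shifts are of this kind.\<close>

lemma mu_diagonal_left:
  assumes comp: "composable B [u, f]"
    and e: "\<And>x. kt (e x) = x" "\<And>x. x \<in> Ix (tgt u) \<Longrightarrow> ks (e x) \<in> Ix (src u)"
    and keys: "\<And>\<kappa>. \<kappa> \<in> Poly_Mapping.keys (val u) \<Longrightarrow> \<kappa> = e (kt \<kappa>)"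
  shows "mu B [u, f] = (\<Sum>\<kappa>\<in>Poly_Mapping.keys (val f).
    signed (sd (src u) (tgt u) (e (ks \<kappa>)) * (deg f - sd (src f) (tgt f) \<kappa> - 1))
      (Poly_Mapping.single (cc (e (ks \<kappa>)) \<kappa>) (mu A [component u (e (ks \<kappa>)), component f \<kappa>])))"
proof -
  have arr: "is_arr B u" "is_arr B f" "tgt u = src f"
    using comp by (auto simp: composable_pair)
  \<comment> \<open>The image of \<open>e\<close> may exceed the support of \<open>u\<close>; with
    it, exactly one chain belongs to every key of \<open>f\<close>.\<close>
  define Ks where "Ks = [e ` Ix (tgt u), Poly_Mapping.keys (val f)]"
  have "{\<kappa>s \<in> listset Ks. chain \<kappa>s} = (\<lambda>\<kappa>. [e (ks \<kappa>), \<kappa>]) ` Poly_Mapping.keys (val f)"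
    using e(1) is_arr_adm[OF arr(2)] arr(3)
    by (auto simp: Ks_def set_Cons_def adm_def)
  moreover have "Poly_Mapping.keys (val u) \<subseteq> e ` Ix (tgt u)"
    using keys is_arr_adm[OF arr(1)] by (metis adm_def image_eqI subsetI)
  moreover from this have "mu B [u, f] = (\<Sum>\<kappa>s\<in>{\<kappa>s \<in> listset Ks. chain \<kappa>s}. mu_term [u, f] \<kappa>s)"
    using e is_arr_adm[OF arr(2)] arr
    by (intro mu_B_superset comp) (auto simp: Ks_def adm_def is_arr_def finite_Ix)
  ultimately show ?thesis
    by (simp add: sum.reindex inj_on_def weight_def)
qed

lemma mu_diagonal_right:
  assumes comp: "composable B [f, u]"
    and e: "\<And>x. ks (e x) = x" "\<And>x. x \<in> Ix (src u) \<Longrightarrow> kt (e x) \<in> Ix (tgt u)"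
    and keys: "\<And>\<kappa>. \<kappa> \<in> Poly_Mapping.keys (val u) \<Longrightarrow> \<kappa> = e (ks \<kappa>)"
  shows "mu B [f, u] = (\<Sum>\<kappa>\<in>Poly_Mapping.keys (val f).
    signed (sd (src f) (tgt f) \<kappa> * (deg u - sd (src u) (tgt u) (e (kt \<kappa>)) - 1))
      (Poly_Mapping.single (cc \<kappa> (e (kt \<kappa>))) (mu A [component f \<kappa>, component u (e (kt \<kappa>))])))"
proof -
  have arr: "is_arr B u" "is_arr B f" "tgt f = src u"
    using comp by (auto simp: composable_pair)
  define Ks where "Ks = [Poly_Mapping.keys (val f), e ` Ix (src u)]"
  have "{\<kappa>s \<in> listset Ks. chain \<kappa>s} = (\<lambda>\<kappa>. [\<kappa>, e (kt \<kappa>)]) ` Poly_Mapping.keys (val f)"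
    using e(1) is_arr_adm[OF arr(2)] arr(3)
    by (auto simp: Ks_def set_Cons_def adm_def)
  moreover have "Poly_Mapping.keys (val u) \<subseteq> e ` Ix (src u)"
    using keys is_arr_adm[OF arr(1)] by (metis adm_def image_eqI subsetI)
  moreover from this have "mu B [f, u] = (\<Sum>\<kappa>s\<in>{\<kappa>s \<in> listset Ks. chain \<kappa>s}. mu_term [f, u] \<kappa>s)"
    using e is_arr_adm[OF arr(2)] arr
    by (intro mu_B_superset comp) (auto simp: Ks_def adm_def is_arr_def finite_Ix)
  ultimately show ?thesis
    by (simp add: sum.reindex inj_on_def weight_def)
qed

section \<open>Units of the extension\<close>

lemma component_idm:
  assumes "X \<in> Obj B" "x \<in> Ix X"
  shows "component (id_arr B X) (un x) = id_arr A (part X x)"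
  using assms by (simp add: component_def ks_un kt_un sd_un idm_B)

lemma id_arr_B:
  assumes "X \<in> Obj B"
  shows "is_arr B (id_arr B X)"
proof -
  have un: "kt \<kappa> = ks \<kappa> \<and> sd X X \<kappa> = 0" if \<kappa>: "\<kappa> = un (ks \<kappa>)" for \<kappa>
  proof -
    obtain x where "\<kappa> = un x"
      using \<kappa> ..
    then show ?thesis
      by (simp add: ks_un kt_un sd_un)
  qed
  then have "Poly_Mapping.lookup (idm B X) \<kappa> \<in> Hom A (part X (ks \<kappa>)) (part X (kt \<kappa>)) (0 - sd X X \<kappa>)"
    if "ks \<kappa> \<in> Ix X" "kt \<kappa> \<in> Ix X" for \<kappa>
    using assms that by (auto simp: idm_B part_closed intro: A.idm_closed A.Hom_zero)
  then show ?thesis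
    using assms un by (auto simp: is_arr_def Hom_B idm_B)
qed

lemma idm_B_keys: "X \<in> Obj B \<Longrightarrow> \<kappa> \<in> Poly_Mapping.keys (idm B X) \<Longrightarrow> ks \<kappa> \<in> Ix X \<and> \<kappa> = un (ks \<kappa>)"
  by (auto simp: in_keys_iff idm_B split: if_splits)

lemma ainf_category_B: "ainf_category B"
  unfolding ainf_category_iff
proof (intro conjI allI impI)
  show "multilinear_ainf B"
    by (rule B.multilinear_ainf_axioms)
  show "ainf_rel B fs = 0" if "composable B fs" for fs
    using that by (rule ainf_rel_B)
  show "idm B X \<in> Hom B X X 0" if "X \<in> Obj B" for X
    using id_arr_B[OF that] by (simp add: is_arr_def)
  \<comment> \<open>This yields at once the vanishing of \<mu>^d on units for d = 1 and d > 2; only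
    the two laws for d = 2 require a computation.\<close>
  have ul: "unitlike B (id_arr B X)" if "X \<in> Obj B" for X
  proof (rule unitlike_B[OF id_arr_B[OF that]])
    fix \<kappa>
    assume "\<kappa> \<in> Poly_Mapping.keys (val (id_arr B X))"
    then have *: "ks \<kappa> \<in> Ix X" "\<kappa> = un (ks \<kappa>)"
      using idm_B_keys[OF that, of \<kappa>] by auto
    show "unitlike A (component (id_arr B X) \<kappa>)"
      using component_idm[OF that *(1)] *(2)[symmetric] A.unitlike_id_arr[OF part_closed[OF that *(1)]]
      by simp
  qed
  show "mu B [id_arr B X] = 0" if "X \<in> Obj B" for X
    using ul[OF that] id_arr_B[OF that] unfolding unitlike_def
    by (metis add_0 append_Nil composable_single list.size(3) zero_neq_one)
  show "mu B (fs @ id_arr B X # gs) = 0"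
    if "composable B (fs @ id_arr B X # gs)" "length fs + length gs \<ge> 2" for fs X gs
  proof -
    have "X \<in> Obj B"
      using composable_slot[OF that(1)] by (simp add: is_arr_def)
    then show ?thesis
      using ul that by (auto simp: unitlike_def)
  qed
next
  fix f
  assume f: "is_arr B f"
  then have obj: "src f \<in> Obj B" "tgt f \<in> Obj B"
    by (auto simp: is_arr_def)
  have "mu B [id_arr B (src f), f] = (\<Sum>\<kappa>\<in>Poly_Mapping.keys (val f).
    signed (sd (src f) (src f) (un (ks \<kappa>)) * (deg f - sd (src f) (tgt f) \<kappa> - 1))
      (Poly_Mapping.single (cc (un (ks \<kappa>)) \<kappa>)
         (mu A [component (id_arr B (src f)) (un (ks \<kappa>)), component f \<kappa>])))"
    using mu_diagonal_left[of "id_arr B (src f)" f un] f id_arr_B[OF obj(1)] idm_B_keys[OF obj(1)]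
    by (simp add: composable_pair ks_un kt_un) (metis kt_un)
  also have "\<dots> = (\<Sum>\<kappa>\<in>Poly_Mapping.keys (val f). Poly_Mapping.single \<kappa> (Poly_Mapping.lookup (val f) \<kappa>))"
  proof (rule sum.cong)
    fix \<kappa>
    assume \<kappa>: "\<kappa> \<in> Poly_Mapping.keys (val f)"
    then have "adm f \<kappa>"
      using is_arr_adm f by blast
    then have "mu A [component (id_arr B (src f)) (un (ks \<kappa>)), component f \<kappa>] = Poly_Mapping.lookup (val f) \<kappa>"
      using A.mu2_idm_right[OF component_closed[OF f], of \<kappa>] obj
      by (simp add: component_idm adm_def)
    then show "signed (sd (src f) (src f) (un (ks \<kappa>)) * (deg f - sd (src f) (tgt f) \<kappa> - 1))
      (Poly_Mapping.single (cc (un (ks \<kappa>)) \<kappa>)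
         (mu A [component (id_arr B (src f)) (un (ks \<kappa>)), component f \<kappa>])) =
      Poly_Mapping.single \<kappa> (Poly_Mapping.lookup (val f) \<kappa>)"
      by (simp add: sd_un cc_un_left)
  qed simp
  finally show "mu B [id_arr B (src f), f] = val f"
    by (simp add: sum_single_keys)
  have "mu B [f, id_arr B (tgt f)] = (\<Sum>\<kappa>\<in>Poly_Mapping.keys (val f).
    signed (sd (src f) (tgt f) \<kappa> * (0 - sd (tgt f) (tgt f) (un (kt \<kappa>)) - 1))
      (Poly_Mapping.single (cc \<kappa> (un (kt \<kappa>)))
         (mu A [component f \<kappa>, component (id_arr B (tgt f)) (un (kt \<kappa>))])))"
    using mu_diagonal_right[of f "id_arr B (tgt f)" un] f id_arr_B[OF obj(2)] idm_B_keys[OF obj(2)]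
    by (simp add: composable_pair ks_un kt_un)
  also have "\<dots> = (\<Sum>\<kappa>\<in>Poly_Mapping.keys (val f).
      signed (deg f) (Poly_Mapping.single \<kappa> (Poly_Mapping.lookup (val f) \<kappa>)))"
  proof (rule sum.cong)
    fix \<kappa>
    assume \<kappa>: "\<kappa> \<in> Poly_Mapping.keys (val f)"
    then have "adm f \<kappa>"
      using is_arr_adm f by blast
    then have "mu A [component f \<kappa>, component (id_arr B (tgt f)) (un (kt \<kappa>))] =
        signed (deg f - sd (src f) (tgt f) \<kappa>) (Poly_Mapping.lookup (val f) \<kappa>)"
      using A.mu2_idm_left[OF component_closed[OF f], of \<kappa>] obj
      by (simp add: component_idm adm_def)
    \<comment> \<open>The coefficient degree of the key enters twice, through \<open>cross\<close>
      against the reduced degree -1 of the unit and through the degree of the component, and cancels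
      modulo 2.\<close>
    then show "signed (sd (src f) (tgt f) \<kappa> * (0 - sd (tgt f) (tgt f) (un (kt \<kappa>)) - 1))
      (Poly_Mapping.single (cc \<kappa> (un (kt \<kappa>)))
         (mu A [component f \<kappa>, component (id_arr B (tgt f)) (un (kt \<kappa>))])) =
      signed (deg f) (Poly_Mapping.single \<kappa> (Poly_Mapping.lookup (val f) \<kappa>))"
      by (auto simp: sd_un cc_un_right single_signed signed_signed intro!: signed_cong)
  qed simp
  finally show "mu B [f, id_arr B (tgt f)] = signed (deg f) (val f)"
    by (simp add: sum_single_keys flip: signed_sum)
qed

end

subsection \<open>The instances \<open>k[t, t\<^sup>-\<^sup>1] \<otimes> A\<close> and \<open>\<int>A\<close>\<close>

interpretation laurent_keys: key_grading "\<lambda>X (_ :: unit). X" "\<lambda>_. UNIV" "\<lambda>_. ()" "\<lambda>_. ()"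
  "\<lambda>_ _ \<alpha>. \<alpha>" "(+)" "\<lambda>_. 0 :: int"
  by standard auto

lemma laurent_chain: "successively (\<lambda>_ _. True) \<alpha>s"
  by (induction \<alpha>s rule: induct_list012) auto

lemma laurent_cmp: "\<alpha>s \<noteq> [] \<Longrightarrow> laurent_keys.cmp \<alpha>s = sum_list \<alpha>s"
  by (induction \<alpha>s rule: laurent_keys.cmp.induct) auto

lemma laurent_component: "laurent_keys.component = t_coeff"
  by (simp add: fun_eq_iff laurent_keys.component_def t_coeff_def)

lemma laurent_sel [simp]:
  "Obj (laurent A) = Obj A"
  "Hom (laurent A) X Y n = {f. \<forall>\<alpha>. Poly_Mapping.lookup f \<alpha> \<in> Hom A X Y (n - \<alpha>)}"
  "smul (laurent A) = (\<lambda>c. Poly_Mapping.map (smul A c))"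
  "idm (laurent A) X = Poly_Mapping.single 0 (idm A X)"
  by (simp_all add: laurent_def)

lemma graded_extension_laurent:
  assumes "ainf_category A"
  shows "graded_extension (\<lambda>X (_ :: unit). X) (\<lambda>_. UNIV) (\<lambda>_. ()) (\<lambda>_. ())
    (\<lambda>_ _ \<alpha>. \<alpha>) (+) (\<lambda>_. 0) A (laurent A)"
proof -
  interpret ainf_category A by fact
  show ?thesis
  proof
    fix fs
    assume comp: "composable (laurent A) fs"
    have "mu (laurent A) fs = (\<Sum>\<alpha>s\<in>listset (map (\<lambda>f. Poly_Mapping.keys (val f)) fs).
      signed (cross (map2 laurent_keys.weight fs \<alpha>s))
        (Poly_Mapping.single (laurent_keys.cmp \<alpha>s) (mu A (map2 laurent_keys.component fs \<alpha>s))))"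
      unfolding laurent_def ainf.select_convs
    proof (rule sum.cong[OF refl])
      fix \<alpha>s
      assume "\<alpha>s \<in> listset (map (\<lambda>f. Poly_Mapping.keys (val f)) fs)"
      then have len: "length \<alpha>s = length fs"
        by (auto simp: in_listset list_all2_lengthD)
      then have "\<alpha>s \<noteq> []"
        using comp by (auto simp: composable_def)
      moreover have "cross (map2 laurent_keys.weight fs \<alpha>s) =
          (\<Sum>j<length fs. \<Sum>i<j. \<alpha>s ! i * (deg (map2 t_coeff fs \<alpha>s ! j) - 1))"
        unfolding cross_eq_sum using len
        by (intro sum.cong) (auto simp: laurent_keys.weight_def t_coeff_def)
      ultimately show "(let as = map2 t_coeff fs \<alpha>s in
       signed (\<Sum>j<length fs. \<Sum>i<j. \<alpha>s ! i * (deg (as ! j) - 1))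
         (Poly_Mapping.single (sum_list \<alpha>s) (mu A as))) =
        signed (cross (map2 laurent_keys.weight fs \<alpha>s))
          (Poly_Mapping.single (laurent_keys.cmp \<alpha>s) (mu A (map2 laurent_keys.component fs \<alpha>s)))"
        by (simp add: Let_def laurent_cmp laurent_component)
    qed
    then show "\<exists>Ks. list_all2 (\<lambda>f K. finite K \<and> Poly_Mapping.keys (val f) \<subseteq> K \<and> (\<forall>\<kappa>\<in>K. laurent_keys.adm f \<kappa>)) fs Ks \<and>
      mu (laurent A) fs = (\<Sum>\<kappa>s\<in>{\<kappa>s \<in> listset Ks. laurent_keys.chain \<kappa>s}.
        signed (cross (map2 laurent_keys.weight fs \<kappa>s))
          (Poly_Mapping.single (laurent_keys.cmp \<kappa>s) (mu A (map2 laurent_keys.component fs \<kappa>s))))"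
      by (intro exI[of _ "map (\<lambda>f. Poly_Mapping.keys (val f)) fs"])
        (simp add: laurent_chain list_all2_conv_all_nth laurent_keys.adm_def)
  qed (auto simp: lookup_single when_def)
qed

text \<open>The key \<open>(j, i)\<close> is the matrix unit from summand i to summand j, which is
  why \<open>snd\<close> is its source.\<close>

interpretation ZZ_keys: key_grading "\<lambda>X i. fst (X ! i)" "\<lambda>X. {..<length X}" snd fst
  "\<lambda>X Y (j, i). s_deg X Y i j" "\<lambda>\<kappa> \<kappa>'. (fst \<kappa>', snd \<kappa>)" "\<lambda>i. (i, i)"
  by standard (auto simp: s_deg_def)

lemma ZZ_cmp: "\<kappa>s \<noteq> [] \<Longrightarrow> ZZ_keys.cmp \<kappa>s = (fst (last \<kappa>s), snd (hd \<kappa>s))"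
  by (induction \<kappa>s rule: ZZ_keys.cmp.induct) auto

lemma ZZ_component: "ZZ_keys.component f (j, i) = entry f i j"
  by (simp add: ZZ_keys.component_def entry_def)

lemma ZZ_sel [simp]:
  "Obj (ZZ A) = {X. fst ` set X \<subseteq> Obj A}"
  "smul (ZZ A) = (\<lambda>c. Poly_Mapping.map (smul A c))"
  by (simp_all add: ZZ_def)

lemma ZZ_Hom:
  "f \<in> Hom (ZZ A) X Y n \<longleftrightarrow> (\<forall>\<kappa>. if snd \<kappa> \<in> {..<length X} \<and> fst \<kappa> \<in> {..<length Y}
     then Poly_Mapping.lookup f \<kappa> \<in> Hom A (fst (X ! snd \<kappa>)) (fst (Y ! fst \<kappa>)) (n - (case \<kappa> of (j, i) \<Rightarrow> s_deg X Y i j))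
     else Poly_Mapping.lookup f \<kappa> = 0)"
  by (auto simp: ZZ_def in_keys_iff subset_eq split: if_splits)

definition path_keys :: "nat list \<Rightarrow> (nat \<times> nat) list" where
  "path_keys is = map (\<lambda>l. (is ! Suc l, is ! l)) [0..<length is - 1]"

text \<open>The d + 1 indices along a path amount to d matrix entries of which consecutive ones
  share an index. The inverse reads the initial index off the head, which exists because
  \<open>fs\<close> is nonempty.\<close>

lemma path_keys_bij:
  assumes "composable (ZZ A) fs"
  shows "bij_betw path_keys (index_paths fs)
    {\<kappa>s \<in> listset (map (\<lambda>f. {..<length (tgt f)} \<times> {..<length (src f)}) fs). ZZ_keys.chain \<kappa>s}"
proof (rule bij_betw_byWitness[where f' = "\<lambda>\<kappa>s. snd (hd \<kappa>s) # map fst \<kappa>s"])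
  have ne: "fs \<noteq> []"
    using assms by (simp add: composable_def)
  show "\<forall>is\<in>index_paths fs. snd (hd (path_keys is)) # map fst (path_keys is) = is"
  proof
    fix "is"
    assume "is \<in> index_paths fs"
    then have "length is = Suc (length fs)"
      by (simp add: index_paths_def)
    with ne show "snd (hd (path_keys is)) # map fst (path_keys is) = is"
      by (intro nth_equalityI) (auto simp: path_keys_def hd_map nth_Cons split: nat.splits)
  qed
  show "\<forall>\<kappa>s\<in>{\<kappa>s \<in> listset (map (\<lambda>f. {..<length (tgt f)} \<times> {..<length (src f)}) fs). ZZ_keys.chain \<kappa>s}.
     path_keys (snd (hd \<kappa>s) # map fst \<kappa>s) = \<kappa>s"
  proof
    fix \<kappa>s
    assume \<kappa>s: "\<kappa>s \<in> {\<kappa>s \<in> listset (map (\<lambda>f. {..<length (tgt f)} \<times> {..<length (src f)}) fs). ZZ_keys.chain \<kappa>s}"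
    then have "length \<kappa>s = length fs"
      by (auto simp: in_listset dest: list_all2_lengthD)
    then have "\<kappa>s \<noteq> []"
      using ne by auto
    then show "path_keys (snd (hd \<kappa>s) # map fst \<kappa>s) = \<kappa>s"
      using \<kappa>s by (intro nth_equalityI)
        (auto simp: path_keys_def successively_conv_nth nth_Cons hd_conv_nth prod_eq_iff split: nat.splits)
  qed
  show "path_keys ` index_paths fs \<subseteq>
    {\<kappa>s \<in> listset (map (\<lambda>f. {..<length (tgt f)} \<times> {..<length (src f)}) fs). ZZ_keys.chain \<kappa>s}"
    by (auto simp: index_paths_def path_keys_def in_listset list_all2_conv_all_nth successively_conv_nth)
  show "(\<lambda>\<kappa>s. snd (hd \<kappa>s) # map fst \<kappa>s) `
    {\<kappa>s \<in> listset (map (\<lambda>f. {..<length (tgt f)} \<times> {..<length (src f)}) fs). ZZ_keys.chain \<kappa>s}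
    \<subseteq> index_paths fs"
  proof
    fix js
    assume "js \<in> (\<lambda>\<kappa>s. snd (hd \<kappa>s) # map fst \<kappa>s) `
      {\<kappa>s \<in> listset (map (\<lambda>f. {..<length (tgt f)} \<times> {..<length (src f)}) fs). ZZ_keys.chain \<kappa>s}"
    then obtain \<kappa>s where js: "js = snd (hd \<kappa>s) # map fst \<kappa>s"
      and \<kappa>s: "length \<kappa>s = length fs" "ZZ_keys.chain \<kappa>s"
        "\<And>l. l < length fs \<Longrightarrow> fst (\<kappa>s ! l) < length (tgt (fs ! l)) \<and> snd (\<kappa>s ! l) < length (src (fs ! l))"
      by (auto simp: in_listset list_all2_conv_all_nth mem_Times_iff)
    have "\<kappa>s \<noteq> []"
      using \<kappa>s(1) ne by auto
    have "js ! l = snd (\<kappa>s ! l) \<and> js ! Suc l = fst (\<kappa>s ! l)" if "l < length fs" for l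
      using that \<kappa>s(1,2) \<open>\<kappa>s \<noteq> []\<close> unfolding successively_conv_nth js by (cases l) (auto simp: hd_conv_nth)
    then show "js \<in> index_paths fs"
      using \<kappa>s by (simp add: index_paths_def js)
  qed
qed

lemma graded_extension_ZZ:
  assumes "ainf_category A"
  shows "graded_extension (\<lambda>X i. fst (X ! i)) (\<lambda>X. {..<length X}) snd fst
    (\<lambda>X Y (j, i). s_deg X Y i j) (\<lambda>\<kappa> \<kappa>'. (fst \<kappa>', snd \<kappa>)) (\<lambda>i. (i, i)) A (ZZ A)"
proof -
  interpret ainf_category A by fact
  show ?thesis
  proof
    fix fs
    assume comp: "composable (ZZ A) fs"
    \<comment> \<open>Full rectangles of keys, since \<open>ZZ\<close> also sums over index paths
      through zero entries.\<close>
    define Ks where "Ks = map (\<lambda>f. {..<length (tgt f)} \<times> {..<length (src f)}) fs"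
    have "mu (ZZ A) fs = (\<Sum>is\<in>index_paths fs.
      signed (cross (map2 ZZ_keys.weight fs (path_keys is)))
        (Poly_Mapping.single (ZZ_keys.cmp (path_keys is)) (mu A (map2 ZZ_keys.component fs (path_keys is)))))"
      unfolding ZZ_def ainf.select_convs
    proof (rule sum.cong[OF refl])
      fix "is"
      assume "is \<in> index_paths fs"
      then have len: "length is = Suc (length fs)"
        by (simp add: index_paths_def)
      have ne: "fs \<noteq> []"
        using comp by (simp add: composable_def)
      define as where "as = map (\<lambda>l. entry (fs ! l) (is ! l) (is ! Suc l)) [0..<length fs]"
      have as: "as = map2 ZZ_keys.component fs (path_keys is)"
        using len by (intro nth_equalityI) (auto simp: as_def path_keys_def ZZ_component)
      have "cross (map2 ZZ_keys.weight fs (path_keys is)) =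
          (\<Sum>j<length fs. \<Sum>i<j. s_deg (src (fs ! i)) (tgt (fs ! i)) (is ! i) (is ! Suc i) * (deg (as ! j) - 1))"
        unfolding cross_eq_sum using len
        by (intro sum.cong) (auto simp: ZZ_keys.weight_def path_keys_def as_def entry_def)
      moreover have "ZZ_keys.cmp (path_keys is) = (last is, hd is)"
        using len ne
        by (cases "is = []"; subst ZZ_cmp) (auto simp: path_keys_def last_map hd_map last_conv_nth hd_conv_nth)
      ultimately show "(let as = map (\<lambda>l. entry (fs ! l) (is ! l) (is ! Suc l)) [0..<length fs];
           s = (\<lambda>l. s_deg (src (fs ! l)) (tgt (fs ! l)) (is ! l) (is ! Suc l)) in
       signed (\<Sum>j<length fs. \<Sum>i<j. s i * (deg (as ! j) - 1))
         (Poly_Mapping.single (last is, hd is) (mu A as))) =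
        signed (cross (map2 ZZ_keys.weight fs (path_keys is)))
        (Poly_Mapping.single (ZZ_keys.cmp (path_keys is)) (mu A (map2 ZZ_keys.component fs (path_keys is))))"
        by (simp add: Let_def as_def[symmetric] as[symmetric])
    qed
    also have "\<dots> = (\<Sum>\<kappa>s\<in>{\<kappa>s \<in> listset Ks. ZZ_keys.chain \<kappa>s}.
        signed (cross (map2 ZZ_keys.weight fs \<kappa>s))
          (Poly_Mapping.single (ZZ_keys.cmp \<kappa>s) (mu A (map2 ZZ_keys.component fs \<kappa>s))))"
      unfolding Ks_def by (rule sum.reindex_bij_betw[OF path_keys_bij[OF comp]])
    finally have "mu (ZZ A) fs = (\<Sum>\<kappa>s\<in>{\<kappa>s \<in> listset Ks. ZZ_keys.chain \<kappa>s}.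
        signed (cross (map2 ZZ_keys.weight fs \<kappa>s))
          (Poly_Mapping.single (ZZ_keys.cmp \<kappa>s) (mu A (map2 ZZ_keys.component fs \<kappa>s))))" .
    moreover have "Poly_Mapping.keys (val f) \<subseteq> {..<length (tgt f)} \<times> {..<length (src f)}" if "f \<in> set fs" for f
      using comp that by (auto simp: composable_def is_arr_def ZZ_def)
    ultimately show "\<exists>Ks. list_all2 (\<lambda>f K. finite K \<and> Poly_Mapping.keys (val f) \<subseteq> K \<and> (\<forall>\<kappa>\<in>K. ZZ_keys.adm f \<kappa>)) fs Ks \<and>
      mu (ZZ A) fs = (\<Sum>\<kappa>s\<in>{\<kappa>s \<in> listset Ks. ZZ_keys.chain \<kappa>s}.
        signed (cross (map2 ZZ_keys.weight fs \<kappa>s))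
          (Poly_Mapping.single (ZZ_keys.cmp \<kappa>s) (mu A (map2 ZZ_keys.component fs \<kappa>s))))"
      by (intro exI[of _ Ks]) (auto simp: Ks_def list_all2_conv_all_nth ZZ_keys.adm_def)
  next
    fix X \<kappa>
    show "Poly_Mapping.lookup (idm (ZZ A) X) \<kappa> =
      (if snd \<kappa> \<in> {..<length X} \<and> \<kappa> = (snd \<kappa>, snd \<kappa>) then idm A (fst (X ! snd \<kappa>)) else 0)"
      by (cases \<kappa>) (auto simp: ZZ_def lookup_sum lookup_single when_def intro: sum.neutral)
  next
    fix X Y n
    show "Hom (ZZ A) X Y n = {f. \<forall>\<kappa>. if snd \<kappa> \<in> {..<length X} \<and> fst \<kappa> \<in> {..<length Y}
      then Poly_Mapping.lookup f \<kappa> \<in> Hom A (fst (X ! snd \<kappa>)) (fst (Y ! fst \<kappa>)) (n - (case \<kappa> of (j, i) \<Rightarrow> s_deg X Y i j))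
      else Poly_Mapping.lookup f \<kappa> = 0}"
      by (rule set_eqI) (simp only: ZZ_Hom mem_Collect_eq)
  qed auto
qed

lemma ainf_category_laurent: "ainf_category A \<Longrightarrow> ainf_category (laurent A)"
  by (rule graded_extension.ainf_category_B[OF graded_extension_laurent])

lemma ainf_category_ZZ: "ainf_category A \<Longrightarrow> ainf_category (ZZ A)"
  by (rule graded_extension.ainf_category_B[OF graded_extension_ZZ])

section \<open>Twisted complexes\<close>

subsection \<open>Words in the letters of a path and the differentials\<close>

text \<open>A word is a path with inserted differentials: \<open>Some f\<close> is an argument, and
  \<open>None\<close> stands for the differential of the object reached at that place, which the
  preceding letters determine. Words can be cut anywhere, unlike lists of insertion counts.\<close>

fun letters :: "'a option list \<Rightarrow> 'a list" where
  "letters [] = []"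
| "letters (None # w) = letters w"
| "letters (Some f # w) = f # letters w"

lemma letters_append [simp]: "letters (u @ v) = letters u @ letters v"
  by (induction u rule: letters.induct) auto

lemma letters_replicate [simp]: "letters (replicate n None) = []"
  by (induction n) auto

lemma length_letters: "length (letters w) \<le> length w"
  by (induction w rule: letters.induct) auto

lemma letters_eq_Nil: "letters w = [] \<Longrightarrow> w = replicate (length w) None"
  by (induction w rule: letters.induct) auto

text \<open>The length bound makes the set finite, so that an infinite sum over insertions can be
  replaced by a finite one.\<close>

definition words :: "nat \<Rightarrow> 'a list \<Rightarrow> 'a option list set" where
  "words B fs = {w. letters w = fs \<and> length w \<le> B}"

lemma set_word: "set w \<subseteq> insert None (Some ` set (letters w))"
  by (induction w rule: letters.induct) auto

lemma finite_words [simp]: "finite (words B fs)"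
proof (rule finite_subset)
  show "words B fs \<subseteq> {w. set w \<subseteq> insert None (Some ` set fs) \<and> length w \<le> B}"
    using set_word by (auto simp: words_def)
  show "finite {w. set w \<subseteq> insert None (Some ` set fs) \<and> length w \<le> B}"
    by (rule finite_lists_length_le) simp
qed

lemma words_Nil: "words B [] = (\<lambda>d. replicate d None) ` {..B}"
  by (auto simp: words_def dest: letters_eq_Nil)

lemma word_cases:
  obtains n where "w = replicate n None" | n f v where "w = replicate n None @ Some f # v"
proof (induction w arbitrary: thesis)
  case Nil
  show ?case by (rule Nil(1)[of 0]) simp
next
  case (Cons a w)
  show ?case
  proof (cases a)
    case None
    show ?thesis
    proof (rule Cons.IH)
      show thesis if "w = replicate n None" for n
        using Cons.prems(1)[of "Suc n"] that None by simp
      show thesis if "w = replicate n None @ Some f # v" for n f v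
        using Cons.prems(2)[of "Suc n"] that None by simp
    qed
  next
    case (Some f)
    then show ?thesis
      using Cons.prems(2)[of 0] by simp
  qed
qed

text \<open>A pigeonhole argument: d letters leave d + 1 gaps, so a word of length at least (d + 1)
  N has N differentials in a row.\<close>

lemma long_word:
  assumes "length w \<ge> Suc (length (letters w)) * N"
  shows "\<exists>u v. w = u @ replicate N None @ v"
  using assms
proof (induction "length (letters w)" arbitrary: w)
  case 0
  then have "w = replicate (length w) None" "N \<le> length w"
    using letters_eq_Nil[of w] by auto
  then have "w = [] @ replicate N None @ replicate (length w - N) None"
    by (simp flip: replicate_add)
  then show ?case by blast
next
  case (Suc d)
  consider (none) n where "w = replicate n None" | (some) n f v where "w = replicate n None @ Some f # v"
    by (rule word_cases)
  then show ?case
  proof cases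
    case none
    then show ?thesis using Suc by simp
  next
    case some
    show ?thesis
    proof (cases "N \<le> n")
      case True
      then have "replicate n None = replicate N None @ replicate (n - N) None"
        by (simp flip: replicate_add)
      then have "w = [] @ replicate N None @ (replicate (n - N) None @ Some f # v)"
        using some by simp
      then show ?thesis by blast
    next
      case False
      \<comment> \<open>A leading gap shorter than N uses, together with the letter after it, at
        most N places.\<close>
      then have "Suc (length (letters v)) * N \<le> length v"
        using Suc.prems some by simp
      then obtain u' v' where "v = u' @ replicate N None @ v'"
        using Suc.hyps some by fastforce
      then have "w = (replicate n None @ Some f # u') @ replicate N None @ v'"
        using some by simp
      then show ?thesis by blast
    qed
  qed
qed

lemma letter_split:
  assumes "letters w = fs @ f # gs"
  obtains u v where "w = u @ Some f # v" "letters u = fs" "letters v = gs"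
  using assms
proof (induction w arbitrary: fs thesis rule: letters.induct)
  case (2 w)
  show ?case
  proof (rule 2(1))
    show "letters w = fs @ f # gs"
      using 2 by simp
    show thesis if "w = u @ Some f # v" "letters u = fs" "letters v = gs" for u v
      using 2(2)[of "None # u" v] that by simp
  qed
next
  case (3 g w)
  show ?case
  proof (cases fs)
    case Nil
    then show ?thesis
      using 3(2)[of "[]" w] 3(3) by simp
  next
    case (Cons h hs)
    show ?thesis
    proof (rule 3(1))
      show "letters w = hs @ f # gs"
        using 3(3) Cons by simp
      show thesis if "w = u @ Some f # v" "letters u = hs" "letters v = gs" for u v
        using 3(2)[of "Some g # u" v] 3(3) that Cons by simp
    qed
  qed
qed simp

text \<open>A letter of a word is located by the letters before it, differentials not counted. This
  makes the separation of insertions around one argument injective.\<close>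

lemma letter_split_unique:
  "u @ Some f # v = u' @ Some f' # v' \<Longrightarrow> letters u = letters u' \<Longrightarrow> u = u' \<and> v = v'"
proof (induction u arbitrary: u' rule: letters.induct)
  case 1
  then show ?case by (cases u' rule: letters.cases) auto
next
  case (2 w)
  then show ?case by (cases u' rule: letters.cases) auto
next
  case (3 g w)
  then show ?case by (cases u' rule: letters.cases) auto
qed

text \<open>\<open>interleave\<close> and \<open>gaps\<close> translate between words and the
  insertion counts in the definition of \<open>Tw\<close>; a word with d letters has d + 1
  gaps.\<close>

fun interleave :: "'a list \<Rightarrow> nat list \<Rightarrow> 'a option list" where
  "interleave [] ns = replicate (hd ns) None"
| "interleave (f # fs) ns = replicate (hd ns) None @ Some f # interleave fs (tl ns)"

fun gaps :: "'a option list \<Rightarrow> nat list" where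
  "gaps [] = [0]"
| "gaps (None # w) = Suc (hd (gaps w)) # tl (gaps w)"
| "gaps (Some f # w) = 0 # gaps w"

lemma gaps_replicate: "gaps (replicate n None @ w) = (n + hd (gaps w)) # tl (gaps w)"
  by (induction n) (cases w rule: gaps.cases; simp)+

lemma gaps_interleave: "length ns = Suc (length fs) \<Longrightarrow> gaps (interleave fs ns) = ns"
proof (induction fs arbitrary: ns)
  case Nil
  then show ?case
    using gaps_replicate[of "hd ns" "[]"] by (cases ns) auto
next
  case (Cons f fs)
  then show ?case
    by (cases ns) (auto simp: gaps_replicate)
qed

lemma length_gaps: "length (gaps w) = Suc (length (letters w))"
  by (induction w rule: gaps.induct) auto

lemma interleave_gaps: "interleave (letters w) (gaps w) = w"
proof (induction w rule: gaps.induct)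
  case (2 w)
  then show ?case
    by (cases "letters w") auto
qed auto

lemma letters_interleave: "letters (interleave fs ns) = fs"
  by (induction fs arbitrary: ns) auto

subsection \<open>Walks\<close>

text \<open>Unlike \<open>composable\<close>, this admits the empty path at a given object. Blocks
  without letters occur when words are cut, and they produce the Maurer-Cartan terms.\<close>

fun walk :: "('k, 'o, 'm) ainf \<Rightarrow> 'o \<Rightarrow> ('o, 'm) arr list \<Rightarrow> bool" where
  "walk A X [] \<longleftrightarrow> X \<in> Obj A"
| "walk A X (f # fs) \<longleftrightarrow> is_arr A f \<and> src f = X \<and> walk A (tgt f) fs"

definition endpoint :: "'o \<Rightarrow> ('o, 'm) arr list \<Rightarrow> 'o" where
  "endpoint X fs = (if fs = [] then X else tgt (last fs))"

lemma endpoint_simps [simp]: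
  "endpoint X [] = X" "endpoint X (f # fs) = endpoint (tgt f) fs"
  "endpoint X (fs @ gs) = endpoint (endpoint X fs) gs"
  by (auto simp: endpoint_def)

lemma walk_append [simp]: "walk A X (fs @ gs) \<longleftrightarrow> walk A X fs \<and> walk A (endpoint X fs) gs"
  by (induction fs arbitrary: X) (auto simp: is_arr_def elim: walk.elims)

lemma walk_Obj: "walk A X fs \<Longrightarrow> X \<in> Obj A \<and> endpoint X fs \<in> Obj A"
  by (induction fs arbitrary: X) (auto simp: is_arr_def)

lemma composable_walk: "composable A fs \<longleftrightarrow> fs \<noteq> [] \<and> walk A (src (hd fs)) fs"
proof -
  have "walk A (src (hd fs)) fs" if "fs \<noteq> []" "\<forall>f\<in>set fs. is_arr A f" "successively (\<lambda>f g. tgt f = src g) fs" for fs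
    using that by (induction fs rule: induct_list012) (auto simp: is_arr_def)
  moreover have "(\<forall>f\<in>set fs. is_arr A f) \<and> successively (\<lambda>f g. tgt f = src g) fs" if "walk A X fs" for X fs
    using that by (induction fs arbitrary: X rule: induct_list012) auto
  ultimately show ?thesis
    unfolding composable_iff by blast
qed

lemma walk_composable: "walk A X fs \<Longrightarrow> fs \<noteq> [] \<Longrightarrow> composable A fs"
  by (cases fs) (auto simp: composable_walk)

lemma last_hd_walk: "walk A X fs \<Longrightarrow> fs \<noteq> [] \<Longrightarrow> src (hd fs) = X \<and> tgt (last fs) = endpoint X fs"
  by (cases fs) (auto simp: endpoint_def)

text \<open>The current object is carried along, so that \<open>None\<close> becomes the
  differential of the object reached so far.\<close>

fun realize ::
  "('o, 'm) twisted \<Rightarrow> (('o, 'm) twisted, 'm matrix) arr option list \<Rightarrow> ('o formal_sum, 'm matrix) arr list"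
  where
  "realize X [] = []"
| "realize X (None # w) = tw_diff X # realize X w"
| "realize X (Some f # w) = tw_forget f # realize (tgt f) w"

lemma realize_append [simp]:
  "realize X (u @ v) = realize X u @ realize (endpoint X (letters u)) v"
  by (induction X u rule: realize.induct) auto

lemma length_realize [simp]: "length (realize X w) = length w"
  by (induction X w rule: realize.induct) auto

lemma realize_eq_Nil [simp]: "realize X w = [] \<longleftrightarrow> w = []"
  by (metis length_0_conv length_realize)

lemma realize_replicate [simp]: "realize X (replicate n None) = replicate n (tw_diff X)"
  by (induction n) auto

lemma take_realize: "take n (realize X w) = realize X (take n w)"
  by (induction X w arbitrary: n rule: realize.induct) (auto simp: take_Cons split: nat.splits)

lemma drop_realize: "drop n (realize X w) = realize (endpoint X (letters (take n w))) (drop n w)"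
  by (induction X w arbitrary: n rule: realize.induct) (auto simp: drop_Cons take_Cons split: nat.splits)

subsection \<open>The \<open>A\<^sub>\<infinity>\<close>-structure\<close>

lemma Tw_sel [simp]:
  "Obj (Tw A) = {(X, \<delta>). X \<in> Obj (ZZ A) \<and> \<delta> \<in> Hom (ZZ A) X X 1 \<and> strictly_lower_triangular X \<delta> \<and>
       Sum_any (\<lambda>d. if d > 0 then mu (ZZ A) (replicate d (tw_diff (X, \<delta>))) else 0) = 0}"
  "Hom (Tw A) X Y = Hom (ZZ A) (fst X) (fst Y)"
  "smul (Tw A) = smul (ZZ A)"
  "idm (Tw A) X = idm (ZZ A) (fst X)"
  by (simp_all add: Tw_def)

declare Tw_sel(1) [simp del] ZZ_sel(1) [simp del]

lemma tw_forget_sel [simp]: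
  "src (tw_forget f) = fst (src f)" "tgt (tw_forget f) = fst (tgt f)"
  "deg (tw_forget f) = deg f" "val (tw_forget f) = val f"
  "tw_forget (Arr X Y n a) = Arr (fst X) (fst Y) n a"
  by (simp_all add: tw_forget_def)

lemma tw_diff_sel [simp]:
  "src (tw_diff X) = fst X" "tgt (tw_diff X) = fst X" "deg (tw_diff X) = 1" "val (tw_diff X) = snd X"
  by (simp_all add: tw_diff_def)

lemma fst_Obj_Tw: "X \<in> Obj (Tw A) \<Longrightarrow> fst X \<in> Obj (ZZ A)"
  by (auto simp: Tw_sel(1))

lemma is_arr_tw_diff: "X \<in> Obj (Tw A) \<Longrightarrow> is_arr (ZZ A) (tw_diff X)"
  by (auto simp: Tw_sel(1) is_arr_def)

lemma is_arr_Tw: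
  "is_arr (Tw A) f \<longleftrightarrow> src f \<in> Obj (Tw A) \<and> tgt f \<in> Obj (Tw A) \<and> is_arr (ZZ A) (tw_forget f)"
  by (auto simp: is_arr_def fst_Obj_Tw)

lemma walk_realize:
  "walk (Tw A) X (letters w) \<Longrightarrow> walk (ZZ A) (fst X) (realize X w)"
  by (induction X w rule: realize.induct) (auto simp: is_arr_Tw fst_Obj_Tw is_arr_tw_diff dest: walk_Obj)

lemma endpoint_realize: "endpoint (fst X) (realize X w) = fst (endpoint X (letters w))"
  by (induction X w rule: realize.induct) auto

text \<open>A differential has degree 1, hence reduced degree 0: inserting it changes neither the
  degree of the output nor, by \<open>sum_reduced_deg_realize\<close>, the signs in the
  relations.\<close>

lemma sum_deg_realize:
  "sum_list (map deg (realize X w)) - int (length w) = sum_list (map deg (letters w)) - int (length (letters w))"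
  by (induction X w rule: realize.induct) auto

lemma sum_reduced_deg_realize: "(\<Sum>f\<leftarrow>realize X w. deg f - 1) = (\<Sum>f\<leftarrow>letters w. deg f - 1)"
  by (induction X w rule: realize.induct) auto

lemma tw_insert_realize:
  assumes "fs \<noteq> []" "length ns = Suc (length fs)"
  shows "tw_insert fs ns = realize (src (hd fs)) (interleave fs ns)"
proof -
  have "replicate (ns ! 0) (tw_diff X) @
     concat (map (\<lambda>l. tw_forget (fs ! l) # replicate (ns ! Suc l) (tw_diff (tgt (fs ! l)))) [0..<length fs]) =
     realize X (interleave fs ns)" if "length ns = Suc (length fs)" for X
    using that
  proof (induction fs arbitrary: ns X)
    case Nil
    then show ?case by (cases ns) auto
  next
    case (Cons f fs)
    then obtain n ns' where ns: "ns = n # ns'"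
      by (cases ns) auto
    have "map (\<lambda>l. tw_forget ((f # fs) ! l) # replicate (ns ! Suc l) (tw_diff (tgt ((f # fs) ! l)))) [0..<length (f # fs)] =
      (tw_forget f # replicate (ns' ! 0) (tw_diff (tgt f))) #
      map (\<lambda>l. tw_forget (fs ! l) # replicate (ns' ! Suc l) (tw_diff (tgt (fs ! l)))) [0..<length fs]"
      by (simp add: ns upt_conv_Cons map_Suc_upt[symmetric] comp_def del: upt_Suc)
    then show ?case
      using Cons.IH[of ns' "tgt f"] Cons.prems ns by simp
  qed
  then show ?thesis
    using assms(2) by (simp add: tw_insert_def)
qed

locale twisting = ainf_category A
  for A :: "('k::field, 'o, 'm::ab_group_add) ainf"
begin

abbreviation C :: "('k, 'o formal_sum, 'm matrix) ainf" where
  "C \<equiv> ZZ A"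

sublocale C: ainf_category "ZZ A"
  using ainf_category_axioms by (rule ainf_category_ZZ)

sublocale Tw: closed_ainf "Tw A"
proof (rule closed_ainf.intro)
  show "vector_space (smul (Tw A))"
    using C.vs by (simp del: ZZ_sel)
  show "module.subspace (smul (Tw A)) (Hom (Tw A) X Y n)" if "X \<in> Obj (Tw A)" "Y \<in> Obj (Tw A)" for X Y n
    using C.subspace[of "fst X" "fst Y"] that by (simp add: fst_Obj_Tw del: ZZ_sel)
qed

text \<open>Along a nonzero entry of the differential the filtration level rises, so no chain of N +
  1 nonzero entries exists when \<open>F N\<close> is empty. The surroundings of the block are
  arbitrary because a chain along the whole path contains one along the block.\<close>

lemma nilpotent_differential:
  assumes "X \<in> Obj (Tw A)"
  shows "\<exists>N. \<forall>fs gs. composable C (fs @ replicate N (tw_diff X) @ gs) \<longrightarrow>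
    mu C (fs @ replicate N (tw_diff X) @ gs) = 0"
proof -
  interpret G: graded_extension "\<lambda>X i. fst (X ! i)" "\<lambda>X. {..<length X}" snd fst
    "\<lambda>X Y (j, i). s_deg X Y i j" "\<lambda>\<kappa> \<kappa>'. (fst \<kappa>', snd \<kappa>)" "\<lambda>i. (i, i)" A "ZZ A"
    by (rule graded_extension_ZZ) (rule ainf_category_axioms)
  obtain F :: "nat \<Rightarrow> nat set" and N where F0: "F 0 = {..<length (fst X)}" and FN: "F N = {}"
    and dec: "\<And>r. F (Suc r) \<subseteq> F r"
    and low: "\<And>r i j. i \<in> F r \<Longrightarrow> j \<in> {..<length (fst X)} - F r \<Longrightarrow> Poly_Mapping.lookup (snd X) (j, i) = 0"
    and strict: "\<And>r i j. i \<in> F r - F (Suc r) \<Longrightarrow> j \<in> F r - F (Suc r) \<Longrightarrow> Poly_Mapping.lookup (snd X) (j, i) = 0"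
    using assms unfolding Tw_sel(1) strictly_lower_triangular_def by auto
  have anti: "F b \<subseteq> F a" if "a \<le> b" for a b
    using dec that by (rule lift_Suc_antimono_le)
  have step: "j \<in> F (Suc r)" if "i \<in> F r" "(j, i) \<in> Poly_Mapping.keys (snd X)" "j < length (fst X)" for i j r
  proof -
    \<comment> \<open>The last level that contains i. Level r alone only keeps the target in
      \<open>F r\<close>; strictness applies at the level where i leaves the filtration.\<close>
    define s where "s = (LEAST s. i \<notin> F (Suc s))"
    have ex: "\<exists>s. i \<notin> F (Suc s)"
      using FN dec[of N] by auto
    have s: "i \<notin> F (Suc s)"
      unfolding s_def using ex by (rule LeastI_ex)
    have "r \<le> s"
    proof (rule ccontr)
      assume "\<not> r \<le> s"
      then have "F r \<subseteq> F (Suc s)"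
        by (intro anti) simp
      then show False using s that(1) by blast
    qed
    have "i \<in> F s"
    proof (cases s)
      case 0
      then show ?thesis using anti[of 0 r] that(1) by auto
    next
      case (Suc s')
      then have "s' < s" by simp
      from not_less_Least[OF this[unfolded s_def]] show ?thesis
        using Suc by simp
    qed
    have nz: "Poly_Mapping.lookup (snd X) (j, i) \<noteq> 0"
      using that(2) by (simp add: in_keys_iff)
    have "j \<in> F s"
      using low[OF \<open>i \<in> F s\<close>, of j] nz that(3) by blast
    then have "j \<in> F (Suc s)"
      using strict[of i s j] nz s \<open>i \<in> F s\<close> by blast
    then show ?thesis
      using anti[of "Suc r" "Suc s"] \<open>r \<le> s\<close> by auto
  qed
  have "mu C (fs @ replicate (Suc N) (tw_diff X) @ gs) = 0"
    if comp: "composable C (fs @ replicate (Suc N) (tw_diff X) @ gs)" for fs gs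
  proof -
    let ?l = "fs @ replicate (Suc N) (tw_diff X) @ gs"
    have False if "\<kappa>s \<in> listset (map (\<lambda>f. Poly_Mapping.keys (val f)) ?l)" "ZZ_keys.chain \<kappa>s" for \<kappa>s
    proof -
      have l2: "list_all2 (\<in>) \<kappa>s (map (\<lambda>f. Poly_Mapping.keys (val f)) ?l)"
        using that(1) by (simp only: in_listset)
      then obtain us ls vs where eq: "\<kappa>s = us @ ls @ vs"
        and "list_all2 (\<in>) ls (map (\<lambda>f. Poly_Mapping.keys (val f)) (replicate (Suc N) (tw_diff X)))"
        unfolding map_append list_all2_append2 by blast
      then have len: "length ls = Suc N"
        and mem: "\<And>l. l < Suc N \<Longrightarrow> ls ! l \<in> Poly_Mapping.keys (snd X)"
        by (auto simp: list_all2_conv_all_nth simp del: replicate_Suc)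
      have chain: "ZZ_keys.chain ls"
        using that(2) eq by (auto simp: successively_append_iff)
      have "is_arr C (tw_diff X)"
        using is_arr_tw_diff[OF assms] .
      then have bd: "fst (ls ! l) < length (fst X) \<and> snd (ls ! l) < length (fst X)" if "l < Suc N" for l
        using G.is_arr_adm[of "tw_diff X" "ls ! l"] mem[OF that] by (simp add: ZZ_keys.adm_def)
      have link: "fst (ls ! l) = snd (ls ! Suc l)" if "Suc l < Suc N" for l
        using chain that len by (simp add: successively_conv_nth)
      have "fst (ls ! l) \<in> F (Suc l)" if "l < Suc N" for l
        using that
      proof (induction l)
        case 0
        then show ?case
          using step[of "snd (ls ! 0)" 0 "fst (ls ! 0)"] bd[of 0] mem[of 0] F0 by auto
      next
        case (Suc l)
        then show ?case
          using step[of "snd (ls ! Suc l)" "Suc l" "fst (ls ! Suc l)"] bd[of "Suc l"] mem[of "Suc l"] link[of l]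
          by auto
      qed
      from this[of N] show False
        using dec[of N] FN by auto
    qed
    then have "{\<kappa>s \<in> listset (map (\<lambda>f. Poly_Mapping.keys (val f)) ?l). ZZ_keys.chain \<kappa>s} = {}"
      by blast
    then show ?thesis
      unfolding G.mu_B[OF comp] by (simp only: sum.empty)
  qed
  then show ?thesis by blast
qed

text \<open>Words on \<open>fs\<close> longer than B contribute nothing, even as part of a longer
  path. The context \<open>gs\<close>, \<open>hs\<close> is there because the bound is applied to
  blocks of words and not only to whole paths.\<close>

definition vanishing :: "nat \<Rightarrow> ('o, 'm) twisted \<Rightarrow> (('o, 'm) twisted, 'm matrix) arr list \<Rightarrow> bool" where
  "vanishing B X fs \<longleftrightarrow> (\<forall>w gs hs. letters w = fs \<longrightarrow> length w > B \<longrightarrow>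
     composable C (gs @ realize X w @ hs) \<longrightarrow> mu C (gs @ realize X w @ hs) = 0)"

lemma vanishingD:
  "vanishing B X fs \<Longrightarrow> letters w = fs \<Longrightarrow> length w > B \<Longrightarrow>
   composable C (gs @ realize X w @ hs) \<Longrightarrow> mu C (gs @ realize X w @ hs) = 0"
  by (simp add: vanishing_def)

lemma vanishing_mono: "vanishing B X fs \<Longrightarrow> B \<le> B' \<Longrightarrow> vanishing B' X fs"
  by (auto simp: vanishing_def)

text \<open>Stated with a filter so that bounds for finitely many objects and paths hold
  simultaneously without naming their maximum.\<close>

lemma eventually_nilpotent:
  assumes "X \<in> Obj (Tw A)"
  shows "\<forall>\<^sub>F N in sequentially. \<forall>fs gs. composable C (fs @ replicate N (tw_diff X) @ gs) \<longrightarrow>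
    mu C (fs @ replicate N (tw_diff X) @ gs) = 0"
proof -
  obtain N where N: "\<And>fs gs. composable C (fs @ replicate N (tw_diff X) @ gs) \<Longrightarrow>
    mu C (fs @ replicate N (tw_diff X) @ gs) = 0"
    using nilpotent_differential[OF assms] by blast
  have "mu C (fs @ replicate N' (tw_diff X) @ gs) = 0"
    if "composable C (fs @ replicate N' (tw_diff X) @ gs)" "N \<le> N'" for fs gs N'
    using N[of fs "replicate (N' - N) (tw_diff X) @ gs"] that replicate_add[of N "N' - N" "tw_diff X"] by simp
  then show ?thesis
    unfolding eventually_sequentially by blast
qed

lemma eventually_vanishing:
  assumes "walk (Tw A) X fs"
  shows "\<forall>\<^sub>F B in sequentially. vanishing B X fs"
proof -
  \<comment> \<open>The finitely many objects met by the path; one N serves all of them.\<close>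
  define Os where "Os = (\<lambda>n. endpoint X (take n fs)) ` {..length fs}"
  have "Y \<in> Obj (Tw A)" if Y: "Y \<in> Os" for Y
  proof -
    obtain n where "Y = endpoint X (take n fs)"
      using Y by (auto simp: Os_def)
    moreover have "walk (Tw A) X (take n fs)"
      using assms by (metis append_take_drop_id walk_append)
    ultimately show ?thesis
      using walk_Obj by metis
  qed
  then have "\<forall>\<^sub>F N in sequentially. \<forall>Y\<in>Os. \<forall>fs gs. composable C (fs @ replicate N (tw_diff Y) @ gs) \<longrightarrow>
    mu C (fs @ replicate N (tw_diff Y) @ gs) = 0"
    by (intro eventually_ball_finite ballI eventually_nilpotent) (auto simp: Os_def)
  then obtain N where N: "\<And>Y fs gs. Y \<in> Os \<Longrightarrow> composable C (fs @ replicate N (tw_diff Y) @ gs) \<Longrightarrow>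
    mu C (fs @ replicate N (tw_diff Y) @ gs) = 0"
    using eventually_happens'[OF sequentially_bot] by fast
  \<comment> \<open>The bound at which \<open>long_word\<close> supplies N consecutive differentials
    of one object.\<close>
  have "vanishing (Suc (length fs) * N) X fs"
    unfolding vanishing_def
  proof (intro allI impI)
    fix w gs hs
    assume w: "letters w = fs" "length w > Suc (length fs) * N" and comp: "composable C (gs @ realize X w @ hs)"
    obtain u v where uv: "w = u @ replicate N None @ v"
      using long_word[of w N] w by auto
    then have "endpoint X (letters u) \<in> Os"
      using w(1) unfolding Os_def by (intro image_eqI[of _ _ "length (letters u)"]) auto
    then show "mu C (gs @ realize X w @ hs) = 0"
      using N[of "endpoint X (letters u)" "gs @ realize X u" "realize (endpoint X (letters u)) v @ hs"] comp
      by (simp add: uv)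
  qed
  then show ?thesis
    unfolding eventually_sequentially using vanishing_mono by blast
qed

text \<open>Reindexing by \<open>gaps\<close> turns the sum over insertion counts into one over
  words. The second claim is what gives the sum its intended meaning, as \<open>Sum_any\<close> of a
  family with infinite support is 0 by convention.\<close>

lemma mu_Tw_words:
  assumes "fs \<noteq> []" "walk (Tw A) X fs" "vanishing B X fs"
  shows "mu (Tw A) fs = (\<Sum>w\<in>words B fs. mu C (realize X w))"
    and "finite {ns. (if length ns = Suc (length fs) then mu C (tw_insert fs ns) else 0) \<noteq> 0}"
proof -
  let ?g = "\<lambda>ns. if length ns = Suc (length fs) then mu C (tw_insert fs ns) else 0"
  let ?I = "{ns. length ns = Suc (length fs)}"
  have X: "src (hd fs) = X"
    using assms by (cases fs) auto
  define S where "S = gaps ` words B fs"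
  have S: "S \<subseteq> ?I"
    by (auto simp: S_def words_def length_gaps)
  have bij: "bij_betw (interleave fs) S (words B fs)"
    unfolding S_def by (rule bij_betw_byWitness[where f' = gaps])
      (auto simp: words_def gaps_interleave interleave_gaps length_gaps)
  have sup: "{ns. ?g ns \<noteq> 0} \<subseteq> S"
  proof
    fix ns
    assume "ns \<in> {ns. ?g ns \<noteq> 0}"
    then have ns: "length ns = Suc (length fs)" "mu C (tw_insert fs ns) \<noteq> 0"
      by (auto split: if_splits)
    let ?w = "interleave fs ns"
    have "mu C (realize X ?w) \<noteq> 0"
      using ns tw_insert_realize[OF assms(1) ns(1)] X by simp
    moreover have "?w \<noteq> []"
      using letters_interleave[of fs ns] assms(1) by auto
    then have "composable C (realize X ?w)"
      using walk_realize[of A X ?w] assms(2) by (intro walk_composable) (auto simp: letters_interleave)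
    ultimately have "length ?w \<le> B"
      using vanishingD[OF assms(3), of ?w "[]" "[]"] letters_interleave[of fs ns] not_le by auto
    then have "?w \<in> words B fs"
      by (simp add: words_def letters_interleave)
    then show "ns \<in> S"
      unfolding S_def using gaps_interleave[OF ns(1)] by (metis image_eqI)
  qed
  have "finite S"
    by (simp add: S_def)
  then show "finite {ns. ?g ns \<noteq> 0}"
    using sup by (rule finite_subset[rotated])
  have "mu (Tw A) fs = Sum_any ?g"
    by (simp add: Tw_def)
  also have "\<dots> = sum ?g S"
    by (rule Sum_any.expand_superset[OF \<open>finite S\<close> sup])
  also have "\<dots> = (\<Sum>ns\<in>S. mu C (realize X (interleave fs ns)))"
    using S tw_insert_realize[OF assms(1)] X by (intro sum.cong) auto
  also have "\<dots> = (\<Sum>w\<in>words B fs. mu C (realize X w))"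
    by (rule sum.reindex_bij_betw[OF bij])
  finally show "mu (Tw A) fs = (\<Sum>w\<in>words B fs. mu C (realize X w))" .
qed

lemma maurer_cartan_support:
  assumes "X \<in> Obj (Tw A)" "vanishing B X []"
  shows "{d. (if d > 0 then mu C (replicate d (tw_diff X)) else 0) \<noteq> 0} \<subseteq> {..B}"
proof -
  have "(if d > 0 then mu C (replicate d (tw_diff X)) else 0) = 0" if "d > B" for d
  proof -
    have "walk C (fst X) (realize X (replicate d None))"
      using assms(1) by (intro walk_realize) simp
    then have "composable C (replicate d (tw_diff X))"
      using that by (intro walk_composable) auto
    then show ?thesis
      using vanishingD[OF assms(2), of "replicate d None" "[]" "[]"] that by simp
  qed
  then show ?thesis
    using not_le by blast
qed

text \<open>Words without letters are the powers of the differential. The empty word is left out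
  because the equation starts at d = 1.\<close>

lemma maurer_cartan:
  assumes "X \<in> Obj (Tw A)" "vanishing B X []"
  shows "(\<Sum>w\<in>words B [] - {[]}. mu C (realize X w)) = 0"
proof -
  let ?g = "\<lambda>d. if d > 0 then mu C (replicate d (tw_diff X)) else 0"
  have sup: "{d. ?g d \<noteq> 0} \<subseteq> {..B}"
    using maurer_cartan_support[OF assms] .
  have "0 = Sum_any ?g"
    using assms(1) by (auto simp: Tw_sel(1))
  also have "\<dots> = sum ?g {..B}"
    by (rule Sum_any.expand_superset[OF _ sup]) simp
  also have "\<dots> = (\<Sum>w\<in>(words B [] :: (('o, 'm) twisted, 'm matrix) arr option list set). if w = [] then 0 else mu C (realize X w))"
    unfolding words_Nil by (subst sum.reindex) (auto simp: inj_on_def intro!: sum.cong)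
  also have "\<dots> = (\<Sum>w\<in>words B [] - {[]}. mu C (realize X w))"
    by (intro sum.mono_neutral_cong_right) auto
  finally show ?thesis by simp
qed

text \<open>Separating the insertions before and after one argument exposes that argument as a
  single slot of \<open>mu C\<close>. In this way multilinearity and contraction of blocks pass from
  \<open>ZZ\<close> to \<open>Tw\<close>.\<close>

lemma mu_Tw_slot:
  assumes "walk (Tw A) X (fs @ f # gs)"
  shows "\<forall>\<^sub>F B in sequentially. mu (Tw A) (fs @ f # gs) = (\<Sum>u\<in>words B fs. \<Sum>v\<in>words B gs.
    mu C (realize X u @ tw_forget f # realize (tgt f) v))"
proof -
  have walks: "walk (Tw A) X fs" "walk (Tw A) (tgt f) gs"
    using assms by auto
  have *: "mu (Tw A) (fs @ f # gs) = (\<Sum>u\<in>words B fs. \<Sum>v\<in>words B gs.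
    mu C (realize X u @ tw_forget f # realize (tgt f) v))"
    if B: "vanishing B X (fs @ f # gs)" "vanishing B X fs" "vanishing B (tgt f) gs" for B
  proof -
    define j where "j = (\<lambda>(u, v). u @ Some f # v)"
    have j: "inj_on j (words B fs \<times> words B gs)"
    proof (rule inj_onI)
      fix p q
      assume "p \<in> words B fs \<times> words B gs" "q \<in> words B fs \<times> words B gs" "j p = j q"
      then show "p = q"
        using letter_split_unique[of "fst p" f "snd p" "fst q" f "snd q"]
        by (simp add: words_def j_def case_prod_unfold mem_Times_iff prod_eq_iff)
    qed
    \<comment> \<open>Two words of length at most B and the letter between them occupy at most 2 B +
      1 places.\<close>
    have B': "vanishing (2 * B + 1) X (fs @ f # gs)"
      using vanishing_mono[OF B(1)] by simp
    have "mu (Tw A) (fs @ f # gs) = (\<Sum>w\<in>words (2 * B + 1) (fs @ f # gs). mu C (realize X w))"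
      by (rule mu_Tw_words(1)[OF _ assms B']) simp
    also have "\<dots> = (\<Sum>w\<in>j ` (words B fs \<times> words B gs). mu C (realize X w))"
    proof (rule sum.mono_neutral_right)
      show "finite (words (2 * B + 1) (fs @ f # gs))"
        by simp
      show "j ` (words B fs \<times> words B gs) \<subseteq> words (2 * B + 1) (fs @ f # gs)"
        by (auto simp: words_def j_def)
      show "\<forall>w\<in>words (2 * B + 1) (fs @ f # gs) - j ` (words B fs \<times> words B gs). mu C (realize X w) = 0"
      proof
        fix w
        assume w: "w \<in> words (2 * B + 1) (fs @ f # gs) - j ` (words B fs \<times> words B gs)"
        then have "letters w = fs @ f # gs"
          by (simp add: words_def)
        then obtain u v where uv: "w = u @ Some f # v" "letters u = fs" "letters v = gs"
          by (rule letter_split)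
        have comp: "composable C (realize X w)"
          using walk_realize[of A X w] assms uv by (intro walk_composable) auto
        have "(u, v) \<notin> words B fs \<times> words B gs"
          using w uv(1) by (auto simp: j_def)
        then consider "length u > B" | "length v > B"
          using uv(2,3) by (auto simp: words_def)
        then show "mu C (realize X w) = 0"
        proof cases
          case 1
          have "realize X w = [] @ realize X u @ (tw_forget f # realize (tgt f) v)"
            using uv by simp
          then show ?thesis
            using vanishingD[OF B(2) uv(2) 1] comp by metis
        next
          case 2
          have "realize X w = (realize X u @ [tw_forget f]) @ realize (tgt f) v @ []"
            using uv by simp
          then show ?thesis
            using vanishingD[OF B(3) uv(3) 2] comp by metis
        qed
      qed
    qed
    also have "\<dots> = (\<Sum>(u, v)\<in>words B fs \<times> words B gs. mu C (realize X (j (u, v))))"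
      by (simp add: sum.reindex[OF j] comp_def case_prod_unfold)
    also have "\<dots> = (\<Sum>(u, v)\<in>words B fs \<times> words B gs. mu C (realize X u @ tw_forget f # realize (tgt f) v))"
      by (simp add: j_def case_prod_unfold)
    finally show ?thesis
      by (simp add: sum.cartesian_product)
  qed
  show ?thesis
    using eventually_vanishing[OF assms] eventually_vanishing[OF walks(1)] eventually_vanishing[OF walks(2)]
    by eventually_elim (rule *)
qed

lemma mem_words: "w \<in> words B fs \<longleftrightarrow> letters w = fs \<and> length w \<le> B"
  by (simp add: words_def)

lemma mu_realize:
  assumes "walk (Tw A) X (letters w)" "w \<noteq> []"
  shows "composable C (realize X w)"
    and "mu_arr C (realize X w) = Arr (fst X) (fst (endpoint X (letters w)))
      (sum_list (map deg (letters w)) + 2 - int (length (letters w))) (mu C (realize X w))"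
    and "mu C (realize X w) \<in> Hom C (fst X) (fst (endpoint X (letters w)))
      (sum_list (map deg (letters w)) + 2 - int (length (letters w)))"
proof -
  have walk: "walk C (fst X) (realize X w)"
    using assms(1) by (rule walk_realize)
  then show comp: "composable C (realize X w)"
    using assms(2) by (intro walk_composable) auto
  show arr: "mu_arr C (realize X w) = Arr (fst X) (fst (endpoint X (letters w)))
      (sum_list (map deg (letters w)) + 2 - int (length (letters w))) (mu C (realize X w))"
    using last_hd_walk[OF walk] assms(2) sum_deg_realize[of X w]
    by (simp add: mu_arr_def endpoint_realize)
  show "mu C (realize X w) \<in> Hom C (fst X) (fst (endpoint X (letters w)))
      (sum_list (map deg (letters w)) + 2 - int (length (letters w)))"
    using C.mu_arr_closed[OF comp] by (simp add: arr is_arr_def)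
qed

lemma composable_slot_words:
  assumes "walk (Tw A) X (fs @ f # gs)" "u \<in> words B fs" "v \<in> words B gs"
  shows "composable C (realize X u @ tw_forget f # realize (tgt f) v)"
  using mu_realize(1)[of X "u @ Some f # v"] assms by (simp add: words_def)

lemma vanishing_obtain:
  assumes "walk (Tw A) X fs"
  obtains B where "vanishing B X fs"
  using eventually_happens'[OF sequentially_bot eventually_vanishing[OF assms]] by blast

sublocale Tw: multilinear_ainf "Tw A"
proof
  fix fs
  assume comp: "composable (Tw A) fs"
  define X where "X = src (hd fs)"
  have walk: "walk (Tw A) X fs" and ne: "fs \<noteq> []"
    using comp by (auto simp: composable_walk X_def)
  obtain B where B: "vanishing B X fs"
    using walk by (rule vanishing_obtain)
  have obj: "X \<in> Obj (Tw A)" "endpoint X fs \<in> Obj (Tw A)"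
    using walk_Obj[OF walk] by auto
  have "mu C (realize X w) \<in> Hom C (fst X) (fst (endpoint X fs)) (sum_list (map deg fs) + 2 - int (length fs))"
    if "w \<in> words B fs" for w
    using mu_realize(3)[of X w] that walk ne by (cases "w = []") (auto simp: words_def)
  then have "mu (Tw A) fs \<in> Hom C (fst X) (fst (endpoint X fs)) (sum_list (map deg fs) + 2 - int (length fs))"
    unfolding mu_Tw_words(1)[OF ne walk B] using obj by (intro C.Hom_sum fst_Obj_Tw)
  then show "is_arr (Tw A) (mu_arr (Tw A) fs)"
    using obj last_hd_walk[OF walk ne] by (simp add: is_arr_def mu_arr_def)
next
  fix fs gs X Y n a b
  assume comp: "composable (Tw A) (fs @ Arr X Y n a # gs)" and b: "b \<in> Hom (Tw A) X Y n"
  define Z where "Z = src (hd (fs @ Arr X Y n a # gs))"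
  have walk: "walk (Tw A) Z (fs @ Arr X Y n a # gs)"
    using comp by (simp only: composable_walk Z_def)
  have arr: "is_arr (Tw A) (Arr X Y n a)" "is_arr (Tw A) (Arr X Y n b)"
    using walk b by (auto simp: is_arr_def)
  then have arr_ab: "is_arr (Tw A) (Arr X Y n (a + b))"
    by (simp add: is_arr_def C.Hom_add fst_Obj_Tw)
  have walk_b: "walk (Tw A) Z (fs @ Arr X Y n b # gs)" and walk_ab: "walk (Tw A) Z (fs @ Arr X Y n (a + b) # gs)"
    using walk arr arr_ab by auto
  \<comment> \<open>The three paths have different bounds. The sums are compared for all large B,
    and B does not occur in the equation, so it holds outright.\<close>
  have "\<forall>\<^sub>F B in sequentially. mu (Tw A) (fs @ Arr X Y n (a + b) # gs) =
      mu (Tw A) (fs @ Arr X Y n a # gs) + mu (Tw A) (fs @ Arr X Y n b # gs)"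
    using mu_Tw_slot[OF walk] mu_Tw_slot[OF walk_b] mu_Tw_slot[OF walk_ab]
  proof eventually_elim
    case (elim B)
    have "mu C (realize Z u @ tw_forget (Arr X Y n (a + b)) # realize Y v) =
      mu C (realize Z u @ tw_forget (Arr X Y n a) # realize Y v) +
      mu C (realize Z u @ tw_forget (Arr X Y n b) # realize Y v)"
      if "u \<in> words B fs" "v \<in> words B gs" for u v
      using composable_slot_words[OF walk that] b by (simp add: C.mu_slot_add)
    then show ?case
      by (simp add: elim sum.distrib)
  qed
  then show "mu (Tw A) (fs @ Arr X Y n (a + b) # gs) =
      mu (Tw A) (fs @ Arr X Y n a # gs) + mu (Tw A) (fs @ Arr X Y n b # gs)"
    by simp
next
  fix fs gs X Y n a c
  assume comp: "composable (Tw A) (fs @ Arr X Y n a # gs)"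
  let ?ca = "smul (Tw A) c a"
  define Z where "Z = src (hd (fs @ Arr X Y n a # gs))"
  have walk: "walk (Tw A) Z (fs @ Arr X Y n a # gs)"
    using comp by (simp only: composable_walk Z_def)
  then have walk_c: "walk (Tw A) Z (fs @ Arr X Y n ?ca # gs)"
    by (auto simp: is_arr_def Tw.Hom_smul simp del: Tw_sel)
  have "\<forall>\<^sub>F B in sequentially. mu (Tw A) (fs @ Arr X Y n ?ca # gs) =
      smul (Tw A) c (mu (Tw A) (fs @ Arr X Y n a # gs))"
    using mu_Tw_slot[OF walk] mu_Tw_slot[OF walk_c]
  proof eventually_elim
    case (elim B)
    have "mu C (realize Z u @ tw_forget (Arr X Y n ?ca) # realize Y v) =
      smul C c (mu C (realize Z u @ tw_forget (Arr X Y n a) # realize Y v))"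
      if "u \<in> words B fs" "v \<in> words B gs" for u v
      using composable_slot_words[OF walk that] by (simp add: C.mu_slot_smul del: ZZ_sel)
    then show ?case
      unfolding elim by (simp only: Tw_sel(3) C.scale_sum_right) (intro sum.cong refl, simp del: ZZ_sel)
  qed
  then show "mu (Tw A) (fs @ Arr X Y n ?ca # gs) = smul (Tw A) c (mu (Tw A) (fs @ Arr X Y n a # gs))"
    by simp
qed

text \<open>Cutting a realized word anywhere gives realized words, the later ones starting at the
  object reached by the earlier letters.\<close>

lemma ainf_rel_realize:
  "ainf_rel C (realize X w) = (\<Sum>(u, v, x)\<in>splits w. signed (\<Sum>f\<leftarrow>letters u. deg f - 1)
     (mu C (realize X u @ [mu_arr C (realize (endpoint X (letters u)) v)] @
       realize (endpoint X (letters u @ letters v)) x)))"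
  unfolding ainf_rel_def sum_splits
  by (simp add: take_realize drop_realize take_add sum_reduced_deg_realize)

text \<open>Triples of words (u, v, x) with v nonempty are summed in two ways, and each way has its
  own truncation: a total length of at most 3 B suits the relations of \<open>ZZ\<close>, a length
  of at most B for each part suits those of \<open>Tw\<close>. Terms in the difference vanish
  because one part is too long.\<close>

lemma ainf_rel_Tw:
  assumes comp: "composable (Tw A) fs"
  shows "ainf_rel (Tw A) fs = 0"
proof -
  define X where "X = src (hd fs)"
  have walk: "walk (Tw A) X fs" and ne: "fs \<noteq> []"
    using comp by (auto simp: composable_walk X_def)
  \<comment> \<open>Unlike in \<open>splits\<close>, the middle block may be empty; such triples
    collect the terms whose inner operation sees only differentials.\<close>
  define S where "S = {(xs, ys, zs). xs @ ys @ zs = fs}"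
  define E where "E xs = endpoint X xs" for xs :: "(('o, 'm) twisted, 'm matrix) arr list"
  define T where "T = (\<lambda>(u, v, x). signed (\<Sum>f\<leftarrow>letters u. deg f - 1)
     (mu C (realize X u @ mu_arr C (realize (E (letters u)) v) # realize (E (letters u @ letters v)) x)))"
  have walks: "walk (Tw A) X xs" "walk (Tw A) (E xs) ys" "walk (Tw A) (E (xs @ ys)) zs"
    if "(xs, ys, zs) \<in> S" for xs ys zs
    using that walk by (auto simp: S_def E_def)
  have contract: "walk (Tw A) X (xs @ mu_arr (Tw A) ys # zs)" "mu_arr (Tw A) ys =
      Arr (E xs) (E (xs @ ys)) (sum_list (map deg ys) + 2 - int (length ys)) (mu (Tw A) ys)"
    if "(xs, ys, zs) \<in> S" "ys \<noteq> []" for xs ys zs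
  proof -
    have "composable (Tw A) ys"
      using walks(2)[OF that(1)] that(2) by (rule walk_composable)
    then have arr: "is_arr (Tw A) (mu_arr (Tw A) ys)"
      by (rule Tw.mu_arr_closed)
    show eq: "mu_arr (Tw A) ys =
      Arr (E xs) (E (xs @ ys)) (sum_list (map deg ys) + 2 - int (length ys)) (mu (Tw A) ys)"
      using last_hd_walk[OF walks(2)[OF that(1)] that(2)] by (simp add: mu_arr_def E_def)
    show "walk (Tw A) X (xs @ mu_arr (Tw A) ys # zs)"
      using walks[OF that(1)] arr by (simp add: eq E_def)
  qed
  have finS: "finite S"
  proof (rule finite_subset)
    show "S \<subseteq> (\<lambda>(n, m). (take n fs, take m (drop n fs), drop (n + m) fs)) ` ({..length fs} \<times> {..length fs})"
    proof clarify
      fix xs ys zs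
      assume "(xs, ys, zs) \<in> S"
      then show "(xs, ys, zs) \<in> (\<lambda>(n, m). (take n fs, take m (drop n fs), drop (n + m) fs)) ` ({..length fs} \<times> {..length fs})"
        by (intro image_eqI[of _ _ "(length xs, length ys)"]) (auto simp: S_def)
    qed
  qed simp
  \<comment> \<open>One bound for all decompositions of \<open>fs\<close> and for all paths with a
    contracted block.\<close>
  have "\<forall>\<^sub>F B in sequentially. \<forall>(xs, ys, zs)\<in>S. vanishing B X xs \<and> vanishing B (E xs) ys \<and>
     vanishing B (E (xs @ ys)) zs \<and> (ys \<noteq> [] \<longrightarrow> mu (Tw A) (xs @ mu_arr (Tw A) ys # zs) =
     (\<Sum>u\<in>words B xs. \<Sum>x\<in>words B zs. mu C (realize X u @ tw_forget (mu_arr (Tw A) ys) # realize (E (xs @ ys)) x)))"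
  proof (intro eventually_ball_finite finS ballI)
    fix p
    assume "p \<in> S"
    then obtain xs ys zs where p: "p = (xs, ys, zs)" "(xs, ys, zs) \<in> S"
      by (cases p) auto
    have "\<forall>\<^sub>F B in sequentially. ys \<noteq> [] \<longrightarrow> mu (Tw A) (xs @ mu_arr (Tw A) ys # zs) =
     (\<Sum>u\<in>words B xs. \<Sum>x\<in>words B zs. mu C (realize X u @ tw_forget (mu_arr (Tw A) ys) # realize (E (xs @ ys)) x))"
    proof (cases "ys = []")
      case False
      then have "tgt (mu_arr (Tw A) ys) = E (xs @ ys)"
        using contract(2)[OF p(2)] by simp
      then show ?thesis
        using mu_Tw_slot[OF contract(1)[OF p(2) False]] by (auto elim: eventually_mono)
    qed simp
    then show "\<forall>\<^sub>F B in sequentially. case p of (xs, ys, zs) \<Rightarrow> vanishing B X xs \<and> vanishing B (E xs) ys \<and>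
     vanishing B (E (xs @ ys)) zs \<and> (ys \<noteq> [] \<longrightarrow> mu (Tw A) (xs @ mu_arr (Tw A) ys # zs) =
     (\<Sum>u\<in>words B xs. \<Sum>x\<in>words B zs. mu C (realize X u @ tw_forget (mu_arr (Tw A) ys) # realize (E (xs @ ys)) x)))"
      unfolding p prod.case using walks[OF p(2)] by (intro eventually_conj eventually_vanishing)
  qed
  then obtain B where B: "\<forall>(xs, ys, zs)\<in>S. vanishing B X xs \<and> vanishing B (E xs) ys \<and>
     vanishing B (E (xs @ ys)) zs \<and> (ys \<noteq> [] \<longrightarrow> mu (Tw A) (xs @ mu_arr (Tw A) ys # zs) =
     (\<Sum>u\<in>words B xs. \<Sum>x\<in>words B zs. mu C (realize X u @ tw_forget (mu_arr (Tw A) ys) # realize (E (xs @ ys)) x)))"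
    using eventually_happens'[OF sequentially_bot] by blast
  have van: "vanishing B X xs" "vanishing B (E xs) ys" "vanishing B (E (xs @ ys)) zs"
    if "(xs, ys, zs) \<in> S" for xs ys zs
    using B that by auto
  have slot: "mu (Tw A) (xs @ mu_arr (Tw A) ys # zs) =
     (\<Sum>u\<in>words B xs. \<Sum>x\<in>words B zs. mu C (realize X u @ tw_forget (mu_arr (Tw A) ys) # realize (E (xs @ ys)) x))"
    if "(xs, ys, zs) \<in> S" "ys \<noteq> []" for xs ys zs
    using B that by auto
  have comp_words: "composable C (realize X u @ g # realize (E (xs @ ys)) x)"
    if "(xs, ys, zs) \<in> S" "letters u = xs" "letters x = zs" "is_arr C g" "src g = fst (E xs)" "tgt g = fst (E (xs @ ys))"
    for xs ys zs u x g
    using that walks[OF that(1)] walk_realize[of A X u] walk_realize[of A "E (xs @ ys)" x]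
    by (intro walk_composable[of _ "fst X"]) (auto simp: endpoint_realize E_def)
  define K where "K = {(u, v, x). v \<noteq> [] \<and> letters u @ letters v @ letters x = fs \<and> length u + length v + length x \<le> 3 * B}"
  define K0 where "K0 = {(u, v, x). v \<noteq> [] \<and> letters u @ letters v @ letters x = fs \<and> length u \<le> B \<and> length v \<le> B \<and> length x \<le> B}"
  have K_Sigma: "K = snd ` (SIGMA w:words (3 * B) fs. splits w)"
  proof (intro subset_antisym subsetI)
    fix p
    assume "p \<in> K"
    then obtain u v x where p: "p = (u, v, x)" "(u, v, x) \<in> K"
      by (cases p) auto
    then have "(u @ v @ x, p) \<in> (SIGMA w:words (3 * B) fs. splits w)"
      by (auto simp: K_def words_def splits_def)
    then show "p \<in> snd ` (SIGMA w:words (3 * B) fs. splits w)"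
      by force
  qed (auto simp: K_def words_def splits_def)
  have inj: "inj_on snd (SIGMA w:words (3 * B) fs. splits w)"
    by (auto simp: inj_on_def splits_def)
  have finK: "finite K"
    unfolding K_Sigma by (intro finite_imageI finite_SigmaI) auto
  have K0_K: "K0 \<subseteq> K"
    by (auto simp: K_def K0_def)
  have arr_mid: "mu_arr C (realize (E xs) v) = Arr (fst (E xs)) (fst (E (xs @ ys)))
      (sum_list (map deg ys) + 2 - int (length ys)) (mu C (realize (E xs) v))"
    "mu C (realize (E xs) v) \<in> Hom C (fst (E xs)) (fst (E (xs @ ys))) (sum_list (map deg ys) + 2 - int (length ys))"
    if "(xs, ys, zs) \<in> S" "letters v = ys" "v \<noteq> []" for xs ys zs v
    using mu_realize(2,3)[of "E xs" v] that walks[OF that(1)] by (simp_all add: E_def)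
  have objE: "fst (E xs) \<in> Obj C" "fst (E (xs @ ys)) \<in> Obj C" if "(xs, ys, zs) \<in> S" for xs ys zs
    using walks(2,3)[OF that] walk_Obj fst_Obj_Tw by metis+
  have "0 = (\<Sum>w\<in>words (3 * B) fs. ainf_rel C (realize X w))"
  proof (rule sum.neutral[symmetric], rule ballI)
    fix w
    assume "w \<in> words (3 * B) fs"
    then have "walk (Tw A) X (letters w)" "w \<noteq> []"
      using walk ne by (auto simp: words_def)
    then show "ainf_rel C (realize X w) = 0"
      by (intro C.rel mu_realize(1))
  qed
  also have "\<dots> = (\<Sum>w\<in>words (3 * B) fs. sum T (splits w))"
    by (simp add: ainf_rel_realize T_def E_def)
  also have "\<dots> = sum T K"
    unfolding K_Sigma by (simp add: sum.reindex[OF inj] sum.Sigma case_prod_unfold)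
  also have "\<dots> = sum T K0"
  proof (rule sum.mono_neutral_right[OF finK])
    show "K0 \<subseteq> K"
      by (rule K0_K)
    show "\<forall>p\<in>K - K0. T p = 0"
    proof
      fix p
      assume p: "p \<in> K - K0"
      obtain u v x where uvx: "p = (u, v, x)"
        by (cases p) auto
      have v: "v \<noteq> []" and S: "(letters u, letters v, letters x) \<in> S"
        using p by (auto simp: uvx K_def S_def)
      let ?g = "mu_arr C (realize (E (letters u)) v)"
      have comp_g: "composable C (realize X u @ ?g # realize (E (letters u @ letters v)) x)"
        using objE[OF S] arr_mid[OF S refl v] by (intro comp_words[OF S]) (simp_all add: is_arr_def)
      consider "length u > B" | "length v > B" | "length x > B"
        using p by (auto simp: uvx K_def K0_def)
      then have "mu C (realize X u @ ?g # realize (E (letters u @ letters v)) x) = 0"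
      proof cases
        case 1
        then show ?thesis
          using vanishingD[OF van(1)[OF S] refl 1, of "[]"] comp_g by simp
      next
        \<comment> \<open>Here the inner operation itself vanishes, and the outer one has a zero
          argument.\<close>
        case 2
        have "composable C (realize (E (letters u)) v)"
          using mu_realize(1)[of "E (letters u)" v] walks(2)[OF S] v by simp
        then have "mu C (realize (E (letters u)) v) = 0"
          using vanishingD[OF van(2)[OF S] refl 2, of "[]" "[]"] by simp
        then show ?thesis
          using comp_g arr_mid(1)[OF S refl v] by (simp add: C.mu.slot_zero)
      next
        case 3
        then show ?thesis
          using vanishingD[OF van(3)[OF S] refl 3, of "realize X u @ [?g]" "[]"] comp_g by simp
      qed
      then show "T p = 0"
        by (simp add: T_def uvx)
    qed
  qed
  also have "\<dots> = (\<Sum>q\<in>S. sum T {p \<in> K0. (\<lambda>(u, v, x). (letters u, letters v, letters x)) p = q})"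
    by (rule sum.group[symmetric])
      (use finS finite_subset[OF K0_K finK] in \<open>auto simp: S_def K0_def\<close>)
  also have "\<dots> = (\<Sum>(xs, ys, zs)\<in>S. if ys = [] then 0 else
      signed (\<Sum>f\<leftarrow>xs. deg f - 1) (mu (Tw A) (xs @ [mu_arr (Tw A) ys] @ zs)))"
  proof (rule sum.cong[OF refl])
    fix q
    assume "q \<in> S"
    then obtain xs ys zs where q: "q = (xs, ys, zs)" and S: "(xs, ys, zs) \<in> S"
      by (cases q) auto
    let ?V = "words B ys - {[]}"
    let ?n = "sum_list (map deg ys) + 2 - int (length ys)"
    have K0q: "{p \<in> K0. (\<lambda>(u, v, x). (letters u, letters v, letters x)) p = q} = words B xs \<times> ?V \<times> words B zs"
      using S by (auto simp: q K0_def words_def S_def)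
    \<comment> \<open>The inner operation of \<open>Tw\<close>, or the Maurer-Cartan sum, of degree
      2, if \<open>ys\<close> is empty.\<close>
    define M where "M = (\<Sum>v\<in>?V. mu C (realize (E xs) v))"
    have M: "(\<Sum>v\<in>?V. T (u, v, x)) = signed (\<Sum>f\<leftarrow>xs. deg f - 1)
        (mu C (realize X u @ Arr (fst (E xs)) (fst (E (xs @ ys))) ?n M # realize (E (xs @ ys)) x))"
      if u: "u \<in> words B xs" and x: "x \<in> words B zs" for u x
    proof -
      have lu: "letters u = xs" and lx: "letters x = zs"
        using u x by (auto simp: words_def)
      have "composable C (realize X u @ Arr (fst (E xs)) (fst (E (xs @ ys))) ?n 0 # realize (E (xs @ ys)) x)"
        using objE[OF S] by (intro comp_words[OF S lu lx]) (auto simp: is_arr_def C.Hom_zero)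
      then have "mu C (realize X u @ Arr (fst (E xs)) (fst (E (xs @ ys))) ?n M # realize (E (xs @ ys)) x) =
        (\<Sum>v\<in>?V. mu C (realize X u @ Arr (fst (E xs)) (fst (E (xs @ ys))) ?n (mu C (realize (E xs) v)) # realize (E (xs @ ys)) x))"
        unfolding M_def using arr_mid(2)[OF S] by (intro C.mu_slot_sum) (simp_all add: mem_words)
      moreover have "T (u, v, x) = signed (\<Sum>f\<leftarrow>xs. deg f - 1)
        (mu C (realize X u @ Arr (fst (E xs)) (fst (E (xs @ ys))) ?n (mu C (realize (E xs) v)) # realize (E (xs @ ys)) x))"
        if "v \<in> ?V" for v
      proof -
        have lv: "letters v = ys" "v \<noteq> []"
          using that by (auto simp: words_def)
        show ?thesis
          using arr_mid(1)[OF S lv] by (simp add: T_def lu lv)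
      qed
      ultimately show ?thesis
        by (simp add: signed_sum)
    qed
    have "sum T (words B xs \<times> ?V \<times> words B zs) = (\<Sum>u\<in>words B xs. \<Sum>v\<in>?V. \<Sum>x\<in>words B zs. T (u, v, x))"
      by (simp add: sum.cartesian_product case_prod_unfold)
    also have "\<dots> = (\<Sum>u\<in>words B xs. \<Sum>x\<in>words B zs. \<Sum>v\<in>?V. T (u, v, x))"
      by (intro sum.cong refl sum.swap)
    also have "\<dots> = (\<Sum>u\<in>words B xs. \<Sum>x\<in>words B zs. signed (\<Sum>f\<leftarrow>xs. deg f - 1)
        (mu C (realize X u @ Arr (fst (E xs)) (fst (E (xs @ ys))) ?n M # realize (E (xs @ ys)) x)))"
      using M by (intro sum.cong refl)
    also have "\<dots> = (if ys = [] then 0 else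
      signed (\<Sum>f\<leftarrow>xs. deg f - 1) (mu (Tw A) (xs @ [mu_arr (Tw A) ys] @ zs)))"
    proof (cases "ys = []")
      case True
      have "E xs \<in> Obj (Tw A)"
        using walk_Obj[OF walks(2)[OF S]] by simp
      then have "M = 0"
        unfolding M_def True using van(2)[OF S] True by (intro maurer_cartan) auto
      moreover have "mu C (realize X u @ Arr (fst (E xs)) (fst (E (xs @ ys))) ?n 0 # realize (E (xs @ ys)) x) = 0"
        if "u \<in> words B xs" "x \<in> words B zs" for u x
        using objE[OF S] that
        by (intro C.mu.slot_zero comp_words[OF S]) (auto simp: is_arr_def C.Hom_zero words_def)
      ultimately show ?thesis
        using True by simp
    next
      case False
      then have "?V = words B ys"
        by (auto simp: words_def)
      then have "M = mu (Tw A) ys"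
        using mu_Tw_words(1)[OF False walks(2)[OF S] van(2)[OF S]] by (simp add: M_def)
      then show ?thesis
        using False slot[OF S False] contract(2)[OF S False] by (simp add: signed_sum)
    qed
    finally show "sum T {p \<in> K0. (\<lambda>(u, v, x). (letters u, letters v, letters x)) p = q} =
      (case q of (xs, ys, zs) \<Rightarrow> if ys = [] then 0 else
        signed (\<Sum>f\<leftarrow>xs. deg f - 1) (mu (Tw A) (xs @ [mu_arr (Tw A) ys] @ zs)))"
      unfolding K0q by (simp only: q prod.case)
  qed
  also have "\<dots> = ainf_rel (Tw A) fs"
    unfolding ainf_rel_def using finS
    by (intro sum.mono_neutral_cong_right) (auto simp: S_def splits_def)
  finally show ?thesis ..
qed

text \<open>Differentials can be inserted next to a unit-like morphism only if there is no other argument.\<close>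

lemma mu_Tw_unitlike:
  assumes u: "unitlike C (tw_forget e)" and walk: "walk (Tw A) X (fs @ e # gs)"
  shows "length fs + length gs \<ge> 2 \<Longrightarrow> mu (Tw A) (fs @ e # gs) = 0"
    and "fs = [f] \<Longrightarrow> gs = [] \<Longrightarrow> mu (Tw A) (fs @ e # gs) = mu C [tw_forget f, tw_forget e]"
    and "fs = [] \<Longrightarrow> gs = [g] \<Longrightarrow> mu (Tw A) (fs @ e # gs) = mu C [tw_forget e, tw_forget g]"
    and "fs = [] \<Longrightarrow> gs = [] \<Longrightarrow> mu (Tw A) (fs @ e # gs) =
      mu C [tw_diff (src e), tw_forget e] + mu C [tw_forget e, tw_diff (tgt e)]"
proof -
  \<comment> \<open>B is at least 1 so that a single inserted differential is counted.\<close>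
  obtain B where B: "1 \<le> B" "mu (Tw A) (fs @ e # gs) = (\<Sum>u\<in>words B fs. \<Sum>v\<in>words B gs.
    mu C (realize X u @ tw_forget e # realize (tgt e) v))"
    using eventually_happens'[OF sequentially_bot eventually_conj[OF eventually_ge_at_top[of 1] mu_Tw_slot[OF walk]]]
    by blast
  let ?h = "\<lambda>(u, v). mu C (realize X u @ tw_forget e # realize (tgt e) v)"
  \<comment> \<open>Only terms with exactly one further argument survive next to a unit-like
    morphism, be it a differential or a letter.\<close>
  define P where "P = {(u, v). u \<in> words B fs \<and> v \<in> words B gs \<and> length u + length v = 1}"
  have "mu (Tw A) (fs @ e # gs) = sum ?h (words B fs \<times> words B gs)"
    using B(2) by (simp add: sum.cartesian_product)
  also have "\<dots> = sum ?h P"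
  proof (rule sum.mono_neutral_right)
    show "\<forall>p\<in>words B fs \<times> words B gs - P. ?h p = 0"
      using u composable_slot_words[OF walk] by (fastforce simp: unitlike_def P_def)
  qed (auto simp: P_def)
  finally have eq: "mu (Tw A) (fs @ e # gs) = sum ?h P" .
  show "mu (Tw A) (fs @ e # gs) = 0" if "length fs + length gs \<ge> 2"
  proof -
    have "P = {}"
    proof -
      have False if "(u, v) \<in> P" for u v
        using that \<open>length fs + length gs \<ge> 2\<close> length_letters[of u] length_letters[of v]
        by (simp add: P_def words_def)
      then show ?thesis by auto
    qed
    then show ?thesis
      using eq by simp
  qed
  have len1: "length u = Suc 0 \<longleftrightarrow> u = [None] \<or> (\<exists>a. u = [Some a])" for u :: "'x option list"
    by (cases u; cases "hd u") auto
  show "mu (Tw A) (fs @ e # gs) = mu C [tw_forget f, tw_forget e]" if "fs = [f]" "gs = []"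
  proof -
    have "P = {([Some f], [])}"
      using that B(1) by (auto simp: P_def words_def add_is_1 len1)
    then show ?thesis
      using eq by simp
  qed
  show "mu (Tw A) (fs @ e # gs) = mu C [tw_forget e, tw_forget g]" if "fs = []" "gs = [g]"
  proof -
    have "P = {([], [Some g])}"
      using that B(1) by (auto simp: P_def words_def add_is_1 len1)
    then show ?thesis
      using eq by simp
  qed
  show "mu (Tw A) (fs @ e # gs) = mu C [tw_diff (src e), tw_forget e] + mu C [tw_forget e, tw_diff (tgt e)]"
    if "fs = []" "gs = []"
  proof -
    have "P = {([None], []), ([], [None])}"
      using that B(1) by (auto simp: P_def words_def add_is_1 len1)
    moreover have "X = src e"
      using walk that by simp
    ultimately show ?thesis
      using eq by simp
  qed
qed

lemma id_arr_Tw: "X \<in> Obj (Tw A) \<Longrightarrow> is_arr (Tw A) (id_arr (Tw A) X)"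
  "tw_forget (id_arr (Tw A) X) = id_arr C (fst X)"
  by (simp_all add: is_arr_def C.idm_closed fst_Obj_Tw)

lemma unitlike_id_arr_Tw: "X \<in> Obj (Tw A) \<Longrightarrow> unitlike C (tw_forget (id_arr (Tw A) X))"
  unfolding id_arr_Tw(2) by (intro C.unitlike_id_arr fst_Obj_Tw)

lemma ainf_category_Tw: "ainf_category (Tw A)"
  unfolding ainf_category_iff
proof (intro conjI allI impI)
  show "multilinear_ainf (Tw A)"
    by (rule Tw.multilinear_ainf_axioms)
  show "ainf_rel (Tw A) fs = 0" if "composable (Tw A) fs" for fs
    using that by (rule ainf_rel_Tw)
  show "idm (Tw A) X \<in> Hom (Tw A) X X 0" if "X \<in> Obj (Tw A)" for X
    using that id_arr_Tw(1)[of X] by (simp add: is_arr_def)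
  show "mu (Tw A) [id_arr (Tw A) X] = 0" if X: "X \<in> Obj (Tw A)" for X
  proof -
    \<comment> \<open>The two products of the unit with the differential are opposite, since the
      left unit law carries the sign of a morphism of degree 1.\<close>
    have "mu (Tw A) [id_arr (Tw A) X] = mu C [tw_diff X, id_arr C (fst X)] + mu C [id_arr C (fst X), tw_diff X]"
      using mu_Tw_unitlike(4)[OF unitlike_id_arr_Tw[OF X], of X "[]" "[]"] id_arr_Tw(1)[OF X] X by simp
    then show ?thesis
      using C.mu2_idm_left[OF is_arr_tw_diff[OF X]] C.mu2_idm_right[OF is_arr_tw_diff[OF X]]
      by (simp add: signed_def)
  qed
  show "mu (Tw A) [id_arr (Tw A) (src f), f] = val f" if f: "is_arr (Tw A) f" for f
  proof -
    have obj: "src f \<in> Obj (Tw A)" "tgt f \<in> Obj (Tw A)"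
      using f by (auto simp: is_arr_def)
    have "mu (Tw A) [id_arr (Tw A) (src f), f] = mu C [id_arr C (fst (src f)), tw_forget f]"
      using mu_Tw_unitlike(3)[OF unitlike_id_arr_Tw[OF obj(1)], of "src f" "[]" "[f]" f] id_arr_Tw(1)[OF obj(1)] f obj by simp
    then show ?thesis
      using C.mu2_idm_right[of "tw_forget f"] f by (simp add: is_arr_Tw)
  qed
  show "mu (Tw A) [f, id_arr (Tw A) (tgt f)] = signed (deg f) (val f)" if f: "is_arr (Tw A) f" for f
  proof -
    have obj: "src f \<in> Obj (Tw A)" "tgt f \<in> Obj (Tw A)"
      using f by (auto simp: is_arr_def)
    have "mu (Tw A) [f, id_arr (Tw A) (tgt f)] = mu C [tw_forget f, id_arr C (fst (tgt f))]"
      using mu_Tw_unitlike(2)[OF unitlike_id_arr_Tw[OF obj(2)], of "src f" "[f]" "[]" f] id_arr_Tw(1)[OF obj(2)] f obj by simp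
    then show ?thesis
      using C.mu2_idm_left[of "tw_forget f"] f by (simp add: is_arr_Tw)
  qed
  show "mu (Tw A) (fs @ id_arr (Tw A) X # gs) = 0"
    if "composable (Tw A) (fs @ id_arr (Tw A) X # gs)" "length fs + length gs \<ge> 2" for fs X gs
  proof -
    have "X \<in> Obj (Tw A)"
      using composable_slot[OF that(1)] by (simp add: is_arr_def)
    moreover have "walk (Tw A) (src (hd (fs @ id_arr (Tw A) X # gs))) (fs @ id_arr (Tw A) X # gs)"
      using that(1) by (simp only: composable_walk)
    ultimately show ?thesis
      using mu_Tw_unitlike(1)[OF unitlike_id_arr_Tw] that(2) by blast
  qed
qed

end

section \<open>Cocycle and cohomology categories\<close>

context ainf_category
begin

section \<open>Relations with at most two arguments and the cocycle category\<close>

lemma mu_arr_single: "mu_arr A [f] = Arr (src f) (tgt f) (deg f + 1) (mu A [f])"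
  by (simp add: mu_arr_def)

lemma mu_arr_pair: "mu_arr A [f, g] = Arr (src f) (tgt g) (deg f + deg g) (mu A [f, g])"
  by (simp add: mu_arr_def)

lemma mu1_closed: "is_arr A f \<Longrightarrow> is_arr A (Arr (src f) (tgt f) (deg f + 1) (mu A [f]))"
  using mu_arr_closed[of "[f]"] by (simp add: mu_arr_single)

lemma mu2_closed:
  "is_arr A f \<Longrightarrow> is_arr A g \<Longrightarrow> tgt f = src g \<Longrightarrow>
   is_arr A (Arr (src f) (tgt g) (deg f + deg g) (mu A [f, g]))"
  using mu_arr_closed[of "[f, g]"] by (simp add: mu_arr_pair composable_pair)

lemma mu1_mu1: "is_arr A f \<Longrightarrow> mu A [Arr (src f) (tgt f) (deg f + 1) (mu A [f])] = 0"
  using mu_relations[of "[f]"] by (simp add: mu_arr_single)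

text \<open>The Leibniz rule: the relation for d = 2, solved for the term with inner
  \<mu>^2.\<close>

lemma mu1_mu2:
  assumes "is_arr A f" "is_arr A g" "tgt f = src g"
  shows "mu A [Arr (src f) (tgt g) (deg f + deg g + 1 - 1) (mu A [f, g])] =
    - mu A [Arr (src f) (tgt f) (deg f + 1) (mu A [f]), g] -
    signed (deg f - 1) (mu A [f, Arr (src g) (tgt g) (deg g + 1) (mu A [g])])"
  using mu_relations[of "[f, g]"] assms
  by (simp add: composable_pair mu_arr_single mu_arr_pair lessThan_Suc numeral_2_eq_2 atLeastAtMostSuc_conv
    eq_neg_iff_add_eq_0 algebra_simps)

lemma slot1_add:
  assumes "is_arr A f" "is_arr A (Arr X Y n a)" "is_arr A (Arr X Y n b)" "Y = src f"
  shows "mu A [Arr X Y n (a + b), f] = mu A [Arr X Y n a, f] + mu A [Arr X Y n b, f]"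
  using mu_slot_add[of "[]" X Y n a "[f]" b] assms by (simp add: composable_pair is_arr_def)

lemma slot2_add:
  assumes "is_arr A f" "is_arr A (Arr X Y n a)" "is_arr A (Arr X Y n b)" "tgt f = X"
  shows "mu A [f, Arr X Y n (a + b)] = mu A [f, Arr X Y n a] + mu A [f, Arr X Y n b]"
  using mu_slot_add[of "[f]" X Y n a "[]" b] assms by (simp add: composable_pair is_arr_def)

lemma slot0_add:
  assumes "is_arr A (Arr X Y n a)" "is_arr A (Arr X Y n b)"
  shows "mu A [Arr X Y n (a + b)] = mu A [Arr X Y n a] + mu A [Arr X Y n b]"
  using mu_slot_add[of "[]" X Y n a "[]" b] assms by (simp add: is_arr_def)

lemma slot1_smul:
  assumes "is_arr A f" "is_arr A (Arr X Y n a)" "Y = src f"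
  shows "mu A [Arr X Y n (smul A c a), f] = smul A c (mu A [Arr X Y n a, f])"
  using mu_slot_smul[of "[]" X Y n a "[f]" c] assms by (simp add: composable_pair)

lemma slot2_smul:
  assumes "is_arr A f" "is_arr A (Arr X Y n a)" "tgt f = X"
  shows "mu A [f, Arr X Y n (smul A c a)] = smul A c (mu A [f, Arr X Y n a])"
  using mu_slot_smul[of "[f]" X Y n a "[]" c] assms by (simp add: composable_pair)

lemma slot0_smul:
  assumes "is_arr A (Arr X Y n a)"
  shows "mu A [Arr X Y n (smul A c a)] = smul A c (mu A [Arr X Y n a])"
  using mu_slot_smul[of "[]" X Y n a "[]" c] assms by simp

lemma slot1_zero: "is_arr A f \<Longrightarrow> X \<in> Obj A \<Longrightarrow> mu A [Arr X (src f) n 0, f] = 0"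
  using mu.slot_zero[of "[]" X "src f" n "[f]"] by (simp add: composable_pair is_arr_def Hom_zero)

lemma slot2_zero: "is_arr A f \<Longrightarrow> X \<in> Obj A \<Longrightarrow> mu A [f, Arr (tgt f) X n 0] = 0"
  using mu.slot_zero[of "[f]" "tgt f" X n "[]"] by (simp add: composable_pair is_arr_def Hom_zero)

lemma slot0_zero: "X \<in> Obj A \<Longrightarrow> Y \<in> Obj A \<Longrightarrow> mu A [Arr X Y n 0] = 0"
  using mu.slot_zero[of "[]" X Y n "[]"] by (simp add: is_arr_def Hom_zero)

lemma slot0_signed:
  "is_arr A (Arr X Y n a) \<Longrightarrow> mu A [Arr X Y n (signed k a)] = signed k (mu A [Arr X Y n a])"
  using mu_slot_signed[of "[]" X Y n a "[]" k] by simp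

lemma smul_signed: "smul A c (signed k x) = signed k (smul A c x)"
  by (simp add: signed_def)

lemma cocycles_arr:
  "f \<in> cocycles A X Y n \<Longrightarrow> X \<in> Obj A \<Longrightarrow> Y \<in> Obj A \<Longrightarrow> is_arr A (Arr X Y n f) \<and> mu A [Arr X Y n f] = 0"
  by (simp add: cocycles_def is_arr_def)

lemma cocycles_zero: "X \<in> Obj A \<Longrightarrow> Y \<in> Obj A \<Longrightarrow> 0 \<in> cocycles A X Y n"
  by (simp add: cocycles_def Hom_zero slot0_zero)

lemma cocycles_add:
  "X \<in> Obj A \<Longrightarrow> Y \<in> Obj A \<Longrightarrow> f \<in> cocycles A X Y n \<Longrightarrow> g \<in> cocycles A X Y n \<Longrightarrow> f + g \<in> cocycles A X Y n"
  by (simp add: cocycles_def Hom_add slot0_add is_arr_def)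

lemma cocycles_smul:
  "X \<in> Obj A \<Longrightarrow> Y \<in> Obj A \<Longrightarrow> f \<in> cocycles A X Y n \<Longrightarrow> smul A c f \<in> cocycles A X Y n"
  by (simp add: cocycles_def Hom_smul slot0_smul is_arr_def)

lemma cocycles_signed:
  "X \<in> Obj A \<Longrightarrow> Y \<in> Obj A \<Longrightarrow> f \<in> cocycles A X Y n \<Longrightarrow> signed k f \<in> cocycles A X Y n"
  by (simp add: cocycles_def Hom_signed slot0_signed is_arr_def)

lemma cocycles_idm: "X \<in> Obj A \<Longrightarrow> idm A X \<in> cocycles A X X 0"
  by (simp add: cocycles_def idm_closed mu1_idm)

lemma cocycles_mu2:
  assumes "X \<in> Obj A" "Y \<in> Obj A" "Z \<in> Obj A" "f \<in> cocycles A X Y m" "g \<in> cocycles A Y Z n"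
  shows "mu A [Arr X Y m f, Arr Y Z n g] \<in> cocycles A X Z (m + n)"
  using mu2_closed[of "Arr X Y m f" "Arr Y Z n g"] mu1_mu2[of "Arr X Y m f" "Arr Y Z n g"]
    slot1_zero[of "Arr Y Z n g" X "m + 1"] slot2_zero[of "Arr X Y m f" Z "n + 1"] assms
  by (simp add: cocycles_def is_arr_def)

lemma kvector_space_cocycles:
  assumes "X \<in> Obj A" "Y \<in> Obj A"
  shows "kvector_space \<lparr>carr = cocycles A X Y n, vzero = 0, vadd = (+), vscl = smul A\<rparr>"
proof
  fix x
  assume "x \<in> carr \<lparr>carr = cocycles A X Y n, vzero = 0, vadd = (+), vscl = smul A\<rparr>"
  then show "\<exists>y\<in>carr \<lparr>carr = cocycles A X Y n, vzero = 0, vadd = (+), vscl = smul A\<rparr>.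
    vadd \<lparr>carr = cocycles A X Y n, vzero = 0, vadd = (+), vscl = smul A\<rparr> x y =
    vzero \<lparr>carr = cocycles A X Y n, vzero = 0, vadd = (+), vscl = smul A\<rparr>"
    using cocycles_smul[OF assms, of x n "-1"] by (intro bexI[of _ "- x"]) simp_all
qed (use assms in \<open>simp_all add: cocycles_zero cocycles_add cocycles_smul algebra_simps\<close>)

lemma Z0_sel:
  "obj (Z0 A) = Obj A"
  "hom (Z0 A) X Y = \<lparr>carr = cocycles A X Y 0, vzero = 0, vadd = (+), vscl = smul A\<rparr>"
  "cmp (Z0 A) X Y Z g f = mu A [Arr X Y 0 f, Arr Y Z 0 g]"
  "idn (Z0 A) X = idm A X"
  by (simp_all add: Z0_def cocycles_def)

lemma lcategory_Z0: "lcategory (Z0 A)"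
proof (rule lcategory.intro)
  fix X Y Z f
  assume "X \<in> obj (Z0 A)" "Y \<in> obj (Z0 A)" "Z \<in> obj (Z0 A)" "f \<in> carr (hom (Z0 A) X Y)"
  then show "linear_between (hom (Z0 A) Y Z) (hom (Z0 A) X Z) (\<lambda>g. cmp (Z0 A) X Y Z g f)"
    using cocycles_mu2[of X Y Z f 0 _ 0] cocycles_arr
    by (simp add: linear_between_def Z0_sel slot2_add slot2_smul)
next
  fix X Y Z g
  assume "X \<in> obj (Z0 A)" "Y \<in> obj (Z0 A)" "Z \<in> obj (Z0 A)" "g \<in> carr (hom (Z0 A) Y Z)"
  then show "linear_between (hom (Z0 A) X Y) (hom (Z0 A) X Z) (\<lambda>f. cmp (Z0 A) X Y Z g f)"
    using cocycles_mu2[of X Y Z _ 0 g 0] cocycles_arr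
    by (simp add: linear_between_def Z0_sel slot1_add slot1_smul)
next
  fix X Y f
  assume "X \<in> obj (Z0 A)" "Y \<in> obj (Z0 A)" "f \<in> carr (hom (Z0 A) X Y)"
  then have "is_arr A (Arr X Y 0 f)"
    using cocycles_arr by (simp add: Z0_sel)
  then show "cmp (Z0 A) X X Y f (idn (Z0 A) X) = f" "cmp (Z0 A) X Y Y (idn (Z0 A) Y) f = f"
    using mu2_idm_right[of "Arr X Y 0 f"] mu2_idm_left[of "Arr X Y 0 f"] by (simp_all add: Z0_sel)
qed (simp_all add: Z0_sel kvector_space_cocycles cocycles_idm)

section \<open>Coboundaries and the cohomology category\<close>

lemma coboundaryI: "h \<in> Hom A X Y (n - 1) \<Longrightarrow> mu A [Arr X Y (n - 1) h] \<in> coboundaries A X Y n"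
  by (simp add: coboundaries_def)

lemma coboundaries_zero: "X \<in> Obj A \<Longrightarrow> Y \<in> Obj A \<Longrightarrow> 0 \<in> coboundaries A X Y n"
  using coboundaryI[of 0 X Y n] by (simp add: Hom_zero slot0_zero)

lemma coboundaries_add:
  assumes "X \<in> Obj A" "Y \<in> Obj A" "a \<in> coboundaries A X Y n" "b \<in> coboundaries A X Y n"
  shows "a + b \<in> coboundaries A X Y n"
proof -
  obtain h k where "h \<in> Hom A X Y (n - 1)" "k \<in> Hom A X Y (n - 1)"
    "a = mu A [Arr X Y (n - 1) h]" "b = mu A [Arr X Y (n - 1) k]"
    using assms by (auto simp: coboundaries_def)
  then show ?thesis
    using coboundaryI[of "h + k" X Y n] assms by (simp add: Hom_add slot0_add is_arr_def)
qed

lemma coboundaries_smul: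
  assumes "X \<in> Obj A" "Y \<in> Obj A" "a \<in> coboundaries A X Y n"
  shows "smul A c a \<in> coboundaries A X Y n"
proof -
  obtain h where "h \<in> Hom A X Y (n - 1)" "a = mu A [Arr X Y (n - 1) h]"
    using assms by (auto simp: coboundaries_def)
  then show ?thesis
    using coboundaryI[of "smul A c h" X Y n] assms by (simp add: Hom_smul slot0_smul is_arr_def)
qed

lemma coboundaries_minus:
  assumes "X \<in> Obj A" "Y \<in> Obj A" "a \<in> coboundaries A X Y n"
  shows "- a \<in> coboundaries A X Y n"
  using coboundaries_smul[OF assms, of "-1"] by simp

lemma coboundaries_signed:
  assumes "X \<in> Obj A" "Y \<in> Obj A" "a \<in> coboundaries A X Y n"
  shows "signed k a \<in> coboundaries A X Y n"
  using coboundaries_minus[OF assms] assms by (simp add: signed_def)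

lemma coboundaries_subset:
  assumes "X \<in> Obj A" "Y \<in> Obj A" "a \<in> coboundaries A X Y n"
  shows "a \<in> cocycles A X Y n"
proof -
  obtain h where "is_arr A (Arr X Y (n - 1) h)" "a = mu A [Arr X Y (n - 1) h]"
    using assms by (auto simp: coboundaries_def is_arr_def)
  then show ?thesis
    using mu1_closed[of "Arr X Y (n - 1) h"] mu1_mu1[of "Arr X Y (n - 1) h"]
    by (simp add: cocycles_def is_arr_def)
qed

lemma class_eqI:
  assumes "X \<in> Obj A" "Y \<in> Obj A" "f - g \<in> coboundaries A X Y n"
  shows "cohomology_class A X Y n f = cohomology_class A X Y n g"
proof -
  have *: "cohomology_class A X Y n f \<subseteq> cohomology_class A X Y n g"
    if "f - g \<in> coboundaries A X Y n" for f g
  proof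
    fix x
    assume "x \<in> cohomology_class A X Y n f"
    then obtain b where "b \<in> coboundaries A X Y n" "x = f + b"
      by (auto simp: cohomology_class_def)
    then have "x = g + ((f - g) + b)" "(f - g) + b \<in> coboundaries A X Y n"
      using coboundaries_add[OF assms(1,2) that] by auto
    then show "x \<in> cohomology_class A X Y n g"
      unfolding cohomology_class_def by blast
  qed
  have "g - f \<in> coboundaries A X Y n"
    using coboundaries_minus[OF assms] by simp
  then show ?thesis
    using * assms(3) by blast
qed

lemma class_self: "X \<in> Obj A \<Longrightarrow> Y \<in> Obj A \<Longrightarrow> f \<in> cohomology_class A X Y n f"
  using coboundaries_zero by (force simp: cohomology_class_def)

text \<open>Operations on cosets are defined as unions over representatives; for an operation that
  respects coboundaries the union collapses to its value at any representative.\<close>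

lemma UN_class:
  assumes "X \<in> Obj A" "Y \<in> Obj A" "\<And>b. b \<in> coboundaries A X Y n \<Longrightarrow> F (f + b) = F f"
  shows "(\<Union>x\<in>cohomology_class A X Y n f. F x) = F f"
proof -
  have "F x = F f" if "x \<in> cohomology_class A X Y n f" for x
    using that assms(3) by (auto simp: cohomology_class_def)
  then show ?thesis
    using class_self[OF assms(1,2)] by blast
qed

lemma cohomology_sel:
  assumes "X \<in> Obj A" "Y \<in> Obj A"
  shows "carr (cohomology A X Y n) = cohomology_class A X Y n ` cocycles A X Y n"
    and "vzero (cohomology A X Y n) = cohomology_class A X Y n 0"
    and "vadd (cohomology A X Y n) (cohomology_class A X Y n f) (cohomology_class A X Y n g) =
      cohomology_class A X Y n (f + g)"
    and "vscl (cohomology A X Y n) c (cohomology_class A X Y n f) = cohomology_class A X Y n (smul A c f)"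
proof -
  show "vadd (cohomology A X Y n) (cohomology_class A X Y n f) (cohomology_class A X Y n g) =
      cohomology_class A X Y n (f + g)"
  proof -
    have "(\<Union>x\<in>cohomology_class A X Y n f. \<Union>y\<in>cohomology_class A X Y n g. cohomology_class A X Y n (x + y)) =
      (\<Union>x\<in>cohomology_class A X Y n f. cohomology_class A X Y n (x + g))"
      using assms by (intro SUP_cong refl UN_class class_eqI) simp_all
    also have "\<dots> = cohomology_class A X Y n (f + g)"
      using assms by (intro UN_class class_eqI) simp_all
    finally show ?thesis
      by (simp add: cohomology_def)
  qed
  show "vscl (cohomology A X Y n) c (cohomology_class A X Y n f) = cohomology_class A X Y n (smul A c f)"
  proof -
    have "(\<Union>x\<in>cohomology_class A X Y n f. cohomology_class A X Y n (smul A c x)) =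
      cohomology_class A X Y n (smul A c f)"
      using assms by (intro UN_class class_eqI) (simp_all add: scale_right_distrib coboundaries_smul)
    then show ?thesis
      by (simp add: cohomology_def)
  qed
qed (simp_all add: cohomology_def)

lemma kvector_space_cohomology:
  assumes "X \<in> Obj A" "Y \<in> Obj A"
  shows "kvector_space (cohomology A X Y n)"
proof
  fix u
  assume "u \<in> carr (cohomology A X Y n)"
  then obtain f where "f \<in> cocycles A X Y n" "u = cohomology_class A X Y n f"
    using assms by (auto simp: cohomology_sel)
  then show "\<exists>v\<in>carr (cohomology A X Y n). vadd (cohomology A X Y n) u v = vzero (cohomology A X Y n)"
    using cocycles_smul[OF assms, of f n "-1"] assms
    by (intro bexI[of _ "cohomology_class A X Y n (- f)"]) (auto simp: cohomology_sel)
qed (use assms in \<open>auto simp: cohomology_sel cocycles_zero scale_right_distrib scale_left_distrib algebra_simps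
   intro!: imageI cocycles_add cocycles_smul\<close>)

lemma coh_cat_sel:
  "gobj (coh_cat A) = Obj A" "ghom (coh_cat A) = cohomology A"
  "gidn (coh_cat A) X = cohomology_class A X X 0 (idm A X)"
  by (simp_all add: coh_cat_def)

text \<open>If b = \<mu>^1(h) and g is closed, the Leibniz rule gives \<mu>^2(g, b) =
  \<mu>^1(\<mu>^2(g, h)) up to sign.\<close>

lemma mu2_coboundary_left:
  assumes "X \<in> Obj A" "Y \<in> Obj A" "Z \<in> Obj A" "b \<in> coboundaries A X Y m" "g \<in> cocycles A Y Z n"
  shows "mu A [Arr X Y m b, Arr Y Z n g] \<in> coboundaries A X Z (n + m)"
proof -
  obtain h where h: "is_arr A (Arr X Y (m - 1) h)" "b = mu A [Arr X Y (m - 1) h]"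
    using assms by (auto simp: coboundaries_def is_arr_def)
  have g: "is_arr A (Arr Y Z n g)" "mu A [Arr Y Z n g] = 0"
    using cocycles_arr assms by blast+
  have "mu A [Arr X Z (n + m - 1) (mu A [Arr X Y (m - 1) h, Arr Y Z n g])] = - mu A [Arr X Y m b, Arr Y Z n g]"
    using mu1_mu2[OF h(1) g(1)] g(2) h(2) slot2_zero[OF h(1) assms(3), of "n + 1"] by (simp add: algebra_simps)
  moreover have "mu A [Arr X Y (m - 1) h, Arr Y Z n g] \<in> Hom A X Z (n + m - 1)"
    using mu2_closed[OF h(1) g(1)] by (simp add: is_arr_def algebra_simps)
  ultimately show ?thesis
    using coboundaryI[of "mu A [Arr X Y (m - 1) h, Arr Y Z n g]" X Z "n + m"]
      coboundaries_minus[OF assms(1,3), of "- mu A [Arr X Y m b, Arr Y Z n g]"] by simp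
qed

lemma mu2_coboundary_right:
  assumes "X \<in> Obj A" "Y \<in> Obj A" "Z \<in> Obj A" "f \<in> cocycles A X Y m" "b \<in> coboundaries A Y Z n"
  shows "mu A [Arr X Y m f, Arr Y Z n b] \<in> coboundaries A X Z (n + m)"
proof -
  obtain h where h: "is_arr A (Arr Y Z (n - 1) h)" "b = mu A [Arr Y Z (n - 1) h]"
    using assms by (auto simp: coboundaries_def is_arr_def)
  have f: "is_arr A (Arr X Y m f)" "mu A [Arr X Y m f] = 0"
    using cocycles_arr assms by blast+
  have "mu A [Arr X Z (n + m - 1) (mu A [Arr X Y m f, Arr Y Z (n - 1) h])] =
      - signed (m - 1) (mu A [Arr X Y m f, Arr Y Z n b])"
    using mu1_mu2[OF f(1) h(1)] f(2) h(2) slot1_zero[OF h(1) assms(1), of "m + 1"]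
    by (simp add: algebra_simps eq_neg_iff_add_eq_0)
  moreover have "mu A [Arr X Y m f, Arr Y Z (n - 1) h] \<in> Hom A X Z (n + m - 1)"
    using mu2_closed[OF f(1) h(1)] by (simp add: is_arr_def algebra_simps)
  ultimately have "- signed (m - 1) (mu A [Arr X Y m f, Arr Y Z n b]) \<in> coboundaries A X Z (n + m)"
    using coboundaryI[of "mu A [Arr X Y m f, Arr Y Z (n - 1) h]" X Z "n + m"] by simp
  from coboundaries_signed[OF assms(1,3) coboundaries_minus[OF assms(1,3) this], of "m - 1"] show ?thesis
    by (simp add: signed_signed) (simp add: signed_def)
qed

lemma cocycles_shift: "f \<in> cocycles A X Y n \<Longrightarrow> b \<in> coboundaries A X Y n \<Longrightarrow> X \<in> Obj A \<Longrightarrow> Y \<in> Obj A \<Longrightarrow>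
  f + b \<in> cocycles A X Y n"
  using coboundaries_subset cocycles_add by blast

lemma gcmp_class:
  assumes "X \<in> Obj A" "Y \<in> Obj A" "Z \<in> Obj A" "f \<in> cocycles A X Y m" "g \<in> cocycles A Y Z n"
  shows "gcmp (coh_cat A) X Y Z n m (cohomology_class A Y Z n g) (cohomology_class A X Y m f) =
    cohomology_class A X Z (n + m) (signed m (mu A [Arr X Y m f, Arr Y Z n g]))"
proof -
  have 1: "cohomology_class A X Z (n + m) (signed m (mu A [Arr X Y m (f + b), Arr Y Z n g])) =
      cohomology_class A X Z (n + m) (signed m (mu A [Arr X Y m f, Arr Y Z n g]))"
    if "b \<in> coboundaries A X Y m" "g \<in> cocycles A Y Z n" for b g
  proof (rule class_eqI[OF assms(1,3)])
    have "mu A [Arr X Y m (f + b), Arr Y Z n g] = mu A [Arr X Y m f, Arr Y Z n g] + mu A [Arr X Y m b, Arr Y Z n g]"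
      using that assms cocycles_arr coboundaries_subset by (intro slot1_add) auto
    then show "signed m (mu A [Arr X Y m (f + b), Arr Y Z n g]) - signed m (mu A [Arr X Y m f, Arr Y Z n g])
      \<in> coboundaries A X Z (n + m)"
      using coboundaries_signed[OF assms(1,3) mu2_coboundary_left[OF assms(1,2,3) that]] by (simp add: signed_add)
  qed
  have 2: "cohomology_class A X Z (n + m) (signed m (mu A [Arr X Y m f, Arr Y Z n (g + b)])) =
      cohomology_class A X Z (n + m) (signed m (mu A [Arr X Y m f, Arr Y Z n g]))"
    if "b \<in> coboundaries A Y Z n" for b
  proof (rule class_eqI[OF assms(1,3)])
    have "mu A [Arr X Y m f, Arr Y Z n (g + b)] = mu A [Arr X Y m f, Arr Y Z n g] + mu A [Arr X Y m f, Arr Y Z n b]"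
      using that assms cocycles_arr coboundaries_subset by (intro slot2_add) auto
    then show "signed m (mu A [Arr X Y m f, Arr Y Z n (g + b)]) - signed m (mu A [Arr X Y m f, Arr Y Z n g])
      \<in> coboundaries A X Z (n + m)"
      using coboundaries_signed[OF assms(1,3) mu2_coboundary_right[OF assms(1-4) that]] by (simp add: signed_add)
  qed
  have 3: "(\<Union>x\<in>cohomology_class A X Y m f. cohomology_class A X Z (n + m) (signed m (mu A [Arr X Y m x, Arr Y Z n g]))) =
      cohomology_class A X Z (n + m) (signed m (mu A [Arr X Y m f, Arr Y Z n g]))"
    if "g \<in> cocycles A Y Z n" for g
    using assms(1,2) 1 that by (intro UN_class)
  have "(\<Union>y\<in>cohomology_class A Y Z n g. \<Union>x\<in>cohomology_class A X Y m f.
      cohomology_class A X Z (n + m) (signed m (mu A [Arr X Y m x, Arr Y Z n y]))) =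
    (\<Union>x\<in>cohomology_class A X Y m f. cohomology_class A X Z (n + m) (signed m (mu A [Arr X Y m x, Arr Y Z n g])))"
    using assms by (intro UN_class) (simp_all add: 2 3 cocycles_shift)
  then show ?thesis
    using 3[OF assms(5)] by (simp add: coh_cat_def)
qed

text \<open>The relation for d = 3 on closed arguments: the terms with \<mu>^1 inside \<mu>^3
  vanish, and what is left of the associativity defect is \<mu>^1(\<mu>^3(h, g, f)) up to
  sign.\<close>

lemma mu2_assoc_coboundary:
  assumes obj: "W \<in> Obj A" "X \<in> Obj A" "Y \<in> Obj A" "Z \<in> Obj A"
    and cyc: "f \<in> cocycles A W X l" "g \<in> cocycles A X Y m" "h \<in> cocycles A Y Z n"
  shows "mu A [Arr W Y (l + m) (mu A [Arr W X l f, Arr X Y m g]), Arr Y Z n h] -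
    signed l (mu A [Arr W X l f, Arr X Z (m + n) (mu A [Arr X Y m g, Arr Y Z n h])]) \<in> coboundaries A W Z (l + m + n)"
proof -
  have arr: "is_arr A (Arr W X l f)" "is_arr A (Arr X Y m g)" "is_arr A (Arr Y Z n h)"
    "mu A [Arr W X l f] = 0" "mu A [Arr X Y m g] = 0" "mu A [Arr Y Z n h] = 0"
    using cocycles_arr cyc obj by blast+
  let ?fs = "[Arr W X l f, Arr X Y m g, Arr Y Z n h]"
  have comp: "composable A ?fs"
    using arr by (simp add: composable_iff)
  have z: "mu A [Arr W X (l + 1) 0, Arr X Y m g, Arr Y Z n h] = 0"
    "mu A [Arr W X l f, Arr X Y (m + 1) 0, Arr Y Z n h] = 0"
    "mu A [Arr W X l f, Arr X Y m g, Arr Y Z (n + 1) 0] = 0"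
    using mu.slot_zero[of "[]" W X "l + 1" "[Arr X Y m g, Arr Y Z n h]"]
      mu.slot_zero[of "[Arr W X l f]" X Y "m + 1" "[Arr Y Z n h]"]
      mu.slot_zero[of "[Arr W X l f, Arr X Y m g]" Y Z "n + 1" "[]"] arr obj
    by (simp_all add: composable_iff is_arr_def Hom_zero)
  have m3: "mu_arr A ?fs = Arr W Z (l + m + n - 1) (mu A ?fs)"
    by (simp add: mu_arr_def)
  have "mu A [Arr W Y (l + m) (mu A [Arr W X l f, Arr X Y m g]), Arr Y Z n h] +
      mu A [Arr W Z (l + m + n - 1) (mu A ?fs)] +
      signed (l - 1) (mu A [Arr W X l f, Arr X Z (m + n) (mu A [Arr X Y m g, Arr Y Z n h])]) = 0"
    using mu_relations[OF comp] arr(4-6) z m3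
    by (simp add: mu_arr_single mu_arr_pair lessThan_Suc numeral_3_eq_3 atLeastAtMostSuc_conv algebra_simps)
  moreover have "signed (l - 1) x = - signed l x" for x :: 'm
    by (simp add: signed_def)
  ultimately have eq: "mu A [Arr W Y (l + m) (mu A [Arr W X l f, Arr X Y m g]), Arr Y Z n h] -
      signed l (mu A [Arr W X l f, Arr X Z (m + n) (mu A [Arr X Y m g, Arr Y Z n h])]) =
      - mu A [Arr W Z (l + m + n - 1) (mu A ?fs)]"
    by (simp add: eq_neg_iff_add_eq_0 algebra_simps)
  have "mu A ?fs \<in> Hom A W Z (l + m + n - 1)"
    using mu_arr_closed[OF comp] unfolding m3 by (simp add: is_arr_def)
  then show ?thesis
    unfolding eq using obj by (intro coboundaries_minus coboundaryI)
qed

lemma gcategory_coh_cat: "gcategory (coh_cat A)"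
proof (rule gcategory.intro)
  show "kvector_space (ghom (coh_cat A) X Y n)" if "X \<in> gobj (coh_cat A)" "Y \<in> gobj (coh_cat A)" for X Y n
    using that by (simp add: coh_cat_sel kvector_space_cohomology)
  show "gidn (coh_cat A) X \<in> carr (ghom (coh_cat A) X X 0)" if "X \<in> gobj (coh_cat A)" for X
    using that by (simp add: coh_cat_sel cohomology_sel cocycles_idm)
next
  fix X Y Z u m n
  assume obj: "X \<in> gobj (coh_cat A)" "Y \<in> gobj (coh_cat A)" "Z \<in> gobj (coh_cat A)"
    and u: "u \<in> carr (ghom (coh_cat A) X Y m)"
  note O = obj[unfolded coh_cat_sel]
  obtain f where f: "f \<in> cocycles A X Y m" "u = cohomology_class A X Y m f"
    using u O by (auto simp: coh_cat_sel cohomology_sel)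
  show "linear_between (ghom (coh_cat A) Y Z n) (ghom (coh_cat A) X Z (n + m)) (\<lambda>v. gcmp (coh_cat A) X Y Z n m v u)"
    unfolding linear_between_def coh_cat_sel cohomology_sel[OF O(2,3)] cohomology_sel[OF O(1,3)] ball_simps f(2)
    using O f(1) cocycles_arr[OF f(1)] cocycles_arr[of _ Y Z n] cocycles_mu2[OF O f(1), of _ n]
    by (auto simp: gcmp_class cohomology_sel cocycles_add cocycles_smul slot2_add slot2_smul signed_add smul_signed
      add.commute intro!: imageI cocycles_signed)
next
  fix X Y Z v m n
  assume obj: "X \<in> gobj (coh_cat A)" "Y \<in> gobj (coh_cat A)" "Z \<in> gobj (coh_cat A)"
    and v: "v \<in> carr (ghom (coh_cat A) Y Z n)"
  note O = obj[unfolded coh_cat_sel]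
  obtain g where g: "g \<in> cocycles A Y Z n" "v = cohomology_class A Y Z n g"
    using v O by (auto simp: coh_cat_sel cohomology_sel)
  show "linear_between (ghom (coh_cat A) X Y m) (ghom (coh_cat A) X Z (n + m)) (\<lambda>u. gcmp (coh_cat A) X Y Z n m v u)"
    unfolding linear_between_def coh_cat_sel cohomology_sel[OF O(1,2)] cohomology_sel[OF O(1,3)] ball_simps g(2)
    using O g(1) cocycles_arr[OF g(1)] cocycles_arr[of _ X Y m] cocycles_mu2[OF O _ g(1), of _ m]
    by (auto simp: gcmp_class cohomology_sel cocycles_add cocycles_smul slot1_add slot1_smul signed_add smul_signed
      add.commute intro!: imageI cocycles_signed)
next
  fix X Y u m
  assume obj: "X \<in> gobj (coh_cat A)" "Y \<in> gobj (coh_cat A)" and u: "u \<in> carr (ghom (coh_cat A) X Y m)"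
  note O = obj[unfolded coh_cat_sel]
  obtain f where f: "f \<in> cocycles A X Y m" "u = cohomology_class A X Y m f"
    using u O by (auto simp: coh_cat_sel cohomology_sel)
  have "is_arr A (Arr X Y m f)"
    using cocycles_arr[OF f(1)] O by blast
  then show "gcmp (coh_cat A) X X Y m 0 u (gidn (coh_cat A) X) = u"
    "gcmp (coh_cat A) X Y Y 0 m (gidn (coh_cat A) Y) u = u"
    using mu2_idm_right[of "Arr X Y m f"] mu2_idm_left[of "Arr X Y m f"] O f
      gcmp_class[OF O(1,1,2) cocycles_idm f(1)] gcmp_class[OF O(1,2,2) f(1) cocycles_idm]
    by (simp_all add: coh_cat_sel signed_signed) (simp add: signed_def)
next
  fix W X Y Z u v w l m n
  assume obj: "W \<in> gobj (coh_cat A)" "X \<in> gobj (coh_cat A)" "Y \<in> gobj (coh_cat A)" "Z \<in> gobj (coh_cat A)"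
    and u: "u \<in> carr (ghom (coh_cat A) W X l)" and v: "v \<in> carr (ghom (coh_cat A) X Y m)"
    and w: "w \<in> carr (ghom (coh_cat A) Y Z n)"
  note O = obj[unfolded coh_cat_sel]
  obtain f g h where f: "f \<in> cocycles A W X l" "u = cohomology_class A W X l f"
    and g: "g \<in> cocycles A X Y m" "v = cohomology_class A X Y m g"
    and h: "h \<in> cocycles A Y Z n" "w = cohomology_class A Y Z n h"
    using u v w O by (auto simp: coh_cat_sel cohomology_sel)
  let ?gf = "mu A [Arr W X l f, Arr X Y m g]" and ?hg = "mu A [Arr X Y m g, Arr Y Z n h]"
  have gf: "?gf \<in> cocycles A W Y (m + l)" and hg: "?hg \<in> cocycles A X Z (n + m)"
    using cocycles_mu2[OF O(1-3) f(1) g(1)] cocycles_mu2[OF O(2-4) g(1) h(1)] by (simp_all add: add.commute)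
  have "gcmp (coh_cat A) W X Z (n + m) l (gcmp (coh_cat A) X Y Z n m w v) u =
      cohomology_class A W Z (n + m + l) (signed l (mu A [Arr W X l f, Arr X Z (n + m) (signed m ?hg)]))"
    unfolding f(2) g(2) h(2)
    by (simp add: gcmp_class[OF O(2-4) g(1) h(1)] gcmp_class[OF O(1,2,4) f(1) cocycles_signed[OF O(2,4) hg]])
  also have "\<dots> = cohomology_class A W Z (n + m + l) (signed (l + m) (mu A [Arr W X l f, Arr X Z (n + m) ?hg]))"
    using mu_slot_signed[of "[Arr W X l f]" X Z "n + m" ?hg "[]" m] cocycles_arr[OF f(1)] cocycles_arr[OF hg] O
    by (simp add: composable_pair signed_signed)
  also have "\<dots> = cohomology_class A W Z (n + m + l) (signed m (mu A [Arr W Y (m + l) ?gf, Arr Y Z n h]))"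
  proof (rule class_eqI[OF O(1,4)])
    \<comment> \<open>The signs in Seidel's composition turn the signed defect into the difference
      of the two composites.\<close>
    have "signed (m + 1) (mu A [Arr W Y (m + l) ?gf, Arr Y Z n h] - signed l (mu A [Arr W X l f, Arr X Z (n + m) ?hg]))
      \<in> coboundaries A W Z (n + m + l)"
      using coboundaries_signed[OF O(1,4) mu2_assoc_coboundary[OF O f(1) g(1) h(1)], of "m + 1"]
      by (simp add: algebra_simps)
    then show "signed (l + m) (mu A [Arr W X l f, Arr X Z (n + m) ?hg]) - signed m (mu A [Arr W Y (m + l) ?gf, Arr Y Z n h])
      \<in> coboundaries A W Z (n + m + l)"
      by (auto simp: signed_def algebra_simps split: if_splits)
  qed
  also have "\<dots> = cohomology_class A W Z (n + m + l)
      (signed (m + l) (mu A [Arr W Y (m + l) (signed l ?gf), Arr Y Z n h]))"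
    using mu_slot_signed[of "[]" W Y "m + l" ?gf "[Arr Y Z n h]" l] cocycles_arr[OF h(1)] cocycles_arr[OF gf] O
    by (simp add: composable_pair signed_signed) (rule arg_cong[where f = "cohomology_class A W Z (n + m + l)"], rule signed_cong, simp)
  also have "\<dots> = gcmp (coh_cat A) W Y Z n (m + l) w (gcmp (coh_cat A) W X Y m l v u)"
    unfolding f(2) g(2) h(2)
    by (simp add: gcmp_class[OF O(1-3) f(1) g(1)] gcmp_class[OF O(1,3,4) cocycles_signed[OF O(1,3) gf] h(1)] add.assoc)
  finally show "gcmp (coh_cat A) W X Z (n + m) l (gcmp (coh_cat A) X Y Z n m w v) u =
    gcmp (coh_cat A) W Y Z n (m + l) w (gcmp (coh_cat A) W X Y m l v u)" .
qed

end

section \<open>Strict functors and equivalences\<close>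

context ainf_functor
begin

lemma af_arr_sel [simp]:
  "src (af_arr F f) = afob F (src f)" "tgt (af_arr F f) = afob F (tgt f)"
  "deg (af_arr F f) = deg f" "val (af_arr F f) = afmor F f"
  by (simp_all add: af_arr_def)

lemma afmor_Hom:
  "X \<in> Obj A \<Longrightarrow> Y \<in> Obj A \<Longrightarrow> f \<in> Hom A X Y n \<Longrightarrow>
   afmor F (Arr X Y n f) \<in> Hom B (afob F X) (afob F Y) n"
  using af_arr_closed[of "Arr X Y n f"] by (simp add: is_arr_def)

lemma afmor_zero: "X \<in> Obj A \<Longrightarrow> Y \<in> Obj A \<Longrightarrow> afmor F (Arr X Y n 0) = 0"
  using afmor_add[of X Y 0 n 0] by (simp add: A.Hom_zero)

lemma afmor_minus:
  "X \<in> Obj A \<Longrightarrow> Y \<in> Obj A \<Longrightarrow> f \<in> Hom A X Y n \<Longrightarrow> afmor F (Arr X Y n (- f)) = - afmor F (Arr X Y n f)"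
  using afmor_smul[of X Y f n "-1"] by simp

lemma afmor_signed:
  "X \<in> Obj A \<Longrightarrow> Y \<in> Obj A \<Longrightarrow> f \<in> Hom A X Y n \<Longrightarrow>
   afmor F (Arr X Y n (signed k f)) = signed k (afmor F (Arr X Y n f))"
  by (simp add: signed_def afmor_minus)

lemma af_arr_Arr: "af_arr F (Arr X Y n f) = Arr (afob F X) (afob F Y) n (afmor F (Arr X Y n f))"
  by (simp add: af_arr_def)

lemma mu1_afmor:
  "is_arr A (Arr X Y n f) \<Longrightarrow> mu B [Arr (afob F X) (afob F Y) n (afmor F (Arr X Y n f))] =
    afmor F (Arr X Y (n + 1) (mu A [Arr X Y n f]))"
  using afmor_mu[of "[Arr X Y n f]"] by (simp add: A.mu_arr_single af_arr_Arr)

lemma mu2_afmor: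
  "is_arr A (Arr X Y m f) \<Longrightarrow> is_arr A (Arr Y Z n g) \<Longrightarrow>
   mu B [Arr (afob F X) (afob F Y) m (afmor F (Arr X Y m f)), Arr (afob F Y) (afob F Z) n (afmor F (Arr Y Z n g))] =
    afmor F (Arr X Z (m + n) (mu A [Arr X Y m f, Arr Y Z n g]))"
  using afmor_mu[of "[Arr X Y m f, Arr Y Z n g]"]
  by (simp add: A.mu_arr_pair af_arr_Arr composable_pair)

lemma afmor_cocycles:
  assumes "X \<in> Obj A" "Y \<in> Obj A" "f \<in> cocycles A X Y n"
  shows "afmor F (Arr X Y n f) \<in> cocycles B (afob F X) (afob F Y) n"
  using assms mu1_afmor[of X Y n f] afmor_zero[of X Y "n + 1"]
  by (simp add: cocycles_def afmor_Hom is_arr_def)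

lemma afmor_coboundaries:
  assumes "X \<in> Obj A" "Y \<in> Obj A" "b \<in> coboundaries A X Y n"
  shows "afmor F (Arr X Y n b) \<in> coboundaries B (afob F X) (afob F Y) n"
proof -
  obtain h where h: "h \<in> Hom A X Y (n - 1)" "b = mu A [Arr X Y (n - 1) h]"
    using assms(3) by (auto simp: coboundaries_def)
  then show ?thesis
    using mu1_afmor[of X Y "n - 1" h] assms(1,2) B.coboundaryI[OF afmor_Hom[OF assms(1,2) h(1)]]
    by (simp add: is_arr_def)
qed

lemma lfunctor_Z0_map: "lfunctor (Z0 A) (Z0 B) (Z0_map F)"
proof (rule lfunctor.intro[OF A.lcategory_Z0 B.lcategory_Z0], rule lfunctor_axioms.intro)
  fix X Y
  assume "X \<in> obj (Z0 A)" "Y \<in> obj (Z0 A)"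
  then have O: "X \<in> Obj A" "Y \<in> Obj A"
    by (simp_all add: A.Z0_sel)
  have "f \<in> Hom A X Y 0" if "f \<in> cocycles A X Y 0" for f
    using that by (simp add: cocycles_def)
  then show "linear_between (hom (Z0 A) X Y) (hom (Z0 B) (cfob (Z0_map F) X) (cfob (Z0_map F) Y)) (cfmor (Z0_map F) X Y)"
    using O by (simp add: linear_between_def Z0_map_def A.Z0_sel B.Z0_sel afmor_cocycles afmor_add afmor_smul)
next
  fix X Y Z f g
  assume obj: "X \<in> obj (Z0 A)" "Y \<in> obj (Z0 A)" "Z \<in> obj (Z0 A)"
    and f: "f \<in> carr (hom (Z0 A) X Y)" and g: "g \<in> carr (hom (Z0 A) Y Z)"
  have "is_arr A (Arr X Y 0 f)" "is_arr A (Arr Y Z 0 g)"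
    using A.cocycles_arr f g obj by (auto simp: A.Z0_sel)
  from mu2_afmor[OF this] show "cfmor (Z0_map F) X Z (cmp (Z0 A) X Y Z g f) =
    cmp (Z0 B) (cfob (Z0_map F) X) (cfob (Z0_map F) Y) (cfob (Z0_map F) Z)
      (cfmor (Z0_map F) Y Z g) (cfmor (Z0_map F) X Y f)"
    by (simp add: A.Z0_sel B.Z0_sel Z0_map_def)
qed (simp_all add: Z0_map_def A.Z0_sel B.Z0_sel afob_closed afmor_idm)

lemma gfmor_class:
  assumes "X \<in> Obj A" "Y \<in> Obj A" "f \<in> cocycles A X Y n"
  shows "gfmor (coh_map B F) X Y n (cohomology_class A X Y n f) =
    cohomology_class B (afob F X) (afob F Y) n (afmor F (Arr X Y n f))"
proof -
  have "(\<Union>x\<in>cohomology_class A X Y n f.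
      cohomology_class B (afob F X) (afob F Y) n (afmor F (Arr X Y n x))) =
    cohomology_class B (afob F X) (afob F Y) n (afmor F (Arr X Y n f))"
  proof (rule A.UN_class[OF assms(1,2)])
    fix b
    assume b: "b \<in> coboundaries A X Y n"
    have "b \<in> Hom A X Y n" "f \<in> Hom A X Y n"
      using A.coboundaries_subset[OF assms(1,2) b] assms(3) by (simp_all add: cocycles_def)
    then have "afmor F (Arr X Y n (f + b)) - afmor F (Arr X Y n f) \<in> coboundaries B (afob F X) (afob F Y) n"
      using afmor_coboundaries[OF assms(1,2) b] assms(1,2) by (simp add: afmor_add)
    then show "cohomology_class B (afob F X) (afob F Y) n (afmor F (Arr X Y n (f + b))) =
        cohomology_class B (afob F X) (afob F Y) n (afmor F (Arr X Y n f))"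
      by (rule B.class_eqI[OF afob_closed[OF assms(1)] afob_closed[OF assms(2)]])
  qed
  then show ?thesis
    by (simp add: coh_map_def)
qed

lemma gfob_coh_map: "gfob (coh_map B F) = afob F"
  by (simp add: coh_map_def)

lemma gfunctor_coh_map: "gfunctor (coh_cat A) (coh_cat B) (coh_map B F)"
proof (rule gfunctor.intro[OF A.gcategory_coh_cat B.gcategory_coh_cat], rule gfunctor_axioms.intro)
  fix X Y n
  assume "X \<in> gobj (coh_cat A)" "Y \<in> gobj (coh_cat A)"
  then have O: "X \<in> Obj A" "Y \<in> Obj A" "afob F X \<in> Obj B" "afob F Y \<in> Obj B"
    by (auto simp: A.coh_cat_sel afob_closed)
  have Hom: "f \<in> Hom A X Y n" if "f \<in> cocycles A X Y n" for f
    using that by (simp add: cocycles_def)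
  show "linear_between (ghom (coh_cat A) X Y n)
      (ghom (coh_cat B) (gfob (coh_map B F) X) (gfob (coh_map B F) Y) n) (gfmor (coh_map B F) X Y n)"
    unfolding linear_between_def A.coh_cat_sel B.coh_cat_sel gfob_coh_map A.cohomology_sel[OF O(1,2)] ball_simps
    using O by (auto simp: A.cohomology_sel B.cohomology_sel gfmor_class A.cocycles_add A.cocycles_smul
      afmor_add afmor_smul Hom intro!: imageI afmor_cocycles)
next
  fix X Y Z f g m n
  assume obj: "X \<in> gobj (coh_cat A)" "Y \<in> gobj (coh_cat A)" "Z \<in> gobj (coh_cat A)"
    and f: "f \<in> carr (ghom (coh_cat A) X Y m)" and g: "g \<in> carr (ghom (coh_cat A) Y Z n)"
  have O: "X \<in> Obj A" "Y \<in> Obj A" "Z \<in> Obj A" "afob F X \<in> Obj B" "afob F Y \<in> Obj B" "afob F Z \<in> Obj B"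
    using obj by (auto simp: A.coh_cat_sel afob_closed)
  obtain x y where x: "x \<in> cocycles A X Y m" "f = cohomology_class A X Y m x"
    and y: "y \<in> cocycles A Y Z n" "g = cohomology_class A Y Z n y"
    using f g O by (auto simp: A.coh_cat_sel A.cohomology_sel)
  have arr: "is_arr A (Arr X Y m x)" "is_arr A (Arr Y Z n y)"
    using A.cocycles_arr x y O by blast+
  have mu: "mu A [Arr X Y m x, Arr Y Z n y] \<in> cocycles A X Z (n + m)"
    using A.cocycles_mu2[OF O(1-3) x(1) y(1)] by (simp add: add.commute)
  have "afmor F (Arr X Z (n + m) (mu A [Arr X Y m x, Arr Y Z n y])) =
    mu B [Arr (afob F X) (afob F Y) m (afmor F (Arr X Y m x)), Arr (afob F Y) (afob F Z) n (afmor F (Arr Y Z n y))]"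
    using mu2_afmor[OF arr] by (simp add: add.commute)
  moreover have "mu A [Arr X Y m x, Arr Y Z n y] \<in> Hom A X Z (n + m)"
    using mu by (simp add: cocycles_def)
  ultimately show "gfmor (coh_map B F) X Z (n + m) (gcmp (coh_cat A) X Y Z n m g f) =
       gcmp (coh_cat B) (gfob (coh_map B F) X) (gfob (coh_map B F) Y) (gfob (coh_map B F) Z) n m
         (gfmor (coh_map B F) Y Z n g) (gfmor (coh_map B F) X Y m f)"
    using O x y mu
    by (simp add: A.gcmp_class B.gcmp_class gfmor_class gfob_coh_map afmor_cocycles A.cocycles_signed afmor_signed)
next
  fix X
  assume "X \<in> gobj (coh_cat A)"
  then show "gfmor (coh_map B F) X X 0 (gidn (coh_cat A) X) = gidn (coh_cat B) (gfob (coh_map B F) X)"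
    by (simp add: A.coh_cat_sel B.coh_cat_sel gfmor_class gfob_coh_map A.cocycles_idm afmor_idm)
qed (simp add: gfob_coh_map A.coh_cat_sel B.coh_cat_sel afob_closed)

end

section \<open>Equivalences obtained from a strict left inverse\<close>

lemma naturally_isomorphic_id:
  assumes "lcategory C" "functor_eq C H cf_id"
  shows "naturally_isomorphic C C H cf_id"
proof -
  interpret lcategory C by fact
  show ?thesis
    unfolding naturally_isomorphic_def
    using assms(2) idn_closed cmp_idn_left cmp_idn_right
    by (intro exI[of _ "idn C"]) (fastforce simp: functor_eq_def cf_id_def isomorphism_def)
qed

text \<open>A strict left inverse \<open>R\<close> of \<open>F\<close> with closed, mutually inverse
  \<eta> and \<theta> relating F R to the identity. The sign in \<open>\<eta>_natural\<close> is
  Seidel's: the composite of classes carries (-1)^|g| when \<eta> follows a morphism of degree |g|,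
  and no sign when \<eta>, of degree 0, comes before it. For morphisms of degree 0 it disappears, so
  one hypothesis serves both \<open>Z0\<close> and cohomology.\<close>

locale strict_retract = F: ainf_functor S D F + R: ainf_functor D S R
  for S :: "('k::field, 'o, 'm::ab_group_add) ainf" and D :: "('k, 'p, 'n::ab_group_add) ainf"
    and F :: "('o, 'm, 'p, 'n) afun" and R :: "('p, 'n, 'o, 'm) afun" +
  fixes \<eta> \<theta> :: "'p \<Rightarrow> 'n"
  assumes RF_ob: "X \<in> Obj S \<Longrightarrow> afob R (afob F X) = X"
    and RF_mor: "is_arr S f \<Longrightarrow> afmor R (af_arr F f) = val f"
    and \<eta>: "Y \<in> Obj D \<Longrightarrow> \<eta> Y \<in> cocycles D (afob F (afob R Y)) Y 0"
    and \<theta>: "Y \<in> Obj D \<Longrightarrow> \<theta> Y \<in> cocycles D Y (afob F (afob R Y)) 0"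
    and \<eta>_\<theta>: "Y \<in> Obj D \<Longrightarrow>
      mu D [Arr (afob F (afob R Y)) Y 0 (\<eta> Y), Arr Y (afob F (afob R Y)) 0 (\<theta> Y)] = idm D (afob F (afob R Y))"
    and \<theta>_\<eta>: "Y \<in> Obj D \<Longrightarrow>
      mu D [Arr Y (afob F (afob R Y)) 0 (\<theta> Y), Arr (afob F (afob R Y)) Y 0 (\<eta> Y)] = idm D Y"
    and \<eta>_natural: "is_arr D g \<Longrightarrow>
      signed (deg g) (mu D [af_arr F (af_arr R g), Arr (afob F (afob R (tgt g))) (tgt g) 0 (\<eta> (tgt g))]) =
      mu D [Arr (afob F (afob R (src g))) (src g) 0 (\<eta> (src g)), g]"
begin

lemma FR_ob: "X \<in> Obj D \<Longrightarrow> afob F (afob R X) \<in> Obj D"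
  by (simp add: F.afob_closed R.afob_closed)

lemma retraction_eq: "functor_eq (Z0 S) (cf_comp (Z0_map R) (Z0_map F)) cf_id"
  using RF_ob RF_mor F.A.cocycles_arr
  by (fastforce simp: functor_eq_def cf_comp_def cf_id_def Z0_map_def F.A.Z0_sel F.af_arr_Arr)

lemma has_retraction_Z0: "has_retraction (Z0 S) (Z0 D) (Z0_map F)"
  unfolding has_retraction_def
  using F.lfunctor_Z0_map R.lfunctor_Z0_map retraction_eq by blast

lemma equivalence_Z0: "equivalence (Z0 S) (Z0 D) (Z0_map F)"
  unfolding equivalence_def
proof (intro conjI exI)
  show "lfunctor (Z0 S) (Z0 D) (Z0_map F)"
    by (rule F.lfunctor_Z0_map)
  show "lfunctor (Z0 D) (Z0 S) (Z0_map R)"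
    by (rule R.lfunctor_Z0_map)
  show "naturally_isomorphic (Z0 S) (Z0 S) (cf_comp (Z0_map R) (Z0_map F)) cf_id"
    by (rule naturally_isomorphic_id[OF F.A.lcategory_Z0 retraction_eq])
  show "naturally_isomorphic (Z0 D) (Z0 D) (cf_comp (Z0_map F) (Z0_map R)) cf_id"
    unfolding naturally_isomorphic_def
  proof (intro exI conjI ballI)
    fix X
    assume "X \<in> obj (Z0 D)"
    then show "isomorphism (Z0 D) (cfob (cf_comp (Z0_map F) (Z0_map R)) X) (cfob cf_id X) (\<eta> X)"
      using \<eta> \<theta> \<eta>_\<theta> \<theta>_\<eta>
      by (auto simp: isomorphism_def F.B.Z0_sel cf_comp_def cf_id_def Z0_map_def intro!: bexI[of _ "\<theta> X"])
  next
    fix X Y f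
    assume "X \<in> obj (Z0 D)" "Y \<in> obj (Z0 D)" "f \<in> carr (hom (Z0 D) X Y)"
    then have "is_arr D (Arr X Y 0 f)"
      using F.B.cocycles_arr by (simp add: F.B.Z0_sel)
    from \<eta>_natural[OF this]
    show "cmp (Z0 D) (cfob (cf_comp (Z0_map F) (Z0_map R)) X) (cfob (cf_comp (Z0_map F) (Z0_map R)) Y)
        (cfob cf_id Y) (\<eta> Y) (cfmor (cf_comp (Z0_map F) (Z0_map R)) X Y f) =
      cmp (Z0 D) (cfob (cf_comp (Z0_map F) (Z0_map R)) X) (cfob cf_id X) (cfob cf_id Y)
        (cfmor cf_id X Y f) (\<eta> X)"
      by (simp add: F.B.Z0_sel cf_comp_def cf_id_def Z0_map_def F.af_arr_Arr R.af_arr_Arr)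
  qed
qed

lemma gfmor_FR:
  assumes "X \<in> Obj D" "Y \<in> Obj D" "f \<in> cocycles D X Y n"
  shows "gfmor (gf_comp (coh_map D F) (coh_map S R)) X Y n (cohomology_class D X Y n f) =
    cohomology_class D (afob F (afob R X)) (afob F (afob R Y)) n (val (af_arr F (af_arr R (Arr X Y n f))))"
  using assms by (simp add: gf_comp_def R.gfmor_class F.gfmor_class R.gfob_coh_map R.afob_closed
      R.afmor_cocycles R.af_arr_Arr)

lemma gequivalence_coh: "gequivalence (coh_cat S) (coh_cat D) (coh_map D F)"
  unfolding gequivalence_def
proof (intro conjI exI)
  show "gfunctor (coh_cat S) (coh_cat D) (coh_map D F)"
    by (rule F.gfunctor_coh_map)
  show "gfunctor (coh_cat D) (coh_cat S) (coh_map S R)"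
    by (rule R.gfunctor_coh_map)
  interpret CS: gcategory "coh_cat S"
    by (rule F.A.gcategory_coh_cat)
  have RF: "gfmor (gf_comp (coh_map S R) (coh_map D F)) X Y n u = u"
    if O: "X \<in> Obj S" "Y \<in> Obj S" and u: "u \<in> carr (cohomology S X Y n)" for X Y n u
  proof -
    obtain f where f: "f \<in> cocycles S X Y n" "u = cohomology_class S X Y n f"
      using u O by (auto simp: F.A.cohomology_sel)
    then have "afmor R (Arr (afob F X) (afob F Y) n (afmor F (Arr X Y n f))) = f"
      using RF_mor[of "Arr X Y n f"] F.A.cocycles_arr[OF f(1) O] by (simp add: F.af_arr_Arr)
    then show ?thesis
      using O f by (simp add: gf_comp_def R.gfmor_class F.gfmor_class F.gfob_coh_map F.afob_closed
        F.afmor_cocycles RF_ob)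
  qed
  show "gnaturally_isomorphic (coh_cat S) (coh_cat S) (gf_comp (coh_map S R) (coh_map D F)) gf_id"
    unfolding gnaturally_isomorphic_def
  proof (intro exI conjI ballI allI)
    fix X
    assume X: "X \<in> gobj (coh_cat S)"
    then have "gfob (gf_comp (coh_map S R) (coh_map D F)) X = X"
      by (simp add: gf_comp_def F.gfob_coh_map R.gfob_coh_map F.A.coh_cat_sel RF_ob)
    then show "gisomorphism (coh_cat S) (gfob (gf_comp (coh_map S R) (coh_map D F)) X) (gfob gf_id X) (gidn (coh_cat S) X)"
      using CS.idn_closed[OF X] CS.cmp_idn_left[OF X X CS.idn_closed[OF X]]
      by (auto simp: gisomorphism_def gf_id_def)
  next
    fix X Y n u
    assume XY: "X \<in> gobj (coh_cat S)" "Y \<in> gobj (coh_cat S)" and u: "u \<in> carr (ghom (coh_cat S) X Y n)"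
    have "gfob (gf_comp (coh_map S R) (coh_map D F)) X = X" "gfob (gf_comp (coh_map S R) (coh_map D F)) Y = Y"
      using XY by (simp_all add: gf_comp_def F.gfob_coh_map R.gfob_coh_map F.A.coh_cat_sel RF_ob)
    then show "gcmp (coh_cat S) (gfob (gf_comp (coh_map S R) (coh_map D F)) X)
        (gfob (gf_comp (coh_map S R) (coh_map D F)) Y) (gfob gf_id Y) 0 n (gidn (coh_cat S) Y)
        (gfmor (gf_comp (coh_map S R) (coh_map D F)) X Y n u) =
      gcmp (coh_cat S) (gfob (gf_comp (coh_map S R) (coh_map D F)) X) (gfob gf_id X) (gfob gf_id Y) n 0
        (gfmor gf_id X Y n u) (gidn (coh_cat S) X)"
      using RF[of X Y u n] XY u CS.cmp_idn_left[OF XY u] CS.cmp_idn_right[OF XY u]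
      by (simp add: gf_id_def F.A.coh_cat_sel)
  qed
  show "gnaturally_isomorphic (coh_cat D) (coh_cat D) (gf_comp (coh_map D F) (coh_map S R)) gf_id"
    unfolding gnaturally_isomorphic_def
  proof (intro exI conjI ballI allI)
    fix X
    assume "X \<in> gobj (coh_cat D)"
    then have X: "X \<in> Obj D" "afob F (afob R X) \<in> Obj D"
      by (simp_all add: F.B.coh_cat_sel FR_ob)
    show "gisomorphism (coh_cat D) (gfob (gf_comp (coh_map D F) (coh_map S R)) X) (gfob gf_id X)
        (cohomology_class D (afob F (afob R X)) X 0 (\<eta> X))"
      unfolding gisomorphism_def
    proof (intro conjI bexI[of _ "cohomology_class D X (afob F (afob R X)) 0 (\<theta> X)"])
      show "gcmp (coh_cat D) (gfob (gf_comp (coh_map D F) (coh_map S R)) X) (gfob gf_id X)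
          (gfob (gf_comp (coh_map D F) (coh_map S R)) X) 0 0
          (cohomology_class D X (afob F (afob R X)) 0 (\<theta> X)) (cohomology_class D (afob F (afob R X)) X 0 (\<eta> X)) =
        gidn (coh_cat D) (gfob (gf_comp (coh_map D F) (coh_map S R)) X)"
        using F.B.gcmp_class[OF X(2) X(1) X(2) \<eta>[OF X(1)] \<theta>[OF X(1)]] \<eta>_\<theta>[OF X(1)]
        by (simp add: gf_comp_def gf_id_def F.gfob_coh_map R.gfob_coh_map F.B.coh_cat_sel)
      show "gcmp (coh_cat D) (gfob gf_id X) (gfob (gf_comp (coh_map D F) (coh_map S R)) X)
          (gfob gf_id X) 0 0
          (cohomology_class D (afob F (afob R X)) X 0 (\<eta> X)) (cohomology_class D X (afob F (afob R X)) 0 (\<theta> X)) =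
        gidn (coh_cat D) (gfob gf_id X)"
        using F.B.gcmp_class[OF X(1) X(2) X(1) \<theta>[OF X(1)] \<eta>[OF X(1)]] \<theta>_\<eta>[OF X(1)]
        by (simp add: gf_comp_def gf_id_def F.gfob_coh_map R.gfob_coh_map F.B.coh_cat_sel)
    qed (use X \<eta> \<theta> in \<open>simp_all add: gf_comp_def gf_id_def F.gfob_coh_map R.gfob_coh_map F.B.coh_cat_sel
        F.B.cohomology_sel\<close>)
  next
    fix X Y n u
    assume "X \<in> gobj (coh_cat D)" "Y \<in> gobj (coh_cat D)" and u: "u \<in> carr (ghom (coh_cat D) X Y n)"
    then have O: "X \<in> Obj D" "Y \<in> Obj D" "afob F (afob R X) \<in> Obj D" "afob F (afob R Y) \<in> Obj D"
      by (simp_all add: F.B.coh_cat_sel FR_ob)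
    obtain f where f: "f \<in> cocycles D X Y n" "u = cohomology_class D X Y n f"
      using u O by (auto simp: F.B.coh_cat_sel F.B.cohomology_sel)
    have arr: "is_arr D (Arr X Y n f)"
      using F.B.cocycles_arr[OF f(1)] O by blast
    have FRf: "val (af_arr F (af_arr R (Arr X Y n f))) \<in> cocycles D (afob F (afob R X)) (afob F (afob R Y)) n"
      using f(1) O by (simp add: R.af_arr_Arr F.afmor_cocycles R.afmor_cocycles R.afob_closed)
    show "gcmp (coh_cat D) (gfob (gf_comp (coh_map D F) (coh_map S R)) X)
        (gfob (gf_comp (coh_map D F) (coh_map S R)) Y) (gfob gf_id Y) 0 n
        (cohomology_class D (afob F (afob R Y)) Y 0 (\<eta> Y))
        (gfmor (gf_comp (coh_map D F) (coh_map S R)) X Y n u) =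
      gcmp (coh_cat D) (gfob (gf_comp (coh_map D F) (coh_map S R)) X) (gfob gf_id X) (gfob gf_id Y) n 0
        (gfmor gf_id X Y n u) (cohomology_class D (afob F (afob R X)) X 0 (\<eta> X))"
      using F.B.gcmp_class[OF O(3,4,2) FRf \<eta>[OF O(2)]] F.B.gcmp_class[OF O(3,1,2) \<eta>[OF O(1)] f(1)]
        gfmor_FR[OF O(1,2) f(1)] \<eta>_natural[OF arr] f(2)
      by (simp add: gf_comp_def gf_id_def F.gfob_coh_map R.gfob_coh_map F.af_arr_Arr R.af_arr_Arr)
  qed
qed

lemma quasi_equivalence_strict_retract: "quasi_equivalence S D F"
  unfolding quasi_equivalence_def using F.ainf_functor_axioms gequivalence_coh by blast

end

subsection \<open>Full subcategories\<close>

lemma full_subcategory_sel [simp]: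
  "Obj (full_subcategory A U) = Obj A \<inter> U" "Hom (full_subcategory A U) = Hom A"
  "smul (full_subcategory A U) = smul A" "mu (full_subcategory A U) = mu A"
  "idm (full_subcategory A U) = idm A"
  by (simp_all add: full_subcategory_def)

lemma is_arr_full: "is_arr (full_subcategory A U) f \<longleftrightarrow> is_arr A f \<and> src f \<in> U \<and> tgt f \<in> U"
  by (auto simp: is_arr_def)

lemma composable_full: "composable (full_subcategory A U) fs \<Longrightarrow> composable A fs"
  by (auto simp: composable_def is_arr_full)

lemma mu_arr_full [simp]: "mu_arr (full_subcategory A U) fs = mu_arr A fs"
  by (simp add: mu_arr_def)

lemma ainf_category_full:
  assumes "ainf_category A"
  shows "ainf_category (full_subcategory A U)"
proof -
  interpret ainf_category A by fact
  show ?thesis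
  proof (rule ainf_category.intro)
    fix fs
    assume "composable (full_subcategory A U) fs"
    moreover from this have "src (hd fs) \<in> U" "tgt (last fs) \<in> U"
      by (auto simp: composable_def is_arr_full)
    ultimately show "is_arr (full_subcategory A U) (mu_arr (full_subcategory A U) fs)"
      using mu_closed[OF composable_full] by (simp add: is_arr_full) (simp add: mu_arr_def)
  qed (auto simp: is_arr_full vs subspace_Hom idm_closed mu1_idm mu2_idm_right mu2_idm_left mu_add mu_smul
      mu_idm mu_relations[simplified] dest!: composable_full)
qed

lemma inclusion_sel [simp]: "afob inclusion X = X" "afmor inclusion f = val f"
  by (simp_all add: inclusion_def)

lemma af_arr_inclusion [simp]: "af_arr inclusion f = f"
  by (cases f) (simp add: af_arr_def)

lemma map_af_arr_inclusion: "map (af_arr inclusion) fs = fs"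
  by (induction fs) auto

lemma ainf_functor_inclusion:
  assumes "ainf_category A"
  shows "ainf_functor (full_subcategory A U) A inclusion"
proof (rule ainf_functor.intro[OF ainf_category_full[OF assms] assms], rule ainf_functor_axioms.intro)
  show "mu A (map (af_arr inclusion) fs) = afmor inclusion (mu_arr (full_subcategory A U) fs)" for fs
    unfolding map_af_arr_inclusion by (simp add: mu_arr_def)
qed (auto simp: is_arr_full)

section \<open>Removing the shifts\<close>

definition unshift :: "'o formal_sum \<Rightarrow> 'o formal_sum" where
  "unshift X = map (\<lambda>x. (fst x, 0)) X"

lemma unshift_simps [simp]:
  "length (unshift X) = length X"
  "i < length X \<Longrightarrow> unshift X ! i = (fst (X ! i), 0)"
  "fst ` set (unshift X) = fst ` set X"
  by (auto simp: unshift_def image_comp)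

lemma unshift_id: "\<forall>p\<in>snd ` set X. p = 0 \<Longrightarrow> unshift X = X"
  by (auto simp: unshift_def map_idI prod_eq_iff)

text \<open>
  The retraction sends \<open>s\<^sup>p\<^sub>q \<otimes> t\<^bsup>\<alpha>\<^esup> \<otimes> a\<close> to \<open>(-1)\<^bsup>p\<alpha>\<^esup> s\<^sup>0\<^sub>0 \<otimes> t\<^bsup>\<alpha> + p - q\<^esup> \<otimes> a\<close>. The sign makes it strictly compatible
  with the signs of the \<open>\<mu>\<^sup>d\<close>, see \<open>cross_shift\<close>.
\<close>

definition lshift :: "int \<Rightarrow> int \<Rightarrow> (int \<Rightarrow>\<^sub>0 'm::ab_group_add) \<Rightarrow> (int \<Rightarrow>\<^sub>0 'm)" where
  "lshift p q l = Poly_Mapping.map_key (\<lambda>\<beta>. \<beta> - (p - q)) (Poly_Mapping.mapp (\<lambda>\<alpha>. signed (p * \<alpha>)) l)"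

lemma lookup_lshift:
  "Poly_Mapping.lookup (lshift p q l) \<beta> = signed (p * (\<beta> - (p - q))) (Poly_Mapping.lookup l (\<beta> - (p - q)))"
proof -
  \<comment> \<open>Injectivity of the shift of exponents is what lets \<open>map_key\<close> act by
    reindexing.\<close>
  have "inj (\<lambda>\<beta>. \<beta> - (p - q))"
    by (simp add: inj_def)
  then show ?thesis
    by (simp add: lshift_def map_key.rep_eq lookup_mapp when_def in_keys_iff)
qed

definition mshift ::
  "'o formal_sum \<Rightarrow> 'o formal_sum \<Rightarrow> (int \<Rightarrow>\<^sub>0 'm::ab_group_add) matrix \<Rightarrow> (int \<Rightarrow>\<^sub>0 'm) matrix" where
  "mshift X Y = Poly_Mapping.mapp (\<lambda>(j, i). lshift (snd (X ! i)) (snd (Y ! j)))"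

lemma lshift_zero [simp]: "lshift p q 0 = 0"
  by (rule poly_mapping_eqI) (simp add: lookup_lshift)

lemma lshift_add: "lshift p q (l + l') = lshift p q l + lshift p q l'"
  by (rule poly_mapping_eqI) (simp add: lookup_lshift lookup_add signed_add)

lemma lshift_signed: "lshift p q (signed n l) = signed n (lshift p q l)"
  by (rule poly_mapping_eqI) (simp add: lookup_lshift lookup_signed signed_signed add.commute)

lemma lshift_single:
  "lshift p q (Poly_Mapping.single \<alpha> a) = Poly_Mapping.single (\<alpha> + (p - q)) (signed (p * \<alpha>) a)"
  by (rule poly_mapping_eqI) (auto simp: lookup_lshift lookup_single when_def)

lemma lookup_mshift:
  "Poly_Mapping.lookup (mshift X Y f) (j, i) = lshift (snd (X ! i)) (snd (Y ! j)) (Poly_Mapping.lookup f (j, i))"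
  by (simp add: mshift_def lookup_mapp when_def in_keys_iff)

lemma mshift_zero [simp]: "mshift X Y 0 = 0"
  by (rule poly_mapping_eqI) (auto simp: lookup_mshift)

lemma mshift_add: "mshift X Y (f + g) = mshift X Y f + mshift X Y g"
  by (rule poly_mapping_eqI) (auto simp: lookup_mshift lookup_add lshift_add)

lemma mshift_signed: "mshift X Y (signed n f) = signed n (mshift X Y f)"
  by (rule poly_mapping_eqI) (auto simp: lookup_mshift lookup_signed lshift_signed)

lemma mshift_single:
  "mshift X Y (Poly_Mapping.single (j, i) l) = Poly_Mapping.single (j, i) (lshift (snd (X ! i)) (snd (Y ! j)) l)"
  by (rule poly_mapping_eqI) (auto simp: lookup_mshift lookup_single when_def split: if_splits)

lemma mshift_sum: "mshift X Y (sum f S) = (\<Sum>s\<in>S. mshift X Y (f s))"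
  by (induction S rule: infinite_finite_induct) (auto simp: mshift_add)

definition ushift :: "('o formal_sum, (int \<Rightarrow>\<^sub>0 'm::ab_group_add) matrix) arr \<Rightarrow>
    ('o formal_sum, (int \<Rightarrow>\<^sub>0 'm) matrix) arr" where
  "ushift f = Arr (unshift (src f)) (unshift (tgt f)) (deg f) (mshift (src f) (tgt f) (val f))"

lemma ushift_sel [simp]:
  "src (ushift f) = unshift (src f)" "tgt (ushift f) = unshift (tgt f)" "deg (ushift f) = deg f"
  "val (ushift f) = mshift (src f) (tgt f) (val f)"
  by (simp_all add: ushift_def)

lemma ZZ_component_eq:
  "ZZ_keys.component f \<kappa> = Arr (fst (src f ! snd \<kappa>)) (fst (tgt f ! fst \<kappa>))
     (deg f - (snd (src f ! snd \<kappa>) - snd (tgt f ! fst \<kappa>))) (Poly_Mapping.lookup (val f) \<kappa>)"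
  by (cases \<kappa>) (simp only: ZZ_component entry_def fst_conv snd_conv, simp only: s_deg_def)

lemma ZZ_weight_eq:
  "ZZ_keys.weight f \<kappa> = (snd (src f ! snd \<kappa>) - snd (tgt f ! fst \<kappa>),
     deg f - (snd (src f ! snd \<kappa>) - snd (tgt f ! fst \<kappa>)) - 1)"
  by (cases \<kappa>) (simp only: ZZ_keys.weight_def prod.case fst_conv snd_conv, simp only: s_deg_def)

section \<open>Signs along chains of shifts\<close>

lemma map2_map: "map2 f (map g ts) (map h ts) = map (\<lambda>t. f (g t) (h t)) ts"
  by (induction ts) auto

lemma cross_add_left:
  "cross (map (\<lambda>t. (a t + b t, c t)) ts) = cross (map (\<lambda>t. (a t, c t)) ts) + cross (map (\<lambda>t. (b t, c t)) ts)"
  by (induction ts) (auto simp: algebra_simps comp_def)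

lemma cross_add_right:
  "cross (map (\<lambda>t. (a t, b t + c t)) ts) = cross (map (\<lambda>t. (a t, b t)) ts) + cross (map (\<lambda>t. (a t, c t)) ts)"
  by (induction ts) (auto simp: algebra_simps comp_def sum_list_addf)

lemma cross_zero: "cross (map (\<lambda>t. (0, c t)) ts) = 0"
  by (induction ts) auto

text \<open>By telescoping, p at a later position is the initial p minus all differences p - q
  before it. The left side collects the signs of the factors, \<open>p (hd ts)\<close> times the
  total exponent is the sign of the product, and the cross term is the part of the \<open>ZZ\<close>
  sign that pairs shifts with powers of t.\<close>

lemma cross_shift:
  fixes p q \<alpha> :: "'a \<Rightarrow> int"
  assumes "ts \<noteq> []" "successively (\<lambda>t t'. q t = p t') ts"
  shows "(\<Sum>t\<leftarrow>ts. p t * \<alpha> t) = p (hd ts) * (\<Sum>t\<leftarrow>ts. \<alpha> t) - cross (map (\<lambda>t. (p t - q t, \<alpha> t)) ts)"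
  using assms by (induction ts rule: induct_list012) (auto simp: algebra_simps comp_def)

text \<open>The powers of t gained by the factors add up to the power gained by their
  product.\<close>

lemma sum_list_telescope:
  fixes p q :: "'a \<Rightarrow> int"
  assumes "ts \<noteq> []" "successively (\<lambda>t t'. q t = p t') ts"
  shows "(\<Sum>t\<leftarrow>ts. p t - q t) = p (hd ts) - q (last ts)"
  using assms by (induction ts rule: induct_list012) auto

lemma (in multilinear_ainf) mu_map_signed:
  assumes "composable A (gs @ map a ts)"
  shows "mu A (gs @ map (\<lambda>t. Arr (src (a t)) (tgt (a t)) (deg (a t)) (signed (\<epsilon> t) (val (a t)))) ts) =
    signed (\<Sum>t\<leftarrow>ts. \<epsilon> t) (mu A (gs @ map a ts))"
  using assms
proof (induction ts arbitrary: gs)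
  case (Cons t ts)
  let ?a = "\<lambda>t. Arr (src (a t)) (tgt (a t)) (deg (a t)) (signed (\<epsilon> t) (val (a t)))"
  have comp: "composable A (gs @ Arr (src (a t)) (tgt (a t)) (deg (a t)) (val (a t)) # map a ts)"
    using Cons.prems by (simp add: arr_collapse)
  then have "is_arr A (?a t)"
    using composable_slot[OF comp] by (simp add: is_arr_def Hom_signed)
  then have "composable A ((gs @ [?a t]) @ map a ts)"
    using composable_replace[OF comp, of "?a t"] by simp
  then have "mu A (gs @ map ?a (t # ts)) = signed (\<Sum>t\<leftarrow>ts. \<epsilon> t) (mu A (gs @ ?a t # map a ts))"
    using Cons.IH[of "gs @ [?a t]"] by simp
  also have "\<dots> = signed (\<Sum>t\<leftarrow>t # ts. \<epsilon> t) (mu A (gs @ map a (t # ts)))"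
    using mu_slot_signed[OF comp, of "\<epsilon> t"] by (simp add: signed_signed add.commute arr_collapse)
  finally show ?case .
qed simp

locale laurent_twisted = A: ainf_category A
  for A :: "('k::field, 'o, 'm::ab_group_add) ainf"
begin

abbreviation L :: "('k, 'o, int \<Rightarrow>\<^sub>0 'm) ainf" where "L \<equiv> laurent A"
abbreviation C :: "('k, 'o formal_sum, (int \<Rightarrow>\<^sub>0 'm) matrix) ainf" where "C \<equiv> ZZ L"
abbreviation T :: "('k, ('o, int \<Rightarrow>\<^sub>0 'm) twisted, (int \<Rightarrow>\<^sub>0 'm) matrix) ainf" where "T \<equiv> Tw L"

sublocale L: ainf_category "laurent A"
  by (rule ainf_category_laurent) (rule A.ainf_category_axioms)

sublocale TW: twisting "laurent A"
  by (rule twisting.intro) (rule L.ainf_category_axioms)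

sublocale G: graded_extension "\<lambda>X i. fst (X ! i)" "\<lambda>X. {..<length X}" snd fst
    "\<lambda>X Y (j, i). s_deg X Y i j" "\<lambda>\<kappa> \<kappa>'. (fst \<kappa>', snd \<kappa>)" "\<lambda>i. (i, i)" "laurent A" "ZZ (laurent A)"
  by (rule graded_extension_ZZ) (rule L.ainf_category_axioms)

sublocale GL: graded_extension "\<lambda>X (_ :: unit). X" "\<lambda>_. UNIV" "\<lambda>_. ()" "\<lambda>_. ()"
    "\<lambda>_ _ \<alpha>. \<alpha>" "(+)" "\<lambda>_. 0" A "laurent A"
  by (rule graded_extension_laurent) (rule A.ainf_category_axioms)

section \<open>Compatibility of removing shifts with the operations of \<open>ZZ\<close>\<close>

lemma unshift_Obj: "X \<in> Obj C \<Longrightarrow> unshift X \<in> Obj C"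
  by (simp add: ZZ_sel(1))

lemma Obj_C_nth: "X \<in> Obj C \<Longrightarrow> i < length X \<Longrightarrow> fst (X ! i) \<in> Obj A"
  by (auto simp: ZZ_sel(1))

lemma entry_Hom:
  assumes "is_arr C f" "i < length (src f)" "j < length (tgt f)"
  shows "Poly_Mapping.lookup (Poly_Mapping.lookup (val f) (j, i)) \<alpha> \<in>
    Hom A (fst (src f ! i)) (fst (tgt f ! j)) (deg f - s_deg (src f) (tgt f) i j - \<alpha>)"
  using assms by (auto simp: is_arr_def ZZ_Hom split: if_splits)

lemma entry_zero:
  assumes "is_arr C f" "\<not> (i < length (src f) \<and> j < length (tgt f))"
  shows "Poly_Mapping.lookup (val f) (j, i) = 0"
  using assms by (auto simp: is_arr_def ZZ_Hom split: if_splits)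

lemma arr_CI:
  assumes "src f \<in> Obj C" "tgt f \<in> Obj C"
    and "\<And>i j \<alpha>. i < length (src f) \<Longrightarrow> j < length (tgt f) \<Longrightarrow>
      Poly_Mapping.lookup (Poly_Mapping.lookup (val f) (j, i)) \<alpha> \<in>
      Hom A (fst (src f ! i)) (fst (tgt f ! j)) (deg f - s_deg (src f) (tgt f) i j - \<alpha>)"
    and "\<And>i j. \<not> (i < length (src f) \<and> j < length (tgt f)) \<Longrightarrow> Poly_Mapping.lookup (val f) (j, i) = 0"
  shows "is_arr C f"
  using assms by (auto simp: is_arr_def ZZ_Hom)

text \<open>The degree p - q lost with the shifts is regained as a power of t, so the total degree
  and the degrees of the coefficients in \<open>A\<close> are unchanged.\<close>

lemma ushift_closed:
  assumes "is_arr C f"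
  shows "is_arr C (ushift f)"
proof (rule arr_CI)
  have obj: "src f \<in> Obj C" "tgt f \<in> Obj C"
    using assms by (auto simp: is_arr_def)
  then show "src (ushift f) \<in> Obj C" "tgt (ushift f) \<in> Obj C"
    by (simp_all add: unshift_Obj)
  show "Poly_Mapping.lookup (val (ushift f)) (j, i) = 0"
    if "\<not> (i < length (src (ushift f)) \<and> j < length (tgt (ushift f)))" for i j
    using that entry_zero[OF assms, of i j] by (simp add: lookup_mshift)
  fix i j \<alpha>
  assume ij: "i < length (src (ushift f))" "j < length (tgt (ushift f))"
  let ?s = "snd (src f ! i) - snd (tgt f ! j)"
  have "Poly_Mapping.lookup (Poly_Mapping.lookup (val f) (j, i)) (\<alpha> - ?s) \<in>
      Hom A (fst (src f ! i)) (fst (tgt f ! j)) (deg f - \<alpha>)"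
    using entry_Hom[OF assms, of i j "\<alpha> - ?s"] ij by (simp add: s_deg_def)
  then show "Poly_Mapping.lookup (Poly_Mapping.lookup (val (ushift f)) (j, i)) \<alpha> \<in>
      Hom A (fst (src (ushift f) ! i)) (fst (tgt (ushift f) ! j))
        (deg (ushift f) - s_deg (src (ushift f)) (tgt (ushift f)) i j - \<alpha>)"
    using ij Obj_C_nth obj by (simp add: lookup_mshift lookup_lshift s_deg_def A.Hom_signed)
qed

lemma walk_ushift: "walk C X fs \<Longrightarrow> walk C (unshift X) (map ushift fs)"
  by (induction fs arbitrary: X) (auto simp: ushift_closed unshift_Obj)

lemma composable_ushift: "composable C fs \<Longrightarrow> composable C (map ushift fs)"
  using walk_ushift[of "src (hd fs)" fs] by (auto simp: composable_walk hd_map)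

text \<open>Both sides are monomials with the same entry, the same power of t and the same operation
  in \<open>A\<close>, or vanish together if the keys do not form a chain. Only the sign is at
  stake: without shifts the matrix part contributes none, and the Laurent part absorbs the
  shifts.\<close>

lemma mu_ushift_monomials:
  assumes comp: "composable C (map fst ts)"
    and mono: "\<And>f \<kappa> \<alpha>. (f, \<kappa>, \<alpha>) \<in> set ts \<Longrightarrow> ZZ_keys.adm f \<kappa> \<and> Poly_Mapping.keys (val f) \<subseteq> {\<kappa>} \<and>
      Poly_Mapping.keys (Poly_Mapping.lookup (val f) \<kappa>) \<subseteq> {\<alpha>}"
  shows "mu C (map ushift (map fst ts)) =
    mshift (src (hd (map fst ts))) (tgt (last (map fst ts))) (mu C (map fst ts))"
proof -
  define kp where "kp t = fst (snd t)" for t :: "('o formal_sum, (int \<Rightarrow>\<^sub>0 'm) matrix) arr \<times> (nat \<times> nat) \<times> int"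
  define al where "al t = snd (snd t)" for t :: "('o formal_sum, (int \<Rightarrow>\<^sub>0 'm) matrix) arr \<times> (nat \<times> nat) \<times> int"
  \<comment> \<open>\<open>p\<close> and \<open>q\<close> are the shifts at the two ends of the
    entry, \<open>e\<close> is the reduced degree of the factor in \<open>A\<close>.\<close>
  define p where "p t = snd (src (fst t) ! snd (kp t))" for t
  define q where "q t = snd (tgt (fst t) ! fst (kp t))" for t
  define e where "e t = deg (fst t) - (p t - q t) - al t - 1" for t
  define K where "K t = ZZ_keys.component (fst t) (kp t)" for t
  define K' where "K' t = ZZ_keys.component (ushift (fst t)) (kp t)" for t
  let ?fs = "map fst ts" and ?\<kappa>s = "map kp ts"
  have ne: "ts \<noteq> []"
    using comp by (auto simp: composable_def)
  have mono': "ZZ_keys.adm (fst t) (kp t)" "Poly_Mapping.keys (val (fst t)) \<subseteq> {kp t}"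
    "Poly_Mapping.keys (Poly_Mapping.lookup (val (fst t)) (kp t)) \<subseteq> {al t}" if "t \<in> set ts" for t
    using mono[of "fst t" "kp t" "al t"] that by (simp_all add: kp_def al_def)
  have bd: "snd (kp t) < length (src (fst t))" "fst (kp t) < length (tgt (fst t))" if "t \<in> set ts" for t
    using mono'(1)[OF that] by (auto simp: ZZ_keys.adm_def)
  have comp': "composable C (map (\<lambda>t. ushift (fst t)) ts)"
    using composable_ushift[OF comp] by (simp add: comp_def)
  have lk: "Poly_Mapping.lookup (val (ushift (fst t))) (kp t) =
      lshift (p t) (q t) (Poly_Mapping.lookup (val (fst t)) (kp t))" if "t \<in> set ts" for t
    using lookup_mshift[of "src (fst t)" "tgt (fst t)" "val (fst t)" "fst (kp t)" "snd (kp t)"]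
    by (simp add: p_def q_def)
  have K_eq: "K t = Arr (fst (src (fst t) ! snd (kp t))) (fst (tgt (fst t) ! fst (kp t)))
      (deg (fst t) - (p t - q t)) (Poly_Mapping.lookup (val (fst t)) (kp t))" for t
    unfolding K_def ZZ_component_eq p_def q_def ..
  have K'_eq: "K' t = Arr (fst (src (fst t) ! snd (kp t))) (fst (tgt (fst t) ! fst (kp t)))
      (deg (fst t)) (lshift (p t) (q t) (Poly_Mapping.lookup (val (fst t)) (kp t)))" if "t \<in> set ts" for t
    unfolding K'_def ZZ_component_eq using bd[OF that] lk[OF that] by simp
  have mu1: "mu C ?fs = (if ZZ_keys.chain ?\<kappa>s then signed (cross (map (\<lambda>t. ZZ_keys.weight (fst t) (kp t)) ts))
      (Poly_Mapping.single (ZZ_keys.cmp ?\<kappa>s) (mu L (map K ts))) else 0)"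
    using G.mu_monomials[OF comp, of ?\<kappa>s] mono' by (simp add: map2_map K_def[abs_def] list_all2_conv_all_nth)
  have keys': "Poly_Mapping.keys (val (ushift (fst t))) \<subseteq> {kp t}" if "t \<in> set ts" for t
    using mono'(2)[OF that] keys_mapp_subset by (force simp: mshift_def)
  have mu2: "mu C (map (\<lambda>t. ushift (fst t)) ts) = (if ZZ_keys.chain ?\<kappa>s
      then signed (cross (map (\<lambda>t. ZZ_keys.weight (ushift (fst t)) (kp t)) ts))
      (Poly_Mapping.single (ZZ_keys.cmp ?\<kappa>s) (mu L (map K' ts))) else 0)"
    using G.mu_monomials[OF comp', of ?\<kappa>s] bd keys'
    by (simp add: map2_map K'_def[abs_def] list_all2_conv_all_nth ZZ_keys.adm_def)
  show ?thesis
  proof (cases "ZZ_keys.chain ?\<kappa>s")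
    case False
    then show ?thesis
      using mu1 mu2 by (simp add: comp_def)
  next
    case True
    have succ: "successively (\<lambda>t t'. q t = p t') ts"
      using True comp unfolding composable_iff
      by (auto simp: successively_conv_nth p_def q_def)
    have compK: "composable L (map K ts)"
      using G.components_composable[OF comp, of ?\<kappa>s] mono'(1) True
      by (simp add: map2_map K_def[abs_def] list_all2_conv_all_nth)
    have compK': "composable L (map K' ts)"
      using G.components_composable[OF comp', of ?\<kappa>s] bd True
      by (simp add: map2_map K'_def[abs_def] list_all2_conv_all_nth ZZ_keys.adm_def)
    define M where "M = mu A (map (\<lambda>t. t_coeff (K t) (al t)) ts)"
    have muK: "mu L (map K ts) = signed (cross (map (\<lambda>t. (al t, e t)) ts))
        (Poly_Mapping.single (\<Sum>t\<leftarrow>ts. al t) M)"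
    proof -
      have "mu L (map K ts) = signed (cross (map (\<lambda>t. laurent_keys.weight (K t) (al t)) ts))
        (Poly_Mapping.single (laurent_keys.cmp (map al ts)) M)"
        using GL.mu_monomials[OF compK, of "map al ts"] mono'(3)
        by (simp add: map2_map M_def laurent_component laurent_chain list_all2_conv_all_nth
          laurent_keys.adm_def K_eq)
      moreover have "laurent_keys.weight (K t) (al t) = (al t, e t)" for t
        by (simp add: laurent_keys.weight_def K_eq e_def)
      ultimately show ?thesis
        using ne by (simp add: laurent_cmp)
    qed
    have muK': "mu L (map K' ts) = signed (cross (map (\<lambda>t. (al t + (p t - q t), e t)) ts))
        (Poly_Mapping.single (\<Sum>t\<leftarrow>ts. al t + (p t - q t)) (signed (\<Sum>t\<leftarrow>ts. p t * al t) M))"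
    proof -
      have keysK': "Poly_Mapping.keys (val (K' t)) \<subseteq> {al t + (p t - q t)}" if "t \<in> set ts" for t
        using mono'(3)[OF that] by (auto simp: K'_eq[OF that] in_keys_iff lookup_lshift)
      have "mu L (map K' ts) = signed (cross (map (\<lambda>t. laurent_keys.weight (K' t) (al t + (p t - q t))) ts))
        (Poly_Mapping.single (laurent_keys.cmp (map (\<lambda>t. al t + (p t - q t)) ts))
          (mu A (map (\<lambda>t. t_coeff (K' t) (al t + (p t - q t))) ts)))"
        using GL.mu_monomials[OF compK', of "map (\<lambda>t. al t + (p t - q t)) ts"] keysK'
        by (simp add: map2_map laurent_component laurent_chain list_all2_conv_all_nth laurent_keys.adm_def)
      moreover have "map (\<lambda>t. laurent_keys.weight (K' t) (al t + (p t - q t))) ts =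
          map (\<lambda>t. (al t + (p t - q t), e t)) ts"
        by (auto simp: laurent_keys.weight_def K'_eq e_def)
      moreover have "mu A (map (\<lambda>t. t_coeff (K' t) (al t + (p t - q t))) ts) = signed (\<Sum>t\<leftarrow>ts. p t * al t) M"
      proof -
        have "map (\<lambda>t. t_coeff (K' t) (al t + (p t - q t))) ts =
          map (\<lambda>t. Arr (src (t_coeff (K t) (al t))) (tgt (t_coeff (K t) (al t))) (deg (t_coeff (K t) (al t)))
            (signed (p t * al t) (val (t_coeff (K t) (al t))))) ts"
          by (auto simp: t_coeff_def K_eq K'_eq lookup_lshift)
        moreover have "composable A (map (\<lambda>t. t_coeff (K t) (al t)) ts)"
          using GL.components_composable[OF compK, of "map al ts"]
          by (simp add: map2_map laurent_component laurent_chain list_all2_conv_all_nth laurent_keys.adm_def)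
        ultimately show ?thesis
          using A.mu_map_signed[of "[]" "\<lambda>t. t_coeff (K t) (al t)" ts "\<lambda>t. p t * al t"]
          by (simp only: append_Nil M_def)
      qed
      ultimately show ?thesis
        using ne by (simp add: laurent_cmp)
    qed
    have cmp: "ZZ_keys.cmp ?\<kappa>s = (fst (kp (last ts)), snd (kp (hd ts)))"
      using ne by (simp add: ZZ_cmp last_map hd_map)
    have w: "map (\<lambda>t. ZZ_keys.weight (fst t) (kp t)) ts = map (\<lambda>t. (p t - q t, al t + e t)) ts"
      by (simp add: ZZ_weight_eq p_def q_def e_def)
    have w': "map (\<lambda>t. ZZ_keys.weight (ushift (fst t)) (kp t)) ts = map (\<lambda>t. (0, deg (fst t) - 1)) ts"
      using bd by (simp add: ZZ_weight_eq)
    have tele: "(\<Sum>t\<leftarrow>ts. al t + (p t - q t)) = (\<Sum>t\<leftarrow>ts. al t) + (p (hd ts) - q (last ts))"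
      using sum_list_telescope[OF ne succ] by (simp add: sum_list_addf)
    have P: "snd (src (hd ?fs) ! snd (kp (hd ts))) = p (hd ts)" "snd (tgt (last ?fs) ! fst (kp (last ts))) = q (last ts)"
      using ne by (simp_all add: p_def q_def hd_map last_map)
    \<comment> \<open>Expanding both exponents bilinearly and applying \<open>cross_shift\<close>
      leaves an even multiple of a \<open>cross\<close> term.\<close>
    have sign: "signed (cross (map (\<lambda>t. (al t + (p t - q t), e t)) ts) + (\<Sum>t\<leftarrow>ts. p t * al t)) M =
      signed (cross (map (\<lambda>t. (p t - q t, al t + e t)) ts) + (cross (map (\<lambda>t. (al t, e t)) ts) +
        p (hd ts) * (\<Sum>t\<leftarrow>ts. al t))) M"
      by (rule signed_cong) (simp add: cross_add_left cross_add_right cross_shift[OF ne succ])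
    show ?thesis
      using mu1 mu2 True ne
      by (simp add: comp_def w w' cross_zero muK muK' cmp tele mshift_signed mshift_single P
        lshift_signed lshift_single sign signed_signed flip: single_signed) (simp only: ac_simps)
  qed
qed

text \<open>Monomials here have one matrix entry and one power of t in it, so morphisms are
  decomposed along both kinds of keys at once.\<close>

lemma mu_ushift:
  assumes "composable C fs"
  shows "mu C (map ushift fs) = mshift (src (hd fs)) (tgt (last fs)) (mu C fs)"
proof (rule TW.C.slot_additive_eqI[where E = "\<lambda>fs. mu C (map ushift fs)"
    and E' = "\<lambda>fs. mshift (src (hd fs)) (tgt (last fs)) (mu C fs)"
    and G = "\<lambda>f. \<exists>\<kappa> \<alpha>. ZZ_keys.adm f \<kappa> \<and> Poly_Mapping.keys (val f) \<subseteq> {\<kappa>} \<and>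
      Poly_Mapping.keys (Poly_Mapping.lookup (val f) \<kappa>) \<subseteq> {\<alpha>}"])
  show "composable C fs"
    by (rule assms)
next
  show "slot_additive C (\<lambda>fs. mu C (map ushift fs))"
  proof
    fix fs gs X Y n a b
    assume comp: "composable C (fs @ Arr X Y n a # gs)" and b: "is_arr C (Arr X Y n b)"
    have 1: "composable C (map ushift fs @ Arr (unshift X) (unshift Y) n (mshift X Y a) # map ushift gs)"
      using composable_ushift[OF comp] by (simp add: ushift_def)
    have 2: "mshift X Y b \<in> Hom C (unshift X) (unshift Y) n"
      using ushift_closed[OF b] by (simp add: is_arr_def)
    show "mu C (map ushift (fs @ Arr X Y n (a + b) # gs)) =
        mu C (map ushift (fs @ Arr X Y n a # gs)) + mu C (map ushift (fs @ Arr X Y n b # gs))"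
      using TW.C.mu_slot_add[OF 1 2] by (simp add: ushift_def mshift_add)
  qed
  show "slot_additive C (\<lambda>fs. mshift (src (hd fs)) (tgt (last fs)) (mu C fs))"
  proof
    fix fs gs X Y n a b
    assume comp: "composable C (fs @ Arr X Y n a # gs)" and "is_arr C (Arr X Y n b)"
    then have b: "b \<in> Hom C X Y n"
      by (simp add: is_arr_def)
    have ends: "src (hd (fs @ Arr X Y n c # gs)) = (if fs = [] then X else src (hd fs))"
      "tgt (last (fs @ Arr X Y n c # gs)) = (if gs = [] then Y else tgt (last gs))" for c
      by auto
    show "mshift (src (hd (fs @ Arr X Y n (a + b) # gs))) (tgt (last (fs @ Arr X Y n (a + b) # gs)))
          (mu C (fs @ Arr X Y n (a + b) # gs)) =
        mshift (src (hd (fs @ Arr X Y n a # gs))) (tgt (last (fs @ Arr X Y n a # gs))) (mu C (fs @ Arr X Y n a # gs)) +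
        mshift (src (hd (fs @ Arr X Y n b # gs))) (tgt (last (fs @ Arr X Y n b # gs))) (mu C (fs @ Arr X Y n b # gs))"
      unfolding ends TW.C.mu_slot_add[OF comp b] mshift_add ..
  qed
next
  fix f
  assume f: "is_arr C f"
  define S where "S = (SIGMA \<kappa>:Poly_Mapping.keys (val f). Poly_Mapping.keys (Poly_Mapping.lookup (val f) \<kappa>))"
  define a where "a = (\<lambda>(\<kappa>, \<alpha>). Poly_Mapping.single \<kappa> (Poly_Mapping.single \<alpha> (Poly_Mapping.lookup (Poly_Mapping.lookup (val f) \<kappa>) \<alpha>)))"
  have obj: "src f \<in> Obj C" "tgt f \<in> Obj C"
    using f by (auto simp: is_arr_def)
  have "val f = sum a S"
  proof -
    have dec: "Poly_Mapping.single \<kappa> l = (\<Sum>\<alpha>\<in>Poly_Mapping.keys l. Poly_Mapping.single \<kappa> (Poly_Mapping.single \<alpha> (Poly_Mapping.lookup l \<alpha>)))"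
      for \<kappa> :: "nat \<times> nat" and l :: "int \<Rightarrow>\<^sub>0 'm"
      by (rule poly_mapping_eqI) (simp add: lookup_sum lookup_single when_def sum_single_keys)
    have "val f = (\<Sum>\<kappa>\<in>Poly_Mapping.keys (val f). Poly_Mapping.single \<kappa> (Poly_Mapping.lookup (val f) \<kappa>))"
      by (rule sum_single_keys[symmetric])
    also have "\<dots> = (\<Sum>\<kappa>\<in>Poly_Mapping.keys (val f). \<Sum>\<alpha>\<in>Poly_Mapping.keys (Poly_Mapping.lookup (val f) \<kappa>). a (\<kappa>, \<alpha>))"
      unfolding a_def prod.case by (rule sum.cong[OF refl dec])
    also have "\<dots> = sum a S"
      unfolding S_def by (simp add: sum.Sigma)
    finally show ?thesis .
  qed
  moreover have "is_arr C (Arr (src f) (tgt f) (deg f) (a s)) \<and>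
     (\<exists>\<kappa> \<alpha>. ZZ_keys.adm (Arr (src f) (tgt f) (deg f) (a s)) \<kappa> \<and> Poly_Mapping.keys (a s) \<subseteq> {\<kappa>} \<and>
      Poly_Mapping.keys (Poly_Mapping.lookup (a s) \<kappa>) \<subseteq> {\<alpha>})" if sS: "s \<in> S" for s
  proof -
    obtain j i \<alpha> where s: "s = ((j, i), \<alpha>)" "(j, i) \<in> Poly_Mapping.keys (val f)"
      using sS by (cases s) (auto simp: S_def)
    then have ij: "i < length (src f)" "j < length (tgt f)"
      using G.is_arr_adm[OF f] by (auto simp: ZZ_keys.adm_def)
    have "is_arr C (Arr (src f) (tgt f) (deg f) (a s))"
      using obj ij entry_Hom[OF f ij, of \<alpha>] Obj_C_nth
      by (intro arr_CI) (auto simp: a_def s(1) lookup_single when_def A.Hom_zero)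
    moreover have "ZZ_keys.adm (Arr (src f) (tgt f) (deg f) (a s)) (j, i)"
      using ij by (simp add: ZZ_keys.adm_def)
    moreover have "Poly_Mapping.keys (a s) \<subseteq> {(j, i)}" "Poly_Mapping.keys (Poly_Mapping.lookup (a s) (j, i)) \<subseteq> {\<alpha>}"
      by (auto simp: a_def s(1))
    ultimately show ?thesis
      by blast
  qed
  ultimately show "\<exists>(S :: ((nat \<times> nat) \<times> int) set) a. finite S \<and> val f = sum a S \<and>
     (\<forall>s\<in>S. is_arr C (Arr (src f) (tgt f) (deg f) (a s)) \<and>
       (\<exists>\<kappa> \<alpha>. ZZ_keys.adm (Arr (src f) (tgt f) (deg f) (a s)) \<kappa> \<and>
         Poly_Mapping.keys (val (Arr (src f) (tgt f) (deg f) (a s))) \<subseteq> {\<kappa>} \<and>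
         Poly_Mapping.keys (Poly_Mapping.lookup (val (Arr (src f) (tgt f) (deg f) (a s))) \<kappa>) \<subseteq> {\<alpha>}))"
    by (intro exI[of _ S] exI[of _ a]) (auto simp: S_def)
next
  fix fs
  assume comp: "composable C fs" and "\<forall>f\<in>set fs. \<exists>\<kappa> \<alpha>. ZZ_keys.adm f \<kappa> \<and> Poly_Mapping.keys (val f) \<subseteq> {\<kappa>} \<and>
      Poly_Mapping.keys (Poly_Mapping.lookup (val f) \<kappa>) \<subseteq> {\<alpha>}"
  then obtain k a where ka: "\<And>f. f \<in> set fs \<Longrightarrow> ZZ_keys.adm f (k f) \<and> Poly_Mapping.keys (val f) \<subseteq> {k f} \<and>
      Poly_Mapping.keys (Poly_Mapping.lookup (val f) (k f)) \<subseteq> {a f}"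
    by metis
  have fs: "map fst (map (\<lambda>f. (f, k f, a f)) fs) = fs"
    by (simp add: comp_def)
  show "mu C (map ushift fs) = mshift (src (hd fs)) (tgt (last fs)) (mu C fs)"
  proof -
    have "ZZ_keys.adm f \<kappa> \<and> Poly_Mapping.keys (val f) \<subseteq> {\<kappa>} \<and>
        Poly_Mapping.keys (Poly_Mapping.lookup (val f) \<kappa>) \<subseteq> {\<alpha>}"
      if "(f, \<kappa>, \<alpha>) \<in> set (map (\<lambda>f. (f, k f, a f)) fs)" for f \<kappa> \<alpha>
      using that ka by auto
    then show ?thesis
      using mu_ushift_monomials[of "map (\<lambda>f. (f, k f, a f)) fs"] comp unfolding fs by blast
  qed
qed

subsection \<open>The retraction on twisted complexes\<close>

definition retract_ob :: "('o, int \<Rightarrow>\<^sub>0 'm) twisted \<Rightarrow> ('o, int \<Rightarrow>\<^sub>0 'm) twisted" where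
  "retract_ob X = (unshift (fst X), mshift (fst X) (fst X) (snd X))"

definition retract :: "(('o, int \<Rightarrow>\<^sub>0 'm) twisted, (int \<Rightarrow>\<^sub>0 'm) matrix,
    ('o, int \<Rightarrow>\<^sub>0 'm) twisted, (int \<Rightarrow>\<^sub>0 'm) matrix) afun" where
  "retract = \<lparr>afob = retract_ob, afmor = (\<lambda>f. mshift (fst (src f)) (fst (tgt f)) (val f))\<rparr>"

lemma af_arr_retract:
  "src (af_arr retract f) = retract_ob (src f)" "tgt (af_arr retract f) = retract_ob (tgt f)"
  by (simp_all add: af_arr_def retract_def)

lemma tw_diff_retract: "tw_diff (retract_ob X) = ushift (tw_diff X)"
  by (simp add: tw_diff_def retract_ob_def ushift_def)

lemma tw_forget_retract: "tw_forget (af_arr retract f) = ushift (tw_forget f)"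
  by (simp add: tw_forget_def af_arr_def retract_def retract_ob_def ushift_def)

lemma mshift_Sum_any:
  assumes "finite {x. g x \<noteq> 0}"
  shows "mshift X Y (Sum_any g) = Sum_any (\<lambda>x. mshift X Y (g x))"
proof -
  have "Sum_any (\<lambda>x. mshift X Y (g x)) = (\<Sum>x\<in>{x. g x \<noteq> 0}. mshift X Y (g x))"
    using assms by (intro Sum_any.expand_superset) auto
  then show ?thesis
    by (simp add: Sum_any.expand_set mshift_sum)
qed

text \<open>Zero entries stay zero, so the same filtration shows triangularity, and the
  Maurer-Cartan sum is transported term by term by \<open>mu_ushift\<close>.\<close>

lemma retract_ob_closed:
  assumes X: "X \<in> Obj T"
  shows "retract_ob X \<in> Obj T"
proof -
  have arr: "is_arr C (tw_diff X)"
    using X by (rule is_arr_tw_diff)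
  then have arr': "is_arr C (tw_diff (retract_ob X))"
    unfolding tw_diff_retract by (rule ushift_closed)
  have slt: "strictly_lower_triangular (fst X) (snd X)"
    using X by (auto simp: Tw_sel(1))
  have "strictly_lower_triangular (fst (retract_ob X)) (snd (retract_ob X))"
  proof -
    have "Poly_Mapping.lookup (snd X) (j, i) = 0 \<Longrightarrow> Poly_Mapping.lookup (snd (retract_ob X)) (j, i) = 0" for i j
      by (simp add: retract_ob_def lookup_mshift)
    moreover have "length (fst (retract_ob X)) = length (fst X)"
      by (simp add: retract_ob_def)
    ultimately show ?thesis
      using slt unfolding strictly_lower_triangular_def by metis
  qed
  moreover have "Sum_any (\<lambda>d. if d > 0 then mu C (replicate d (tw_diff (retract_ob X))) else 0) = 0"
  proof -
    have "walk T X []"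
      using X by simp
    then obtain B where "TW.vanishing B X []"
      by (rule TW.vanishing_obtain)
    then have fin: "finite {d. (if d > 0 then mu C (replicate d (tw_diff X)) else 0) \<noteq> 0}"
      using finite_subset[OF TW.maurer_cartan_support[OF X]] by blast
    have mu: "mu C (replicate d (tw_diff (retract_ob X))) =
        mshift (fst X) (fst X) (mu C (replicate d (tw_diff X)))" if "d > 0" for d
    proof -
      have "walk C (fst X) (realize X (replicate d None))"
        using X by (intro walk_realize) simp
      then have "composable C (replicate d (tw_diff X))"
        using that by (intro walk_composable) auto
      from mu_ushift[OF this] show ?thesis
        using that by (simp add: tw_diff_retract)
    qed
    have "Sum_any (\<lambda>d. if d > 0 then mu C (replicate d (tw_diff (retract_ob X))) else 0) =
        Sum_any (\<lambda>d. mshift (fst X) (fst X) (if d > 0 then mu C (replicate d (tw_diff X)) else 0))"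
      by (rule Sum_any.cong) (simp add: mu)
    also have "\<dots> = mshift (fst X) (fst X) (Sum_any (\<lambda>d. if d > 0 then mu C (replicate d (tw_diff X)) else 0))"
      by (rule mshift_Sum_any[OF fin, symmetric])
    also have "\<dots> = 0"
      using X by (auto simp: Tw_sel(1))
    finally show ?thesis .
  qed
  ultimately show ?thesis
    unfolding Tw_sel(1) mem_Collect_eq case_prod_unfold prod.collapse using arr' by (simp add: is_arr_def)
qed

lemma tw_insert_retract:
  assumes "fs \<noteq> []"
  shows "tw_insert (map (af_arr retract) fs) ns = map ushift (tw_insert fs ns)"
proof -
  have src: "tw_diff (src (hd (map (af_arr retract) fs))) = ushift (tw_diff (src (hd fs)))"
    using assms by (simp add: hd_map af_arr_def retract_def tw_diff_retract)
  have tgt: "tw_diff (tgt (af_arr retract f)) = ushift (tw_diff (tgt f))" for f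
    by (simp add: af_arr_def retract_def tw_diff_retract)
  have "map (\<lambda>l. tw_forget (map (af_arr retract) fs ! l) #
      replicate (ns ! Suc l) (tw_diff (tgt (map (af_arr retract) fs ! l)))) [0..<length fs] =
    map (\<lambda>l. map ushift (tw_forget (fs ! l) # replicate (ns ! Suc l) (tw_diff (tgt (fs ! l))))) [0..<length fs]"
    by (rule map_cong) (simp_all add: tw_forget_retract tgt)
  then show ?thesis
    unfolding tw_insert_def src length_map
    by (simp only: map_append map_replicate map_concat map_map comp_def)
qed

text \<open>The differentials of the image objects are the images of the differentials, so the
  retraction can be applied inside each insertion term, where \<open>mu_ushift\<close> takes
  over.\<close>

lemma mu_retract:
  assumes comp: "composable T fs"
  shows "mu T (map (af_arr retract) fs) = mshift (fst (src (hd fs))) (fst (tgt (last fs))) (mu T fs)"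
proof -
  define X where "X = src (hd fs)"
  have walk: "walk T X fs" and ne: "fs \<noteq> []"
    using comp by (auto simp: composable_walk X_def)
  obtain B where B: "TW.vanishing B X fs"
    using walk by (rule TW.vanishing_obtain)
  have fin: "finite {ns. (if length ns = Suc (length fs) then mu C (tw_insert fs ns) else 0) \<noteq> 0}"
    by (rule TW.mu_Tw_words(2)[OF ne walk B])
  have mu: "mu C (tw_insert (map (af_arr retract) fs) ns) =
      mshift (fst (src (hd fs))) (fst (tgt (last fs))) (mu C (tw_insert fs ns))"
    if ns: "length ns = Suc (length fs)" for ns
  proof -
    let ?w = "interleave fs ns"
    have w: "tw_insert fs ns = realize X ?w"
      using tw_insert_realize[OF ne ns] by (simp add: X_def)
    have walk_w: "walk T X (letters ?w)" and ne_w: "?w \<noteq> []"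
      using walk ne letters_interleave[of fs ns] by auto
    have comp_w: "composable C (realize X ?w)"
      using walk_w ne_w by (rule TW.mu_realize(1))
    have "fst X = src (hd (realize X ?w))" "fst (endpoint X fs) = tgt (last (realize X ?w))"
      using last_hd_walk[OF walk_realize[OF walk_w]] ne_w by (simp_all add: endpoint_realize letters_interleave)
    then show ?thesis
      using mu_ushift[OF comp_w] last_hd_walk[OF walk ne]
      by (simp add: tw_insert_retract[OF ne] w)
  qed
  have "mu T (map (af_arr retract) fs) = Sum_any (\<lambda>ns. mshift (fst (src (hd fs))) (fst (tgt (last fs)))
      (if length ns = Suc (length fs) then mu C (tw_insert fs ns) else 0))"
    unfolding Tw_def ainf.select_convs by (rule Sum_any.cong) (simp add: mu)
  also have "\<dots> = mshift (fst (src (hd fs))) (fst (tgt (last fs))) (mu T fs)"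
    unfolding Tw_def ainf.select_convs by (rule mshift_Sum_any[OF fin, symmetric])
  finally show ?thesis .
qed

lemma lookup_idm_C:
  "X \<in> Obj C \<Longrightarrow> Poly_Mapping.lookup (idm C X) (j, i) =
    (if i < length X \<and> j = i then Poly_Mapping.single 0 (idm A (fst (X ! i))) else 0)"
  by (simp add: G.idm_B)

text \<open>The identity has exponent 0 in t and equal shifts at both ends, so it acquires neither a
  sign nor a power of t.\<close>

lemma mshift_idm:
  assumes "X \<in> Obj C"
  shows "mshift X X (idm C X) = idm C (unshift X)"
proof (rule poly_mapping_eqI)
  fix \<kappa> :: "nat \<times> nat"
  show "Poly_Mapping.lookup (mshift X X (idm C X)) \<kappa> = Poly_Mapping.lookup (idm C (unshift X)) \<kappa>"
    using assms by (cases \<kappa>) (simp add: lookup_mshift lookup_idm_C unshift_Obj lshift_single)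
qed

abbreviation S :: "('k, ('o, int \<Rightarrow>\<^sub>0 'm) twisted, (int \<Rightarrow>\<^sub>0 'm) matrix) ainf" where
  "S \<equiv> unshifted_Tw A"

lemma retract_ob_S: "X \<in> Obj T \<Longrightarrow> retract_ob X \<in> Obj S"
  using retract_ob_closed[of X]
  by (auto simp: unshifted_Tw_def retract_ob_def unshift_def)

lemma retract_closed: "is_arr T f \<Longrightarrow> is_arr S (af_arr retract f)"
  using retract_ob_S[of "src f"] retract_ob_S[of "tgt f"] ushift_closed[of "tw_forget f"]
  by (simp add: is_arr_Tw unshifted_Tw_def is_arr_full tw_forget_retract af_arr_retract case_prod_unfold)

lemma lshift_map_smul:
  "lshift p q (Poly_Mapping.map (smul A c) l) = Poly_Mapping.map (smul A c) (lshift p q l)"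
  by (rule poly_mapping_eqI) (simp add: lookup_lshift lookup_map_0 signed_def)

lemma mshift_smul: "mshift X Y (smul C c f) = smul C c (mshift X Y f)"
proof (rule poly_mapping_eqI)
  fix \<kappa> :: "nat \<times> nat"
  have "Poly_Mapping.map (smul A c) (0 :: int \<Rightarrow>\<^sub>0 'm) = 0"
    by (rule poly_mapping_eqI) (simp add: lookup_map_0)
  then show "Poly_Mapping.lookup (mshift X Y (smul C c f)) \<kappa> = Poly_Mapping.lookup (smul C c (mshift X Y f)) \<kappa>"
    by (cases \<kappa>) (simp add: lookup_mshift lookup_map_0 lshift_map_smul)
qed

lemma ainf_functor_retract: "ainf_functor T S retract"
proof (rule ainf_functor.intro)
  show "ainf_category T"
    by (rule TW.ainf_category_Tw)
  then show "ainf_category S"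
    unfolding unshifted_Tw_def by (rule ainf_category_full)
  show "ainf_functor_axioms T S retract"
  proof
    fix X
    assume X: "X \<in> Obj T"
    then show "afob retract X \<in> Obj S"
      by (simp add: retract_def retract_ob_S)
    show "afmor retract (id_arr T X) = idm S (afob retract X)"
      using mshift_idm[OF fst_Obj_Tw[OF X]] by (simp add: retract_def retract_ob_def unshifted_Tw_def)
  next
    fix fs
    assume "composable T fs"
    then show "mu S (map (af_arr retract) fs) = afmor retract (mu_arr T fs)"
      using mu_retract[of fs] by (simp add: unshifted_Tw_def retract_def mu_arr_def)
  next
    fix f
    assume "is_arr T f"
    then show "is_arr S (af_arr retract f)"
      by (rule retract_closed)
  qed (auto simp: unshifted_Tw_def retract_def mshift_add mshift_smul simp del: ZZ_sel)
qed

subsection \<open>The natural isomorphism\<close>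

text \<open>
  A diagonal matrix with entries \<open>(-1)\<^bsup>\<epsilon>\<^esup> s\<^sup>p\<^sub>q \<otimes> t\<^bsup>q - p\<^esup> \<otimes> id\<close> has degree 0 and relates formal sums that
  differ only in their shifts.
\<close>

definition diag :: "'o formal_sum \<Rightarrow> 'o formal_sum \<Rightarrow> (nat \<Rightarrow> int) \<Rightarrow> (int \<Rightarrow>\<^sub>0 'm) matrix" where
  "diag X Y \<epsilon> = (\<Sum>i<length X. Poly_Mapping.single (i, i)
     (Poly_Mapping.single (snd (Y ! i) - snd (X ! i)) (signed (\<epsilon> i) (idm A (fst (X ! i))))))"

abbreviation diag_arr where "diag_arr X Y \<epsilon> \<equiv> Arr X Y 0 (diag X Y \<epsilon>)"

lemma lookup_diag:
  "Poly_Mapping.lookup (diag X Y \<epsilon>) (j, i) = (if j = i \<and> i < length X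
     then Poly_Mapping.single (snd (Y ! i) - snd (X ! i)) (signed (\<epsilon> i) (idm A (fst (X ! i)))) else 0)"
  by (auto simp: diag_def lookup_sum lookup_single when_def intro: sum.neutral)

lemma lookup_sum_single_shift:
  fixes r :: int
  assumes "finite K"
  shows "Poly_Mapping.lookup (\<Sum>\<alpha>\<in>K. Poly_Mapping.single (r + \<alpha>) (g \<alpha>)) \<beta> = (if \<beta> - r \<in> K then g (\<beta> - r) else 0)"
proof -
  have "(r + \<alpha> = \<beta>) = (\<alpha> = \<beta> - r)" for \<alpha>
    by auto
  then show ?thesis
    using assms by (simp add: lookup_sum lookup_single when_def)
qed

text \<open>Two formal sums with the same underlying objects, so that both directions of the
  isomorphism are instances.\<close>

context
  fixes X Y :: "'o formal_sum"
  assumes X: "X \<in> Obj C" and XY: "map fst X = map fst Y"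
begin

lemma length_XY: "length Y = length X"
  using XY by (metis length_map)

lemma fst_XY: "i < length X \<Longrightarrow> fst (Y ! i) = fst (X ! i)"
  using XY length_XY by (metis nth_map)

lemma Y_Obj: "Y \<in> Obj C"
  using X XY by (simp add: ZZ_sel(1)) (metis list.set_map)

lemma diag_closed: "is_arr C (diag_arr X Y \<epsilon>)"
proof (rule arr_CI)
  fix i j \<alpha>
  assume "i < length (src (diag_arr X Y \<epsilon>))" "j < length (tgt (diag_arr X Y \<epsilon>))"
  then show "Poly_Mapping.lookup (Poly_Mapping.lookup (val (diag_arr X Y \<epsilon>)) (j, i)) \<alpha> \<in>
      Hom A (fst (src (diag_arr X Y \<epsilon>) ! i)) (fst (tgt (diag_arr X Y \<epsilon>) ! j))
        (deg (diag_arr X Y \<epsilon>) - s_deg (src (diag_arr X Y \<epsilon>)) (tgt (diag_arr X Y \<epsilon>)) i j - \<alpha>)"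
    using X fst_XY length_XY Obj_C_nth[OF X] Obj_C_nth[OF Y_Obj]
    by (auto simp: lookup_diag lookup_single when_def s_deg_def A.Hom_zero A.Hom_signed A.idm_closed)
qed (use X Y_Obj length_XY in \<open>auto simp: lookup_diag\<close>)

lemma diag_component:
  assumes "i < length X"
  shows "ZZ_keys.component (diag_arr X Y \<epsilon>) (i, i) = Arr (fst (X ! i)) (fst (X ! i)) (snd (Y ! i) - snd (X ! i))
    (Poly_Mapping.single (snd (Y ! i) - snd (X ! i)) (signed (\<epsilon> i) (idm A (fst (X ! i)))))"
  unfolding ZZ_component_eq using assms by (simp add: lookup_diag fst_XY)

lemma diag_keys: "\<kappa> \<in> Poly_Mapping.keys (diag X Y \<epsilon>) \<Longrightarrow> fst \<kappa> = snd \<kappa> \<and> snd \<kappa> < length X"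
  by (cases \<kappa>) (auto simp: in_keys_iff lookup_diag split: if_splits)

text \<open>Passing to a matrix entry and to its coefficient of t leaves a signed unit of
  \<open>A\<close>; \<open>unitlike_B\<close> climbs back through both extensions.\<close>

lemma unitlike_diag: "unitlike C (diag_arr X Y \<epsilon>)"
proof (rule G.unitlike_B[OF diag_closed])
  fix \<kappa>
  assume "\<kappa> \<in> Poly_Mapping.keys (val (diag_arr X Y \<epsilon>))"
  then obtain i where \<kappa>: "\<kappa> = (i, i)" and i: "i < length X"
    using diag_keys[of \<kappa> \<epsilon>] by (cases \<kappa>) auto
  let ?u = "ZZ_keys.component (diag_arr X Y \<epsilon>) (i, i)"
  have Xi: "fst (X ! i) \<in> Obj A"
    using Obj_C_nth[OF X i] .
  have "is_arr L ?u"
    using i length_XY by (intro G.component_closed[OF diag_closed]) (simp add: ZZ_keys.adm_def)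
  then have "unitlike L ?u"
  proof (rule GL.unitlike_B)
    fix \<alpha>
    assume "\<alpha> \<in> Poly_Mapping.keys (val ?u)"
    then have "\<alpha> = snd (Y ! i) - snd (X ! i)"
      by (auto simp: diag_component[OF i] split: if_splits)
    then have eq: "laurent_keys.component ?u \<alpha> = Arr (fst (X ! i)) (fst (X ! i)) 0 (signed (\<epsilon> i) (idm A (fst (X ! i))))"
      by (simp add: laurent_component t_coeff_def diag_component[OF i])
    show "unitlike A (laurent_keys.component ?u \<alpha>)"
      unfolding eq by (rule A.unitlike_signed[OF A.unitlike_id_arr[OF Xi]])
  qed
  then show "unitlike L (ZZ_keys.component (diag_arr X Y \<epsilon>) \<kappa>)"
    by (simp add: \<kappa>)
qed

text \<open>Let r be the power of t in the diagonal entry and s the difference of shifts of the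
  entry of \<open>f\<close>. The matrix sign has exponent -r (deg f - s - 1), the Laurent sign r
  (deg f - s - (\<beta> - r) - 1); modulo 2 their sum is r (\<beta> - r).\<close>

lemma mu_diag_left:
  assumes f: "is_arr C f" "src f = Y"
  shows "Poly_Mapping.lookup (Poly_Mapping.lookup (mu C [diag_arr X Y \<epsilon>, f]) (j, i)) \<beta> =
    signed ((snd (Y ! i) - snd (X ! i)) * (\<beta> - (snd (Y ! i) - snd (X ! i))) + \<epsilon> i)
      (Poly_Mapping.lookup (Poly_Mapping.lookup (val f) (j, i)) (\<beta> - (snd (Y ! i) - snd (X ! i))))"
proof -
  let ?d = "diag_arr X Y \<epsilon>"
  let ?r = "snd (Y ! i) - snd (X ! i)"
  let ?s = "snd (Y ! i) - snd (tgt f ! j)"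
  have comp: "composable C [?d, f]"
    using f diag_closed by (simp add: composable_pair)
  have "mu C [?d, f] = (\<Sum>\<kappa>\<in>Poly_Mapping.keys (val f).
    signed ((case (snd \<kappa>, snd \<kappa>) of (j, i) \<Rightarrow> s_deg (src ?d) (tgt ?d) i j) *
        (deg f - (case \<kappa> of (j, i) \<Rightarrow> s_deg (src f) (tgt f) i j) - 1))
      (Poly_Mapping.single (fst \<kappa>, snd (snd \<kappa>, snd \<kappa>))
        (mu L [ZZ_keys.component ?d (snd \<kappa>, snd \<kappa>), ZZ_keys.component f \<kappa>])))"
    using diag_keys length_XY by (intro G.mu_diagonal_left[OF comp]) (auto simp: prod_eq_iff)
  also have "\<dots> = (\<Sum>\<kappa>\<in>Poly_Mapping.keys (val f). Poly_Mapping.single \<kappa>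
    (signed ((case (snd \<kappa>, snd \<kappa>) of (j, i) \<Rightarrow> s_deg (src ?d) (tgt ?d) i j) *
        (deg f - (case \<kappa> of (j, i) \<Rightarrow> s_deg (src f) (tgt f) i j) - 1))
      (mu L [ZZ_keys.component ?d (snd \<kappa>, snd \<kappa>), ZZ_keys.component f \<kappa>])))"
    by (simp only: single_signed snd_conv prod.collapse)
  finally have outer: "Poly_Mapping.lookup (mu C [?d, f]) (j, i) = (if (j, i) \<in> Poly_Mapping.keys (val f)
    then signed (s_deg X Y i i * (deg f - s_deg (src f) (tgt f) i j - 1))
      (mu L [ZZ_keys.component ?d (i, i), ZZ_keys.component f (j, i)]) else 0)"
    by (simp only: lookup_sum_single[OF finite_keys] snd_conv fst_conv prod.case arr.sel)
  show ?thesis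
  proof (cases "(j, i) \<in> Poly_Mapping.keys (val f)")
    case False
    then show ?thesis
      by (simp add: outer in_keys_iff)
  next
    case True
    then have "ZZ_keys.adm f (j, i)"
      using G.is_arr_adm[OF f(1)] by blast
    then have i: "i < length X" and j: "j < length (tgt f)"
      using f(2) length_XY by (auto simp: ZZ_keys.adm_def)
    let ?u = "ZZ_keys.component ?d (i, i)" and ?g = "ZZ_keys.component f (j, i)"
    have g: "is_arr L ?g" "src ?g = fst (X ! i)" "deg ?g = deg f - ?s" "val ?g = Poly_Mapping.lookup (val f) (j, i)"
      using G.component_closed[OF f(1)] i j f(2) length_XY
      unfolding ZZ_component_eq by (auto simp: ZZ_keys.adm_def fst_XY)
    have u: "is_arr L ?u"
      using i length_XY by (intro G.component_closed[OF diag_closed]) (simp add: ZZ_keys.adm_def)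
    have comp': "composable L [?u, ?g]"
      using g u by (simp only: composable_pair diag_component[OF i] arr.sel)
    have mu_A: "mu A [t_coeff ?u ?r, t_coeff ?g \<alpha>] = signed (\<epsilon> i) (Poly_Mapping.lookup (val ?g) \<alpha>)" for \<alpha>
    proof -
      define h where "h = t_coeff ?g \<alpha>"
      have h: "is_arr A h" "src h = fst (X ! i)" "val h = Poly_Mapping.lookup (val ?g) \<alpha>"
        using GL.component_closed[OF g(1), of \<alpha>] g(2)
        by (simp_all only: h_def laurent_component laurent_keys.adm_def UNIV_I simp_thms t_coeff_def arr.sel)
      have u_eq: "t_coeff ?u ?r = Arr (fst (X ! i)) (fst (X ! i)) 0 (signed (\<epsilon> i) (idm A (fst (X ! i))))"
        by (simp add: diag_component[OF i] t_coeff_def)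
      have "composable A [id_arr A (fst (X ! i)), h]"
        using h A.idm_closed Obj_C_nth[OF X i] by (simp add: composable_pair is_arr_def)
      then have "mu A [t_coeff ?u ?r, h] = signed (\<epsilon> i) (mu A [id_arr A (fst (X ! i)), h])"
        unfolding u_eq using A.mu_slot_signed[of "[]"] by simp
      then show ?thesis
        using A.mu2_idm_right[OF h(1)] h by (simp add: h_def)
    qed
    \<comment> \<open>A monomial in t is diagonal over the single index of
      \<open>laurent_keys\<close>, with constant \<open>e\<close>.\<close>
    have "mu L [?u, ?g] = (\<Sum>\<alpha>\<in>Poly_Mapping.keys (val ?g). signed (?r * (deg ?g - \<alpha> - 1))
       (Poly_Mapping.single (?r + \<alpha>) (mu A [laurent_keys.component ?u ?r, laurent_keys.component ?g \<alpha>])))"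
      by (intro GL.mu_diagonal_left[OF comp', where e = "\<lambda>_. ?r"])
        (auto simp: diag_component[OF i] split: if_splits)
    also have "\<dots> = (\<Sum>\<alpha>\<in>Poly_Mapping.keys (val ?g). Poly_Mapping.single (?r + \<alpha>)
       (signed (?r * (deg ?g - \<alpha> - 1)) (signed (\<epsilon> i) (Poly_Mapping.lookup (val ?g) \<alpha>))))"
      by (simp only: single_signed laurent_component mu_A)
    finally have inner: "Poly_Mapping.lookup (mu L [?u, ?g]) \<beta> =
        signed (?r * (deg ?g - (\<beta> - ?r) - 1)) (signed (\<epsilon> i) (Poly_Mapping.lookup (val ?g) (\<beta> - ?r)))"
      by (simp only: lookup_sum_single_shift[OF finite_keys]) (simp add: in_keys_iff)
    have sd: "s_deg X Y i i = - ?r" "s_deg (src f) (tgt f) i j = ?s"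
      using f(2) by (simp_all add: s_deg_def)
    show ?thesis
      using True
      by (simp add: outer lookup_signed inner g signed_signed sd)
        (rule signed_cong, simp add: algebra_simps)
  qed
qed

text \<open>With r and s as for \<open>mu_diag_left\<close>, the exponents are s (r - 1) from the
  matrices, -(\<beta> - r) from the powers of t and deg f - s - (\<beta> - r) from the left unit
  law; modulo 2 their sum is s r + deg f.\<close>

lemma mu_diag_right:
  assumes f: "is_arr C f" "tgt f = X"
  shows "Poly_Mapping.lookup (Poly_Mapping.lookup (mu C [f, diag_arr X Y \<epsilon>]) (j, i)) \<beta> =
    signed ((snd (src f ! i) - snd (X ! j)) * (snd (Y ! j) - snd (X ! j)) + deg f + \<epsilon> j)
      (Poly_Mapping.lookup (Poly_Mapping.lookup (val f) (j, i)) (\<beta> - (snd (Y ! j) - snd (X ! j))))"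
proof -
  let ?d = "diag_arr X Y \<epsilon>"
  let ?r = "snd (Y ! j) - snd (X ! j)"
  let ?s = "snd (src f ! i) - snd (X ! j)"
  have comp: "composable C [f, ?d]"
    using f diag_closed by (simp add: composable_pair)
  have "mu C [f, ?d] = (\<Sum>\<kappa>\<in>Poly_Mapping.keys (val f).
    signed ((case \<kappa> of (j, i) \<Rightarrow> s_deg (src f) (tgt f) i j) *
        (deg ?d - (case (fst \<kappa>, fst \<kappa>) of (j, i) \<Rightarrow> s_deg (src ?d) (tgt ?d) i j) - 1))
      (Poly_Mapping.single (fst (fst \<kappa>, fst \<kappa>), snd \<kappa>)
        (mu L [ZZ_keys.component f \<kappa>, ZZ_keys.component ?d (fst \<kappa>, fst \<kappa>)])))"
    using diag_keys length_XY by (intro G.mu_diagonal_right[OF comp]) (auto simp: prod_eq_iff)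
  also have "\<dots> = (\<Sum>\<kappa>\<in>Poly_Mapping.keys (val f). Poly_Mapping.single \<kappa>
    (signed ((case \<kappa> of (j, i) \<Rightarrow> s_deg (src f) (tgt f) i j) *
        (deg ?d - (case (fst \<kappa>, fst \<kappa>) of (j, i) \<Rightarrow> s_deg (src ?d) (tgt ?d) i j) - 1))
      (mu L [ZZ_keys.component f \<kappa>, ZZ_keys.component ?d (fst \<kappa>, fst \<kappa>)])))"
    by (simp only: single_signed fst_conv prod.collapse)
  finally have outer: "Poly_Mapping.lookup (mu C [f, ?d]) (j, i) = (if (j, i) \<in> Poly_Mapping.keys (val f)
    then signed (s_deg (src f) (tgt f) i j * (0 - s_deg X Y j j - 1))
      (mu L [ZZ_keys.component f (j, i), ZZ_keys.component ?d (j, j)]) else 0)"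
    by (simp only: lookup_sum_single[OF finite_keys] snd_conv fst_conv prod.case arr.sel)
  show ?thesis
  proof (cases "(j, i) \<in> Poly_Mapping.keys (val f)")
    case False
    then show ?thesis
      by (simp add: outer in_keys_iff)
  next
    case True
    then have "ZZ_keys.adm f (j, i)"
      using G.is_arr_adm[OF f(1)] by blast
    then have i: "i < length (src f)" and j: "j < length X"
      using f(2) length_XY by (auto simp: ZZ_keys.adm_def)
    let ?u = "ZZ_keys.component ?d (j, j)" and ?g = "ZZ_keys.component f (j, i)"
    have g: "is_arr L ?g" "tgt ?g = fst (X ! j)" "deg ?g = deg f - ?s" "val ?g = Poly_Mapping.lookup (val f) (j, i)"
      using G.component_closed[OF f(1)] i j f(2)
      unfolding ZZ_component_eq by (auto simp: ZZ_keys.adm_def)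
    have u: "is_arr L ?u"
      using j length_XY by (intro G.component_closed[OF diag_closed]) (simp add: ZZ_keys.adm_def)
    have comp': "composable L [?g, ?u]"
      using g u by (simp only: composable_pair diag_component[OF j] arr.sel)
    have mu_A: "mu A [t_coeff ?g \<alpha>, t_coeff ?u ?r] = signed (deg ?g - \<alpha> + \<epsilon> j) (Poly_Mapping.lookup (val ?g) \<alpha>)" for \<alpha>
    proof -
      define h where "h = t_coeff ?g \<alpha>"
      have h: "is_arr A h" "tgt h = fst (X ! j)" "deg h = deg ?g - \<alpha>" "val h = Poly_Mapping.lookup (val ?g) \<alpha>"
        using GL.component_closed[OF g(1), of \<alpha>] g(2)
        by (simp_all only: h_def laurent_component laurent_keys.adm_def UNIV_I simp_thms t_coeff_def arr.sel)
      have u_eq: "t_coeff ?u ?r = Arr (fst (X ! j)) (fst (X ! j)) 0 (signed (\<epsilon> j) (idm A (fst (X ! j))))"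
        by (simp add: diag_component[OF j] t_coeff_def)
      have "composable A ([h] @ [id_arr A (fst (X ! j))])"
        using h A.idm_closed Obj_C_nth[OF X j] by (simp add: composable_pair is_arr_def)
      then have "mu A [h, t_coeff ?u ?r] = signed (\<epsilon> j) (mu A [h, id_arr A (fst (X ! j))])"
        unfolding u_eq using A.mu_slot_signed[of "[h]" _ _ _ _ "[]"] by simp
      then show ?thesis
        using A.mu2_idm_left[OF h(1)] h unfolding h_def[symmetric] by (simp add: signed_signed add.commute)
    qed
    have "mu L [?g, ?u] = (\<Sum>\<alpha>\<in>Poly_Mapping.keys (val ?g). signed (\<alpha> * (deg ?u - ?r - 1))
       (Poly_Mapping.single (\<alpha> + ?r) (mu A [laurent_keys.component ?g \<alpha>, laurent_keys.component ?u ?r])))"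
      by (intro GL.mu_diagonal_right[OF comp', where e = "\<lambda>_. ?r"])
        (auto simp: diag_component[OF j] split: if_splits)
    also have "\<dots> = (\<Sum>\<alpha>\<in>Poly_Mapping.keys (val ?g). Poly_Mapping.single (?r + \<alpha>)
       (signed (\<alpha> * (deg ?u - ?r - 1)) (signed (deg ?g - \<alpha> + \<epsilon> j) (Poly_Mapping.lookup (val ?g) \<alpha>))))"
      by (simp only: single_signed laurent_component mu_A add.commute)
    finally have inner: "Poly_Mapping.lookup (mu L [?g, ?u]) \<beta> =
        signed ((\<beta> - ?r) * (deg ?u - ?r - 1)) (signed (deg ?g - (\<beta> - ?r) + \<epsilon> j) (Poly_Mapping.lookup (val ?g) (\<beta> - ?r)))"
      by (simp only: lookup_sum_single_shift[OF finite_keys]) (simp add: in_keys_iff)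
    have sd: "s_deg X Y j j = - ?r" "s_deg (src f) (tgt f) i j = ?s"
      using f(2) by (simp_all add: s_deg_def)
    have deg_u: "deg ?u = ?r"
      by (simp only: diag_component[OF j] arr.sel)
    show ?thesis
      using True
      by (simp add: outer lookup_signed inner g signed_signed sd deg_u)
        (rule signed_cong, simp add: algebra_simps)
  qed
qed

end

section \<open>The two isomorphisms, their naturality and their composites\<close>

lemma map_fst_unshift: "map fst (unshift X) = map fst X"
  by (simp add: unshift_def comp_def)

text \<open>Multiplying t^p with its inverse produces the sign (-1)^(p p) = (-1)^p in either order;
  \<open>theta_arr\<close> carries the sign that compensates it.\<close>

abbreviation eta_arr where "eta_arr X \<equiv> diag_arr (unshift X) X (\<lambda>_. 0)"
abbreviation theta_arr where "theta_arr X \<equiv> diag_arr X (unshift X) (\<lambda>i. snd (X ! i))"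

text \<open>The arrow \<open>f\<close> supplies the index ranges and the vanishing of its entries
  outside them; inside, matrices are compared coefficientwise in t.\<close>

lemma matrix_eqI:
  assumes "is_arr C f"
    and "\<And>i j. \<not> (i < length (src f) \<and> j < length (tgt f)) \<Longrightarrow> Poly_Mapping.lookup (val f) (j, i) = 0 \<Longrightarrow>
      Poly_Mapping.lookup M (j, i) = Poly_Mapping.lookup N (j, i)"
    and "\<And>i j \<beta>. i < length (src f) \<Longrightarrow> j < length (tgt f) \<Longrightarrow>
      Poly_Mapping.lookup (Poly_Mapping.lookup M (j, i)) \<beta> = Poly_Mapping.lookup (Poly_Mapping.lookup N (j, i)) \<beta>"
  shows "M = N"
proof (rule poly_mapping_eqI)
  fix \<kappa> :: "nat \<times> nat"
  obtain j i where \<kappa>: "\<kappa> = (j, i)"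
    by (cases \<kappa>) auto
  show "Poly_Mapping.lookup M \<kappa> = Poly_Mapping.lookup N \<kappa>"
  proof (cases "i < length (src f) \<and> j < length (tgt f)")
    case True
    then show ?thesis
      using assms(3) by (auto simp: \<kappa> intro: poly_mapping_eqI)
  next
    case False
    then show ?thesis
      using assms(2) entry_zero[OF assms(1) False] by (simp add: \<kappa>)
  qed
qed

text \<open>Composing \<open>eta_arr\<close> with \<open>f\<close> multiplies the coefficient of
  exponent \<beta> - p by the sign with exponent p (\<beta> - p), which is the sign built into
  \<open>lshift\<close>. The factor of exponent deg f undoes that of the left unit law.\<close>

lemma eta_natural:
  assumes f: "is_arr C f"
  shows "signed (deg f) (mu C [ushift f, eta_arr (tgt f)]) = mu C [eta_arr (src f), f]"
proof (rule matrix_eqI[OF f])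
  have obj: "unshift (src f) \<in> Obj C" "unshift (tgt f) \<in> Obj C"
    using f by (auto simp: is_arr_def unshift_Obj)
  note left = mu_diag_left[OF obj(1) map_fst_unshift f refl]
  note right = mu_diag_right[OF obj(2) map_fst_unshift ushift_closed[OF f] ushift_sel(2)]
  fix i j
  show "Poly_Mapping.lookup (signed (deg f) (mu C [ushift f, eta_arr (tgt f)])) (j, i) =
      Poly_Mapping.lookup (mu C [eta_arr (src f), f]) (j, i)"
    if "Poly_Mapping.lookup (val f) (j, i) = 0"
    using that by (intro poly_mapping_eqI) (simp add: lookup_signed left right lookup_mshift)
  fix \<beta>
  assume ij: "i < length (src f)" "j < length (tgt f)"
  let ?p = "snd (src f ! i)" and ?q = "snd (tgt f ! j)"
  have "\<beta> - ?q - (?p - ?q) = \<beta> - ?p"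
    by simp
  then show "Poly_Mapping.lookup (Poly_Mapping.lookup (signed (deg f) (mu C [ushift f, eta_arr (tgt f)])) (j, i)) \<beta> =
      Poly_Mapping.lookup (Poly_Mapping.lookup (mu C [eta_arr (src f), f]) (j, i)) \<beta>"
    using ij by (simp add: lookup_signed left right lookup_mshift lookup_lshift signed_signed)
      (rule signed_cong, simp)
qed

text \<open>Applied to differentials, this gives closedness of \<theta>. The sign in
  \<open>theta_arr\<close> enters with the target shift q on one side and the source shift p on the
  other; modulo 2 both exponents reduce to p q.\<close>

lemma theta_natural:
  assumes f: "is_arr C f"
  shows "signed (deg f) (mu C [f, theta_arr (tgt f)]) = mu C [theta_arr (src f), ushift f]"
proof (rule matrix_eqI[OF f])
  have obj: "src f \<in> Obj C" "tgt f \<in> Obj C"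
    using f by (auto simp: is_arr_def)
  note left = mu_diag_left[OF obj(1) map_fst_unshift[symmetric] ushift_closed[OF f] ushift_sel(1)]
  note right = mu_diag_right[OF obj(2) map_fst_unshift[symmetric] f refl]
  fix i j
  show "Poly_Mapping.lookup (signed (deg f) (mu C [f, theta_arr (tgt f)])) (j, i) =
      Poly_Mapping.lookup (mu C [theta_arr (src f), ushift f]) (j, i)"
    if "Poly_Mapping.lookup (val f) (j, i) = 0"
    using that by (intro poly_mapping_eqI) (simp add: lookup_signed left right lookup_mshift)
  fix \<beta>
  assume ij: "i < length (src f)" "j < length (tgt f)"
  let ?p = "snd (src f ! i)" and ?q = "snd (tgt f ! j)"
  have "\<beta> + ?p - (?p - ?q) = \<beta> + ?q"
    by simp
  then show "Poly_Mapping.lookup (Poly_Mapping.lookup (signed (deg f) (mu C [f, theta_arr (tgt f)])) (j, i)) \<beta> =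
      Poly_Mapping.lookup (Poly_Mapping.lookup (mu C [theta_arr (src f), ushift f]) (j, i)) \<beta>"
    using ij by (simp add: lookup_signed left right lookup_mshift lookup_lshift signed_signed)
      (rule signed_cong, simp add: algebra_simps, blast)
qed

lemma idm_arr_C: "X \<in> Obj C \<Longrightarrow> is_arr C (id_arr C X)"
  by (simp add: is_arr_def TW.C.idm_closed)

lemma eta_theta:
  assumes X: "X \<in> Obj C"
  shows "mu C [eta_arr X, theta_arr X] = idm C (unshift X)"
    and "mu C [theta_arr X, eta_arr X] = idm C X"
proof -
  note obj = X unshift_Obj[OF X]
  note left = mu_diag_left[OF obj(2) map_fst_unshift diag_closed[OF X map_fst_unshift[symmetric]], simplified]
    mu_diag_left[OF obj(1) map_fst_unshift[symmetric] diag_closed[OF obj(2) map_fst_unshift], simplified]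
  show "mu C [eta_arr X, theta_arr X] = idm C (unshift X)"
  proof (rule matrix_eqI[OF idm_arr_C[OF obj(2)]])
    fix i j
    show "Poly_Mapping.lookup (mu C [eta_arr X, theta_arr X]) (j, i) = Poly_Mapping.lookup (idm C (unshift X)) (j, i)"
      if "\<not> (i < length (src (id_arr C (unshift X))) \<and> j < length (tgt (id_arr C (unshift X))))"
      using that by (intro poly_mapping_eqI) (auto simp: left lookup_diag lookup_idm_C[OF obj(2)])
    fix \<beta>
    assume "i < length (src (id_arr C (unshift X)))"
    then show "Poly_Mapping.lookup (Poly_Mapping.lookup (mu C [eta_arr X, theta_arr X]) (j, i)) \<beta> =
        Poly_Mapping.lookup (Poly_Mapping.lookup (idm C (unshift X)) (j, i)) \<beta>"
      by (auto simp: left lookup_diag lookup_idm_C[OF obj(2)] lookup_single when_def signed_signed)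
        (simp add: signed_def)
  qed
  show "mu C [theta_arr X, eta_arr X] = idm C X"
  proof (rule matrix_eqI[OF idm_arr_C[OF obj(1)]])
    fix i j
    show "Poly_Mapping.lookup (mu C [theta_arr X, eta_arr X]) (j, i) = Poly_Mapping.lookup (idm C X) (j, i)"
      if "\<not> (i < length (src (id_arr C X)) \<and> j < length (tgt (id_arr C X)))"
      using that by (intro poly_mapping_eqI) (auto simp: left lookup_diag lookup_idm_C[OF obj(1)])
    fix \<beta>
    assume "i < length (src (id_arr C X))"
    then show "Poly_Mapping.lookup (Poly_Mapping.lookup (mu C [theta_arr X, eta_arr X]) (j, i)) \<beta> =
        Poly_Mapping.lookup (Poly_Mapping.lookup (idm C X) (j, i)) \<beta>"
      by (auto simp: left lookup_diag lookup_idm_C[OF obj(1)] lookup_single when_def signed_signed)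
        (simp add: signed_def)
  qed
qed

text \<open>For p = q = 0 the formula for \<open>lshift\<close> has no sign and no shift of
  exponents, so the retraction is a left inverse on the nose.\<close>

lemma mshift_unshifted:
  assumes f: "is_arr C f" and "\<forall>p\<in>snd ` set (src f). p = 0" "\<forall>p\<in>snd ` set (tgt f). p = 0"
  shows "mshift (src f) (tgt f) (val f) = val f"
proof (rule matrix_eqI[OF f])
  fix i j \<beta>
  assume "i < length (src f)" "j < length (tgt f)"
  then have "snd (src f ! i) = 0" "snd (tgt f ! j) = 0"
    using assms(2,3) by auto
  then show "Poly_Mapping.lookup (Poly_Mapping.lookup (mshift (src f) (tgt f) (val f)) (j, i)) \<beta> =
      Poly_Mapping.lookup (Poly_Mapping.lookup (val f) (j, i)) \<beta>"
    by (simp add: lookup_mshift lookup_lshift)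
qed (simp add: lookup_mshift)

lemma retract_ob_unshifted:
  assumes "X \<in> Obj S"
  shows "retract_ob X = X"
proof -
  have X: "X \<in> Obj T" "\<forall>p\<in>snd ` set (fst X). p = 0"
    using assms by (auto simp: unshifted_Tw_def)
  then show ?thesis
    using mshift_unshifted[OF is_arr_tw_diff[OF X(1)]] by (simp add: retract_ob_def unshift_id)
qed

lemma retract_unshifted:
  assumes "is_arr S f"
  shows "afmor retract f = val f"
proof -
  have f: "is_arr T f" "\<forall>p\<in>snd ` set (fst (src f)). p = 0" "\<forall>p\<in>snd ` set (fst (tgt f)). p = 0"
    using assms by (auto simp: unshifted_Tw_def is_arr_full)
  then show ?thesis
    using mshift_unshifted[of "tw_forget f"] by (simp add: is_arr_Tw retract_def)
qed

sublocale strict_retract S T inclusion retract "\<lambda>X. val (eta_arr (fst X))" "\<lambda>X. val (theta_arr (fst X))"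
proof (rule strict_retract.intro)
  show "ainf_functor S T inclusion"
    unfolding unshifted_Tw_def by (rule ainf_functor_inclusion[OF TW.ainf_category_Tw])
  show "ainf_functor T S retract"
    by (rule ainf_functor_retract)
  define e where "e X = Arr (retract_ob X) X 0 (val (eta_arr (fst X)))" for X :: "('o, int \<Rightarrow>\<^sub>0 'm) twisted"
  define t where "t X = Arr X (retract_ob X) 0 (val (theta_arr (fst X)))" for X :: "('o, int \<Rightarrow>\<^sub>0 'm) twisted"
  have forget: "tw_forget (e X) = eta_arr (fst X)" "tw_forget (t X) = theta_arr (fst X)" for X
    by (simp_all add: e_def t_def retract_ob_def)
  have src_tgt: "src (e X) = retract_ob X" "tgt (e X) = X" "src (t X) = X" "tgt (t X) = retract_ob X" for X
    by (simp_all add: e_def t_def)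
  have ul: "unitlike C (tw_forget (e X))" "unitlike C (tw_forget (t X))" if "X \<in> Obj T" for X
    unfolding forget using fst_Obj_Tw[OF that]
    by (auto intro: unitlike_diag unshift_Obj simp: map_fst_unshift)
  have arr: "is_arr T (e X)" "is_arr T (t X)" if "X \<in> Obj T" for X
    using ul[OF that] retract_ob_closed[OF that] that by (auto simp: is_arr_Tw unitlike_def src_tgt)
  \<comment> \<open>In \<open>Tw\<close>, \<mu>^1 of a unit-like morphism is the sum of its products
    with the two differentials. Naturality for the differential, which has degree 1, makes them
    opposite.\<close>
  have mu_e: "mu T [e X] = 0" if X: "X \<in> Obj T" for X
  proof -
    have "mu T [e X] = mu C [ushift (tw_diff X), eta_arr (fst X)] + mu C [eta_arr (fst X), tw_diff X]"
      using TW.mu_Tw_unitlike(4)[OF ul(1)[OF X], of "retract_ob X" "[]" "[]"] arr(1)[OF X] X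
      by (simp add: forget src_tgt tw_diff_retract)
    then show ?thesis
      using eta_natural[OF is_arr_tw_diff[OF X]] by (simp add: signed_def add_eq_0_iff)
  qed
  have mu_t: "mu T [t X] = 0" if X: "X \<in> Obj T" for X
  proof -
    have "mu T [t X] = mu C [tw_diff X, theta_arr (fst X)] + mu C [theta_arr (fst X), ushift (tw_diff X)]"
      using TW.mu_Tw_unitlike(4)[OF ul(2)[OF X], of X "[]" "[]"] arr(2)[OF X] retract_ob_closed[OF X]
      by (simp add: forget src_tgt tw_diff_retract)
    then show ?thesis
      using theta_natural[OF is_arr_tw_diff[OF X]] by (simp add: signed_def add_eq_0_iff)
  qed
  have afob: "afob inclusion (afob retract X) = retract_ob X" for X
    by (simp add: retract_def)
  show "strict_retract_axioms S T inclusion retract (\<lambda>X. val (eta_arr (fst X))) (\<lambda>X. val (theta_arr (fst X)))"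
  proof
    show "afob retract (afob inclusion X) = X" if "X \<in> Obj S" for X
      using retract_ob_unshifted[OF that] by (simp add: retract_def)
    show "afmor retract (af_arr inclusion f) = val f" if "is_arr S f" for f
      using retract_unshifted[OF that] by simp
  next
    fix X
    assume X: "X \<in> Obj T"
    show "val (eta_arr (fst X)) \<in> cocycles T (afob inclusion (afob retract X)) X 0"
      using arr(1)[OF X] mu_e[OF X] unfolding afob by (simp add: cocycles_def is_arr_def e_def)
    show "val (theta_arr (fst X)) \<in> cocycles T X (afob inclusion (afob retract X)) 0"
      using arr(2)[OF X] mu_t[OF X] unfolding afob by (simp add: cocycles_def is_arr_def t_def)
    have "mu T [e X, t X] = mu C [eta_arr (fst X), theta_arr (fst X)]"
      using TW.mu_Tw_unitlike(3)[OF ul(1)[OF X], of "retract_ob X" "[]" "[t X]" "t X"] arr[OF X] retract_ob_closed[OF X]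
      by (simp add: forget src_tgt)
    then show "mu T [Arr (afob inclusion (afob retract X)) X 0 (val (eta_arr (fst X))),
        Arr X (afob inclusion (afob retract X)) 0 (val (theta_arr (fst X)))] =
      idm T (afob inclusion (afob retract X))"
      using eta_theta(1)[OF fst_Obj_Tw[OF X]] unfolding afob by (simp add: e_def t_def retract_ob_def)
    have "mu T [t X, e X] = mu C [theta_arr (fst X), eta_arr (fst X)]"
      using TW.mu_Tw_unitlike(3)[OF ul(2)[OF X], of X "[]" "[e X]" "e X"] arr[OF X] X
      by (simp add: forget src_tgt)
    then show "mu T [Arr X (afob inclusion (afob retract X)) 0 (val (theta_arr (fst X))),
        Arr (afob inclusion (afob retract X)) X 0 (val (eta_arr (fst X)))] = idm T X"
      using eta_theta(2)[OF fst_Obj_Tw[OF X]] unfolding afob by (simp add: e_def t_def)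
  next
    fix f
    assume f: "is_arr T f"
    then have obj: "src f \<in> Obj T" "tgt f \<in> Obj T" and fC: "is_arr C (tw_forget f)"
      by (auto simp: is_arr_Tw)
    have Rf: "is_arr T (af_arr retract f)"
      using retract_closed[OF f] by (simp add: unshifted_Tw_def is_arr_full)
    have 1: "mu T [af_arr retract f, e (tgt f)] = mu C [ushift (tw_forget f), eta_arr (fst (tgt f))]"
      using TW.mu_Tw_unitlike(2)[OF ul(1)[OF obj(2)], of "retract_ob (src f)" "[af_arr retract f]" "[]" "af_arr retract f"]
        Rf arr(1)[OF obj(2)] obj
      by (simp add: forget src_tgt af_arr_retract tw_forget_retract)
    have 2: "mu T [e (src f), f] = mu C [eta_arr (fst (src f)), tw_forget f]"
      using TW.mu_Tw_unitlike(3)[OF ul(1)[OF obj(1)], of "retract_ob (src f)" "[]" "[f]" f] f arr(1)[OF obj(1)] obj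
      by (simp add: forget src_tgt)
    show "signed (deg f) (mu T [af_arr inclusion (af_arr retract f),
        Arr (afob inclusion (afob retract (tgt f))) (tgt f) 0 (val (eta_arr (fst (tgt f))))]) =
      mu T [Arr (afob inclusion (afob retract (src f))) (src f) 0 (val (eta_arr (fst (src f)))), f]"
      using 1 2 eta_natural[OF fC] unfolding afob af_arr_inclusion e_def by simp
  qed
qed

end

theorem mainTheorem4:
  fixes A :: "('k::field, 'o, 'm::ab_group_add) ainf"
  assumes "ainf_category A"
  shows "has_retraction (Z0 (unshifted_Tw A)) (Z0 (Tw (laurent A))) (Z0_map inclusion) \<and>
    equivalence (Z0 (unshifted_Tw A)) (Z0 (Tw (laurent A))) (Z0_map inclusion) \<and>
    quasi_equivalence (unshifted_Tw A) (Tw (laurent A)) inclusion"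
proof -
  interpret laurent_twisted A
    by (rule laurent_twisted.intro) (rule assms)
  show ?thesis
    using has_retraction_Z0 equivalence_Z0 quasi_equivalence_strict_retract by blast
qed

end
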